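(* Let $H\in(0,1)$, $\rho<1/(2H)$ and $T>0$. Then there exists $\gamma>1/2$ such that, for almost every $w\in C([0,T];\mathbb R^d)$ with respect to the law of the $d$-dimensional fractional Brownian motion of Hurst index $H$, there is a constant $C_{w,\gamma,\rho}<\infty$ depending only on $w,\gamma,\rho$ such that for every $\alpha\in\mathbb R$ and all $0\le s\le t\le T$ the averaging operator is bounded from $\mathcal FL^\alpha$ to $\mathcal FL^{\alpha+\rho}$ and satisfies $$\|T^w_t-T^w_s\|_{\mathcal L(\mathcal FL^\alpha;\mathcal FL^{\alpha+\rho})}\le C_{w,\gamma,\rho}\,|t-s|^\gamma .$$ In other words $T^w\in\mathscr C^\gamma([0,T];\mathcal L(\mathcal FL^\alpha,\mathcal FL^{\alpha+\rho}))$, the space of $\gamma$-Hölder maps of time into bounded operators.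
   Context: Fractional Brownian motion of Hurst index $H\in(0,1)$ in $\mathbb R^d$: the centered continuous Gaussian process with i.i.d. components, each with covariance proportional (by a positive constant) to $t^{2H}+s^{2H}-|t-s|^{2H}$. Fourier–Lebesgue space: for $\alpha\in\mathbb R$, $\mathcal FL^\alpha=\{f\in\mathcal S'(\mathbb R^d):\hat f \text{ is a function and } N_\alpha(f)=\int_{\mathbb R^d}|\hat f(\xi)|(1+|\xi|)^\alpha\,d\xi<\infty\}$, normed by $N_\alpha$. Averaging operator: for $w\in C([0,T];\mathbb R^d)$ and bounded continuous $f$, $T^w_tf(x)=\int_0^tf(x+w_r)\,dr$. For $f\in\mathcal FL^\alpha$ with arbitrary $\alpha\in\mathbb R$, $T^w_tf$ is the tempered distribution $\int_0^tf(\cdot+w_r)\,dr$, i.e. the one with Fourier transform $\hat f(\xi)\int_0^te^{i\langle\xi,w_r\rangle}\,dr$; this is the extension of the operator by density and continuity. *)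

theory Defs
  imports "HOL-Probability.Probability"
begin

section \<open>Schwartz functions and tempered distributions\<close>

definition partial_deriv :: "'d \<Rightarrow> (real^'d \<Rightarrow> complex) \<Rightarrow> real^'d \<Rightarrow> complex" where
  "partial_deriv j \<phi> x = frechet_derivative \<phi> (at x) (axis j 1)"

primrec iter_partial :: "'d list \<Rightarrow> (real^'d \<Rightarrow> complex) \<Rightarrow> real^'d \<Rightarrow> complex" where
  "iter_partial [] \<phi> = \<phi>"
| "iter_partial (j # js) \<phi> = partial_deriv j (iter_partial js \<phi>)"

definition schwartz :: "(real^'d \<Rightarrow> complex) \<Rightarrow> bool" where
  "schwartz \<phi> \<longleftrightarrow>
     (\<forall>js x. iter_partial js \<phi> differentiable (at x)) \<and>
     (\<forall>js k. \<exists>K. \<forall>x. (1 + norm x) ^ k * cmod (iter_partial js \<phi> x) \<le> K)"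

definition schwartz_seminorm :: "nat \<Rightarrow> (real^'d \<Rightarrow> complex) \<Rightarrow> real" where
  "schwartz_seminorm N \<phi> =
     (\<Sum>js | length js \<le> N. SUP x. (1 + norm x) ^ N * cmod (iter_partial js \<phi> x))"

type_synonym 'd functional = "(real^'d \<Rightarrow> complex) \<Rightarrow> complex"

text \<open>
  A tempered distribution is represented by a functional on all functions which vanishes, by
  convention, outside the Schwartz space. Hence equality of functionals is equality of
  distributions. The last conjunct is continuity for the Frechet topology of the Schwartz space,
  the seminorms being increasing in the index.
\<close>

definition tempered_distribution :: "('d::finite) functional \<Rightarrow> bool" where
  "tempered_distribution u \<longleftrightarrow>
     (\<forall>\<phi>. \<not> schwartz \<phi> \<longrightarrow> u \<phi> = 0) \<and>
     (\<forall>\<phi> \<psi>. schwartz \<phi> \<longrightarrow> schwartz \<psi> \<longrightarrow> u (\<lambda>x. \<phi> x + \<psi> x) = u \<phi> + u \<psi>) \<and>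
     (\<forall>c \<phi>. schwartz \<phi> \<longrightarrow> u (\<lambda>x. c * \<phi> x) = c * u \<phi>) \<and>
     (\<exists>N K. \<forall>\<phi>. schwartz \<phi> \<longrightarrow> cmod (u \<phi>) \<le> K * schwartz_seminorm N \<phi>)"

definition fourier :: "(real^'d \<Rightarrow> complex) \<Rightarrow> real^'d \<Rightarrow> complex" where
  "fourier \<phi> \<xi> = (\<integral>x. exp (- (\<i> * complex_of_real (x \<bullet> \<xi>))) * \<phi> x \<partial>lborel)"

definition fourier_distribution :: "('d::finite) functional \<Rightarrow> 'd functional" where
  "fourier_distribution u = (\<lambda>\<phi>. if schwartz \<phi> then u (fourier \<phi>) else 0)"

definition represented_by :: "('d::finite) functional \<Rightarrow> (real^'d \<Rightarrow> complex) \<Rightarrow> bool" where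
  "represented_by u g \<longleftrightarrow>
     g \<in> borel_measurable lborel \<and>
     (\<forall>\<phi>. schwartz \<phi> \<longrightarrow>
        integrable lborel (\<lambda>\<xi>. g \<xi> * \<phi> \<xi>) \<and> u \<phi> = (\<integral>\<xi>. g \<xi> * \<phi> \<xi> \<partial>lborel))"


section \<open>Fourier-Lebesgue spaces and their bounded operators\<close>

text \<open>
  The function representing a Fourier transform is unique up to null sets, so the choice
  below does not affect the norm.
\<close>

definition fourier_function :: "('d::finite) functional \<Rightarrow> real^'d \<Rightarrow> complex" where
  "fourier_function u = (SOME g. represented_by (fourier_distribution u) g)"

definition FL :: "real \<Rightarrow> ('d::finite) functional set" where
  "FL \<alpha> = {u. tempered_distribution u \<and>
     (\<exists>g. represented_by (fourier_distribution u) g) \<and>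
     integrable lborel (\<lambda>\<xi>. cmod (fourier_function u \<xi>) * (1 + norm \<xi>) powr \<alpha>)}"

definition FL_norm :: "real \<Rightarrow> ('d::finite) functional \<Rightarrow> real" where
  "FL_norm \<alpha> u = (\<integral>\<xi>. cmod (fourier_function u \<xi>) * (1 + norm \<xi>) powr \<alpha> \<partial>lborel)"

definition FL_bounded_operator :: "real \<Rightarrow> real \<Rightarrow> (('d::finite) functional \<Rightarrow> 'd functional) \<Rightarrow> bool" where
  "FL_bounded_operator \<alpha> \<beta> A \<longleftrightarrow>
     (\<forall>u\<in>FL \<alpha>. A u \<in> FL \<beta>) \<and>
     (\<forall>u\<in>FL \<alpha>. \<forall>v\<in>FL \<alpha>. A (\<lambda>\<phi>. u \<phi> + v \<phi>) = (\<lambda>\<phi>. A u \<phi> + A v \<phi>)) \<and>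
     (\<forall>c. \<forall>u\<in>FL \<alpha>. A (\<lambda>\<phi>. c * u \<phi>) = (\<lambda>\<phi>. c * A u \<phi>)) \<and>
     (\<exists>K. \<forall>u\<in>FL \<alpha>. FL_norm \<beta> (A u) \<le> K * FL_norm \<alpha> u)"

text \<open>As in \<^const>\<open>onorm\<close>, the zero element contributes the quotient \<open>0 / 0 = 0\<close>.\<close>

definition FL_onorm :: "real \<Rightarrow> real \<Rightarrow> (('d::finite) functional \<Rightarrow> 'd functional) \<Rightarrow> real" where
  "FL_onorm \<alpha> \<beta> A = (SUP u\<in>FL \<alpha>. FL_norm \<beta> (A u) / FL_norm \<alpha> u)"


section \<open>The averaging operator\<close>

text \<open>
  The distribution \<open>\<integral>\<^sub>0\<^sup>t f(\<cdot> + w\<^sub>r) dr\<close>: the translate of \<open>f\<close> by \<open>w\<^sub>r\<close> acts on a test function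
  through the opposite translation. With the sign convention of \<^const>\<open>fourier\<close>, its Fourier
  transform is that of \<open>f\<close> times \<open>\<integral>\<^sub>0\<^sup>t exp (i \<langle>\<xi>, w\<^sub>r\<rangle>) dr\<close>.
\<close>

definition averaging :: "(real \<Rightarrow> real^'d) \<Rightarrow> real \<Rightarrow> ('d::finite) functional \<Rightarrow> 'd functional" where
  "averaging w t f = (\<lambda>\<phi>. LINT r:{0..t}|lborel. f (\<lambda>x. \<phi> (x - w r)))"


section \<open>Fractional Brownian motion\<close>

text \<open>Point masses count as Gaussian; they occur at time 0.\<close>

definition gaussian_rv :: "'w measure \<Rightarrow> ('w \<Rightarrow> real) \<Rightarrow> bool" where
  "gaussian_rv M X \<longleftrightarrow>
     X \<in> borel_measurable M \<and>
     ((\<exists>m. AE \<omega> in M. X \<omega> = m) \<or>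
      (\<exists>m \<sigma>. 0 < \<sigma> \<and> distributed M lborel X (\<lambda>x. ennreal (normal_density m \<sigma> x))))"

definition gaussian_process :: "'w measure \<Rightarrow> real set \<Rightarrow> (real \<Rightarrow> 'w \<Rightarrow> real) \<Rightarrow> bool" where
  "gaussian_process M I X \<longleftrightarrow>
     (\<forall>F a. finite F \<longrightarrow> F \<subseteq> I \<longrightarrow> gaussian_rv M (\<lambda>\<omega>. \<Sum>t\<in>F. a t * X t \<omega>))"

definition scalar_fbm ::
  "'w measure \<Rightarrow> real \<Rightarrow> real \<Rightarrow> real \<Rightarrow> (real \<Rightarrow> 'w \<Rightarrow> real) \<Rightarrow> bool" where
  "scalar_fbm M H c T X \<longleftrightarrow>
     gaussian_process M {0..T} X \<and>
     (\<forall>t\<in>{0..T}. (\<integral>\<omega>. X t \<omega> \<partial>M) = 0) \<and>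
     (\<forall>s\<in>{0..T}. \<forall>t\<in>{0..T}. (\<integral>\<omega>. X s \<omega> * X t \<omega> \<partial>M) =
        c * (t powr (2 * H) + s powr (2 * H) - \<bar>t - s\<bar> powr (2 * H))) \<and>
     (\<forall>\<omega>\<in>space M. continuous_on {0..T} (\<lambda>t. X t \<omega>))"

text \<open>
  The components are independent as processes; having the same covariance, the centered Gaussian
  components are also identically distributed.
\<close>

definition fractional_brownian_motion ::
  "'w measure \<Rightarrow> real \<Rightarrow> real \<Rightarrow> (real \<Rightarrow> 'w \<Rightarrow> real^'d) \<Rightarrow> bool" where
  "fractional_brownian_motion M H T B \<longleftrightarrow>
     prob_space M \<and>
     (\<exists>c>0. \<forall>j. scalar_fbm M H c T (\<lambda>t \<omega>. B t \<omega> $ j)) \<and>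
     prob_space.indep_vars M (\<lambda>_. \<Pi>\<^sub>M t\<in>{0..T}. borel)
       (\<lambda>j \<omega>. \<lambda>t\<in>{0..T}. B t \<omega> $ j) UNIV"

text \<open>
  The continuous paths on \<open>[0,T]\<close>, as functions that are \<^const>\<open>undefined\<close> outside of it. The
  sigma-algebra is generated by the evaluation maps, which is also the Borel sigma-algebra of
  the topology of uniform convergence.
\<close>

definition path_space :: "real \<Rightarrow> (real \<Rightarrow> real^'d) measure" where
  "path_space T = restrict_space (\<Pi>\<^sub>M t\<in>{0..T}. borel) {w. continuous_on {0..T} w}"

definition path_law :: "'w measure \<Rightarrow> real \<Rightarrow> (real \<Rightarrow> 'w \<Rightarrow> real^'d) \<Rightarrow> (real \<Rightarrow> real^'d) measure" where
  "path_law M T B = distr M (path_space T) (\<lambda>\<omega>. \<lambda>t\<in>{0..T}. B t \<omega>)"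

end

theory Submission
  imports Defs "HOL-Combinatorics.Permutations"
begin

text \<open>
  On the Fourier side the averaging operator is multiplication by
  \<open>\<Phi>\<^sub>t(\<xi>) = \<integral>\<^sub>0\<^sup>t exp (i \<langle>\<xi>, w\<^sub>r\<rangle>) dr\<close>, so it suffices to bound
  \<open>\<bar>\<Phi>\<^sub>t(\<xi>) - \<Phi>\<^sub>s(\<xi>)\<bar>\<close> by \<open>C \<bar>t - s\<bar>\<^sup>\<gamma> (1 + \<bar>\<xi>\<bar>)\<^sup>-\<^sup>\<rho>\<close> for almost every path.
  The moment of order \<open>2n\<close> of this increment is the integral over \<open>[s,t]\<^sup>2\<^sup>n\<close> of
  \<open>exp (- \<bar>\<xi>\<bar>\<^sup>2 V / 2)\<close>, where \<open>V\<close> is the variance of a signed sum of \<open>2n\<close> values of the scalar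
  process. By the Mandelbrot--Van Ness representation, \<open>V\<close> is a squared \<open>L\<^sup>2\<close> norm in which the
  newest increment charges an interval of its own; this local nondeterminism bounds \<open>V\<close> below by
  the sum of \<open>(r\<^sub>2\<^sub>k - r\<^sub>2\<^sub>k\<^sub>-\<^sub>1)\<^sup>2\<^sup>H\<close> over the ordered times, since every second partial sum of the signs
  is a nonzero integer. For \<open>\<theta> < 1\<close> the moment is therefore at most a constant times
  \<open>\<bar>t - s\<bar>\<close> to the power \<open>n (2 - \<theta>)\<close> and \<open>1 + \<bar>\<xi>\<bar>\<close> to the power \<open>- n \<theta> / H\<close>. With \<open>\<theta>\<close> close to 1 and
  \<open>n\<close> large, a union bound over dyadic times and a polynomially fine grid of frequencies,
  followed by chaining, gives the claim.
\<close>

section \<open>Schwartz functions\<close>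

text \<open>Both exponents come from one parameter. Trading the exponential of the variance for a
  power turns each pair of times into |a - b|^(-\<theta>), whose integrability near the diagonal is
  exactly \<theta> < 1. The 2n-th root of the moment then scales like (t - s)^(1 - \<theta>/2) (1 +
  |\<xi>|)^(-\<theta>/(2H)): a time exponent above 1/2, and, as \<theta> tends to 1, every \<rho> <
  1/(2H). The obstacle is uniformity over a continuum of frequencies. The root exponents do not
  change with n, while the number of grid points in the N-th shell is a power of N independent of n,
  so a large n outweighs it. Off the grid a path-dependent Lipschitz bound in \<xi> takes over,
  which dictates the mesh N^(-K) with K \<ge> \<rho>. The constant does not see \<alpha> because a
  multiplier acts pointwise in \<xi>, where the weight of order \<alpha> factors out. Finally, the
  elements of the spaces are functionals whose Fourier transforms are picked by choice; that
  Schwartz functions separate measurable functions must be shown before any norm can be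
  compared.\<close>

lemma partial_deriv_eqI:
  "(f has_derivative f') (at x) \<Longrightarrow> partial_deriv j f x = f' (axis j 1)"
  unfolding partial_deriv_def by (metis frechet_derivative_at)

lemma has_derivative_translate:
  fixes f :: "real^'d \<Rightarrow> complex"
  assumes "(f has_derivative D) (at (x - a))"
  shows "((\<lambda>x. f (x - a)) has_derivative D) (at x)"
proof -
  have "((\<lambda>x. x - a) has_derivative (\<lambda>h. h)) (at x)"
    by (auto intro!: derivative_eq_intros)
  from has_derivative_compose[OF this assms] show ?thesis by simp
qed

lemma has_derivative_translate_iff:
  fixes f :: "real^'d \<Rightarrow> complex"
  shows "((\<lambda>x. f (x - a)) has_derivative D) (at x) \<longleftrightarrow> (f has_derivative D) (at (x - a))"
proof
  assume "((\<lambda>x. f (x - a)) has_derivative D) (at x)"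
  then have "((\<lambda>y. f (y - (- a) - a)) has_derivative D) (at (x - a))"
    by (intro has_derivative_translate[of "\<lambda>x. f (x - a)" D "x - a" "- a"]) simp
  then show "(f has_derivative D) (at (x - a))" by simp
qed (rule has_derivative_translate)

text \<open>Holds for arbitrary functions: \<open>frechet_derivative\<close> is a choice from the
  set of derivatives, and by \<open>has_derivative_translate_iff\<close> both choices are made from
  the same set.\<close>

lemma partial_deriv_translate:
  "partial_deriv j (\<lambda>x. f (x - a)) = (\<lambda>x. partial_deriv j f (x - a))"
  by (simp add: partial_deriv_def[abs_def] frechet_derivative_def has_derivative_translate_iff)

lemma iter_partial_translate:
  "iter_partial js (\<lambda>x. f (x - a)) = (\<lambda>x. iter_partial js f (x - a))"
  by (induction js) (simp_all add: partial_deriv_translate)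

lemma schwartz_differentiable: "schwartz \<phi> \<Longrightarrow> \<phi> differentiable (at x)"
  unfolding schwartz_def by (metis iter_partial.simps(1))

lemma schwartz_decay: "schwartz \<phi> \<Longrightarrow> \<exists>K. \<forall>x. (1 + norm x) ^ k * cmod (\<phi> x) \<le> K"
  unfolding schwartz_def by (metis iter_partial.simps(1))

text \<open>Replaces a Leibniz formula for iterated derivatives: it suffices to exhibit a family
  that contains \<open>\<phi>\<close>, is stable under each \<open>partial_deriv j\<close> and
  decays rapidly. Linear combinations, modulations and Gaussian products below each come with such a
  family.\<close>

lemma schwartzI_closed:
  assumes "\<phi> \<in> S"
    and "\<And>\<psi> x. \<psi> \<in> S \<Longrightarrow> \<psi> differentiable (at x)"
    and "\<And>\<psi> j. \<psi> \<in> S \<Longrightarrow> partial_deriv j \<psi> \<in> S"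
    and "\<And>\<psi> k. \<psi> \<in> S \<Longrightarrow> \<exists>K. \<forall>x. (1 + norm x) ^ k * cmod (\<psi> x) \<le> K"
  shows "schwartz \<phi>"
proof -
  have "iter_partial js \<phi> \<in> S" for js
    by (induction js) (auto simp: assms)
  then show ?thesis unfolding schwartz_def using assms by blast
qed

lemma iter_partial_append: "iter_partial (js @ ks) \<phi> = iter_partial js (iter_partial ks \<phi>)"
  by (induction js) auto

lemma schwartz_iter_partial: "schwartz \<phi> \<Longrightarrow> schwartz (iter_partial ks \<phi>)"
  unfolding schwartz_def iter_partial_append[symmetric] by blast

lemma schwartz_partial_deriv: "schwartz \<phi> \<Longrightarrow> schwartz (partial_deriv j \<phi>)"
  using schwartz_iter_partial[of \<phi> "[j]"] by simp

lemma schwartz_has_derivative: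
  "schwartz \<phi> \<Longrightarrow> (\<phi> has_derivative frechet_derivative \<phi> (at x)) (at x)"
  by (simp add: schwartz_differentiable frechet_derivative_works[symmetric])

lemma schwartz_lincomb:
  fixes \<phi> \<psi> :: "real^'d \<Rightarrow> complex"
  assumes "schwartz \<phi>" "schwartz \<psi>"
  shows "schwartz (\<lambda>x. a * \<phi> x + b * \<psi> x)"
proof (rule schwartzI_closed)
  let ?S = "{f. \<exists>\<phi> \<psi>. schwartz \<phi> \<and> schwartz \<psi> \<and> f = (\<lambda>x. a * \<phi> x + b * \<psi> x)}"
  show "(\<lambda>x. a * \<phi> x + b * \<psi> x) \<in> ?S" using assms by blast
  fix f assume "f \<in> ?S"
  then obtain \<phi> \<psi> where s: "schwartz \<phi>" "schwartz \<psi>" and f: "f = (\<lambda>x. a * \<phi> x + b * \<psi> x)" by blast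
  have D: "(f has_derivative (\<lambda>h. a * frechet_derivative \<phi> (at x) h + b * frechet_derivative \<psi> (at x) h)) (at x)" for x
    unfolding f by (auto intro!: derivative_eq_intros schwartz_has_derivative s)
  then show "f differentiable (at x)" for x using differentiableI by blast
  have "partial_deriv j f = (\<lambda>x. a * partial_deriv j \<phi> x + b * partial_deriv j \<psi> x)" for j
    using partial_deriv_eqI[OF D] by (auto simp: partial_deriv_def)
  then show "partial_deriv j f \<in> ?S" for j
    using schwartz_partial_deriv s by blast
  fix k
  obtain K L where K: "\<And>x. (1 + norm x) ^ k * cmod (\<phi> x) \<le> K" and L: "\<And>x. (1 + norm x) ^ k * cmod (\<psi> x) \<le> L"
    using schwartz_decay[OF s(1), of k] schwartz_decay[OF s(2), of k] by blast
  have "(1 + norm x) ^ k * cmod (f x) \<le> cmod a * K + cmod b * L" for x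
  proof -
    have "(1 + norm x) ^ k * cmod (f x) \<le> (1 + norm x) ^ k * (cmod a * cmod (\<phi> x) + cmod b * cmod (\<psi> x))"
      unfolding f by (intro mult_left_mono) (metis norm_mult norm_triangle_ineq, simp)
    also have "\<dots> = cmod a * ((1 + norm x) ^ k * cmod (\<phi> x)) + cmod b * ((1 + norm x) ^ k * cmod (\<psi> x))"
      by (simp add: algebra_simps)
    also have "\<dots> \<le> cmod a * K + cmod b * L"
      by (intro add_mono mult_left_mono K L) auto
    finally show ?thesis .
  qed
  then show "\<exists>K. \<forall>x. (1 + norm x) ^ k * cmod (f x) \<le> K" by blast
qed

text \<open>A Peetre-type inequality; it makes the bounds on translates locally uniform in the
  shift.\<close>

lemma one_plus_norm_power_le:
  fixes x y :: "'a::real_normed_vector"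
  assumes "norm (x - y) \<le> r"
  shows "(1 + norm x) ^ k \<le> (1 + r) ^ k * (1 + norm y) ^ k"
proof -
  have r: "0 \<le> r" using assms norm_ge_zero order_trans by blast
  have "norm x \<le> r + norm y" using assms norm_triangle_sub[of x y] by linarith
  then have "1 + norm x \<le> (1 + r) * (1 + norm y)"
    using mult_nonneg_nonneg[OF r norm_ge_zero[of y]] by (simp add: algebra_simps)
  then show ?thesis by (metis power_mono power_mult_distrib norm_ge_zero add_nonneg_nonneg zero_le_one)
qed

lemma schwartz_translate:
  assumes "schwartz \<phi>" shows "schwartz (\<lambda>x. \<phi> (x - a))"
  unfolding schwartz_def iter_partial_translate
proof (intro conjI allI)
  fix js x
  show "(\<lambda>x. iter_partial js \<phi> (x - a)) differentiable (at x)"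
    using schwartz_has_derivative[OF schwartz_iter_partial[OF assms]] has_derivative_translate differentiableI by blast
next
  fix js k
  obtain K where K: "\<And>x. (1 + norm x) ^ k * cmod (iter_partial js \<phi> x) \<le> K"
    using assms unfolding schwartz_def by blast
  have "(1 + norm x) ^ k * cmod (iter_partial js \<phi> (x - a)) \<le> (1 + norm a) ^ k * K" for x
  proof -
    have "(1 + norm x) ^ k * cmod (iter_partial js \<phi> (x - a))
        \<le> ((1 + norm a) ^ k * (1 + norm (x - a)) ^ k) * cmod (iter_partial js \<phi> (x - a))"
      by (intro mult_right_mono one_plus_norm_power_le) auto
    also have "\<dots> \<le> (1 + norm a) ^ k * K"
      unfolding mult.assoc by (intro mult_left_mono K) auto
    finally show ?thesis .
  qed
  then show "\<exists>K. \<forall>x. (1 + norm x) ^ k * cmod (iter_partial js \<phi> (x - a)) \<le> K" by blast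
qed

lemma schwartz_translate_iff: "schwartz (\<lambda>x. \<phi> (x - a)) \<longleftrightarrow> schwartz \<phi>"
  using schwartz_translate[of "\<lambda>x. \<phi> (x - a)" "- a"] schwartz_translate[of \<phi> a] by auto

lemma schwartz_modulate:
  fixes \<phi> :: "real^'d \<Rightarrow> complex"
  assumes "schwartz \<phi>"
  shows "schwartz (\<lambda>x. iexp (x \<bullet> a) * \<phi> x)"
proof (rule schwartzI_closed)
  define e where "e x = iexp (x \<bullet> a)" for x
  let ?S = "{f. \<exists>\<phi>. schwartz \<phi> \<and> f = (\<lambda>x. iexp (x \<bullet> a) * \<phi> x)}"
  show "(\<lambda>x. iexp (x \<bullet> a) * \<phi> x) \<in> ?S" using assms by blast
  fix f assume "f \<in> ?S"
  then obtain \<phi> where s: "schwartz \<phi>" and f: "f = (\<lambda>x. e x * \<phi> x)" by (auto simp: e_def)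
  have E: "(e has_derivative (\<lambda>h. \<i> * complex_of_real (h \<bullet> a) * e x)) (at x)" for x
  proof -
    have "((\<lambda>x. \<i> * complex_of_real (x \<bullet> a)) has_derivative (\<lambda>h. \<i> * complex_of_real (h \<bullet> a))) (at x)"
      by (auto intro!: derivative_eq_intros)
    from has_derivative_compose[OF this DERIV_exp[unfolded has_field_derivative_def]]
    show ?thesis by (simp add: e_def[abs_def] mult_ac)
  qed
  have D: "(f has_derivative (\<lambda>h. e x * frechet_derivative \<phi> (at x) h + \<i> * complex_of_real (h \<bullet> a) * e x * \<phi> x)) (at x)" for x
    unfolding f by (rule has_derivative_mult[OF E schwartz_has_derivative[OF s]])
  then show "f differentiable (at x)" for x using differentiableI by blast
  have "partial_deriv j f = (\<lambda>x. e x * (1 * partial_deriv j \<phi> x + \<i> * complex_of_real (a $ j) * \<phi> x))" for j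
    using partial_deriv_eqI[OF D, of j]
    by (auto simp: partial_deriv_def algebra_simps inner_axis' fun_eq_iff)
  moreover have "schwartz (\<lambda>x. 1 * partial_deriv j \<phi> x + \<i> * complex_of_real (a $ j) * \<phi> x)" for j
    by (rule schwartz_lincomb[OF schwartz_partial_deriv[OF s] s])
  ultimately show "partial_deriv j f \<in> ?S" for j
    unfolding e_def by blast
  show "\<exists>K. \<forall>x. (1 + norm x) ^ k * cmod (f x) \<le> K" for k
    using schwartz_decay[OF s, of k] by (simp add: f e_def norm_mult)
qed

text \<open>Translation on one side of the Fourier transform is modulation on the other; this turns
  the shift by \<open>w r\<close> into the phase of the multiplier.\<close>

lemma fourier_translate:
  "fourier \<phi> (x - a) = fourier (\<lambda>y. iexp (y \<bullet> a) * \<phi> y) x"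
proof -
  have "exp (- (\<i> * complex_of_real (y \<bullet> (x - a)))) =
     exp (- (\<i> * complex_of_real (y \<bullet> x))) * iexp (y \<bullet> a)" for y :: "real^'a"
    by (simp add: exp_add[symmetric] inner_diff_right algebra_simps)
  then show ?thesis unfolding fourier_def by (simp add: mult.assoc)
qed

section \<open>Schwartz seminorms of translates\<close>

lemma schwartz_seminorm_bounds:
  fixes \<phi> :: "real^'d \<Rightarrow> complex"
  assumes "\<And>js x. length js \<le> N \<Longrightarrow> (1 + norm x) ^ N * cmod (iter_partial js \<phi> x) \<le> K js"
  shows "schwartz_seminorm N \<phi> \<le> (\<Sum>js | length js \<le> N. K js)"
  unfolding schwartz_seminorm_def by (intro sum_mono cSUP_least) (auto intro: assms)

lemma schwartz_bdd_above:
  "schwartz \<phi> \<Longrightarrow> bdd_above (range (\<lambda>x. (1 + norm x) ^ N * cmod (iter_partial js \<phi> x)))"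
  unfolding schwartz_def bdd_above_def by blast

lemma schwartz_seminorm_nonneg:
  assumes "schwartz \<phi>" shows "0 \<le> schwartz_seminorm N \<phi>"
  unfolding schwartz_seminorm_def
proof (intro sum_nonneg)
  fix js
  have "0 \<le> (1 + norm (0 :: real^'a)) ^ N * cmod (iter_partial js \<phi> 0)" by simp
  also have "\<dots> \<le> (SUP x. (1 + norm x) ^ N * cmod (iter_partial js \<phi> x))"
    by (rule cSUP_upper[OF UNIV_I schwartz_bdd_above[OF assms]])
  finally show "0 \<le> (SUP x. (1 + norm x) ^ N * cmod (iter_partial js \<phi> x))" .
qed

lemma schwartz_seminorm_translate:
  assumes "schwartz \<phi>"
  shows "schwartz_seminorm N (\<lambda>x. \<phi> (x - a)) \<le> (1 + norm a) ^ N * schwartz_seminorm N \<phi>"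
proof -
  have "schwartz_seminorm N (\<lambda>x. \<phi> (x - a)) \<le>
     (\<Sum>js | length js \<le> N. (1 + norm a) ^ N * (SUP x. (1 + norm x) ^ N * cmod (iter_partial js \<phi> x)))"
  proof (rule schwartz_seminorm_bounds)
    fix js x
    have "(1 + norm x) ^ N * cmod (iter_partial js \<phi> (x - a))
        \<le> ((1 + norm a) ^ N * (1 + norm (x - a)) ^ N) * cmod (iter_partial js \<phi> (x - a))"
      by (intro mult_right_mono one_plus_norm_power_le) auto
    also have "\<dots> \<le> (1 + norm a) ^ N * (SUP x. (1 + norm x) ^ N * cmod (iter_partial js \<phi> x))"
      unfolding mult.assoc by (intro mult_left_mono cSUP_upper schwartz_bdd_above[OF assms]) auto
    finally show "(1 + norm x) ^ N * cmod (iter_partial js (\<lambda>x. \<phi> (x - a)) x)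
        \<le> (1 + norm a) ^ N * (SUP x. (1 + norm x) ^ N * cmod (iter_partial js \<phi> x))"
      by (simp add: iter_partial_translate)
  qed
  then show ?thesis by (simp add: schwartz_seminorm_def sum_distrib_left)
qed

lemma iter_partial_lincomb:
  assumes "schwartz \<phi>" "schwartz \<psi>"
  shows "iter_partial js (\<lambda>x. a * \<phi> x + b * \<psi> x) = (\<lambda>x. a * iter_partial js \<phi> x + b * iter_partial js \<psi> x)"
proof (induction js)
  case (Cons j js)
  have "((\<lambda>x. a * iter_partial js \<phi> x + b * iter_partial js \<psi> x) has_derivative
     (\<lambda>h. a * frechet_derivative (iter_partial js \<phi>) (at x) h + b * frechet_derivative (iter_partial js \<psi>) (at x) h)) (at x)" for x
    by (auto intro!: derivative_eq_intros schwartz_has_derivative schwartz_iter_partial assms)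
  from partial_deriv_eqI[OF this] show ?case by (auto simp: Cons partial_deriv_def)
qed simp

text \<open>Mean value inequality on the ball of radius \<open>R\<close> around \<open>x\<close>,
  which contains both shifted points. There the derivative is bounded through the partial
  derivatives, and the weight at \<open>x\<close> is comparable with the weight at every point of
  the ball.\<close>

lemma schwartz_increment_bound:
  fixes \<psi> :: "real^'d \<Rightarrow> complex"
  assumes "schwartz \<psi>"
  shows "\<exists>K\<ge>0. \<forall>x a b. norm a \<le> R \<longrightarrow> norm b \<le> R \<longrightarrow> (1 + norm x) ^ N * cmod (\<psi> (x - a) - \<psi> (x - b)) \<le> K * norm (a - b)"
proof -
  have "\<exists>k. \<forall>x. (1 + norm x) ^ N * cmod (partial_deriv j \<psi> x) \<le> k" for j
    using schwartz_decay[OF schwartz_partial_deriv[OF assms]] by blast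
  then obtain k where k: "\<And>j x. (1 + norm x) ^ N * cmod (partial_deriv j \<psi> x) \<le> k j" by metis
  define K where "K = (1 + R) ^ N * (\<Sum>j\<in>UNIV. k j)"
  have "(1 + norm x) ^ N * cmod (\<psi> (x - a) - \<psi> (x - b)) \<le> K * norm (a - b)"
    if R: "norm a \<le> R" "norm b \<le> R" for x a b
  proof -
    define B where "B = K / (1 + norm x) ^ N"
    have D: "onorm (frechet_derivative \<psi> (at y)) \<le> B" if y: "y \<in> cball x R" for y
    proof (rule onorm_le)
      fix h :: "real^'d"
      have lin: "linear (frechet_derivative \<psi> (at y))"
        using schwartz_has_derivative[OF assms] has_derivative_linear by blast
      have "frechet_derivative \<psi> (at y) h = frechet_derivative \<psi> (at y) (\<Sum>j\<in>UNIV. (h $ j) *\<^sub>R axis j 1)"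
        by (simp add: basis_expansion[of h, unfolded scalar_mult_eq_scaleR])
      also have "\<dots> = (\<Sum>j\<in>UNIV. (h $ j) *\<^sub>R partial_deriv j \<psi> y)"
        by (simp add: linear_sum[OF lin] linear_scale[OF lin] partial_deriv_def)
      finally have "norm (frechet_derivative \<psi> (at y) h) \<le> (\<Sum>j\<in>UNIV. norm ((h $ j) *\<^sub>R partial_deriv j \<psi> y))"
        by (simp only: norm_sum)
      also have "\<dots> \<le> (\<Sum>j\<in>UNIV. norm h * cmod (partial_deriv j \<psi> y))"
        by (intro sum_mono) (auto simp: component_le_norm_cart mult_right_mono)
      also have "\<dots> \<le> (\<Sum>j\<in>UNIV. norm h * ((1 + R) ^ N * k j / (1 + norm x) ^ N))"
      proof (intro sum_mono mult_left_mono)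
        fix j
        have "(1 + norm x) ^ N * cmod (partial_deriv j \<psi> y) \<le> ((1 + R) ^ N * (1 + norm y) ^ N) * cmod (partial_deriv j \<psi> y)"
          using y by (intro mult_right_mono one_plus_norm_power_le) (auto simp: dist_norm)
        also have "\<dots> \<le> (1 + R) ^ N * k j"
          unfolding mult.assoc using R norm_ge_zero[of a] by (intro mult_left_mono k zero_le_power) linarith
        finally show "cmod (partial_deriv j \<psi> y) \<le> (1 + R) ^ N * k j / (1 + norm x) ^ N"
          by (simp add: pos_le_divide_eq add_pos_nonneg mult.commute)
      qed auto
      also have "\<dots> = B * norm h"
        by (simp add: B_def K_def sum_distrib_left sum_distrib_right sum_divide_distrib mult_ac)
      finally show "norm (frechet_derivative \<psi> (at y) h) \<le> B * norm h" .
    qed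
    have "cmod (\<psi> (x - a) - \<psi> (x - b)) \<le> B * norm ((x - a) - (x - b))"
    proof (rule differentiable_bound[OF convex_cball[of x R] _ D])
      show "(\<psi> has_derivative frechet_derivative \<psi> (at y)) (at y within cball x R)" for y
        by (rule has_derivative_at_withinI[OF schwartz_has_derivative[OF assms]])
    qed (use R in \<open>auto simp: dist_norm\<close>)
    then have "cmod (\<psi> (x - a) - \<psi> (x - b)) \<le> K * norm (a - b) / (1 + norm x) ^ N"
      by (simp add: B_def norm_minus_commute)
    then show ?thesis by (simp add: pos_le_divide_eq add_pos_nonneg mult.commute)
  qed
  moreover have "0 \<le> \<bar>K\<bar>" "K * norm (a - b) \<le> \<bar>K\<bar> * norm (a - b)" for a b :: "real^'d"
    by (auto intro: mult_right_mono)
  ultimately show ?thesis by (intro exI[of _ "\<bar>K\<bar>"]) (meson order_trans)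
qed

text \<open>Makes the integrand of \<open>averaging\<close> continuous along a path, hence
  integrable. A continuous functional is bounded by one seminorm, so
  \<open>schwartz_increment_bound\<close> for the finitely many derivatives of order at most
  \<open>N\<close> suffices.\<close>

lemma tempered_distribution_translate_lipschitz:
  fixes u :: "('d::finite) functional"
  assumes u: "tempered_distribution u" and s: "schwartz \<phi>"
  shows "\<exists>L. L-lipschitz_on (cball 0 R) (\<lambda>a. u (\<lambda>x. \<phi> (x - a)))"
proof -
  obtain N K where K: "\<And>\<phi>. schwartz \<phi> \<Longrightarrow> cmod (u \<phi>) \<le> K * schwartz_seminorm N \<phi>"
    using u unfolding tempered_distribution_def by blast
  obtain L where L0: "\<And>js. L js \<ge> 0" and L: "\<And>js x a b. norm a \<le> R \<Longrightarrow> norm b \<le> R \<Longrightarrow>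
       (1 + norm x) ^ N * cmod (iter_partial js \<phi> (x - a) - iter_partial js \<phi> (x - b)) \<le> L js * norm (a - b)"
    using schwartz_increment_bound[OF schwartz_iter_partial[OF s], of R N] by metis
  have "cmod (u (\<lambda>x. \<phi> (x - a)) - u (\<lambda>x. \<phi> (x - b))) \<le> (\<bar>K\<bar> * (\<Sum>js | length js \<le> N. L js)) * norm (a - b)"
    if R: "norm a \<le> R" "norm b \<le> R" for a b
  proof -
    let ?f = "\<lambda>x. 1 * \<phi> (x - a) + (-1) * \<phi> (x - b)"
    note sa = schwartz_translate[OF s, of a] and sb = schwartz_translate[OF s, of b]
    have sf: "schwartz ?f" by (rule schwartz_lincomb[OF sa sb])
    have "u (\<lambda>x. ?f x + \<phi> (x - b)) = u ?f + u (\<lambda>x. \<phi> (x - b))"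
      using u sf sb unfolding tempered_distribution_def by blast
    then have eq: "u (\<lambda>x. \<phi> (x - a)) - u (\<lambda>x. \<phi> (x - b)) = u ?f" by simp
    have "cmod (u ?f) \<le> K * schwartz_seminorm N ?f" by (rule K[OF sf])
    also have "\<dots> \<le> \<bar>K\<bar> * (\<Sum>js | length js \<le> N. L js * norm (a - b))"
    proof -
      have "schwartz_seminorm N ?f \<le> (\<Sum>js | length js \<le> N. L js * norm (a - b))"
        using L[OF R] unfolding iter_partial_translate
        by (intro schwartz_seminorm_bounds) (simp add: iter_partial_lincomb[OF sa sb, of _ 1 "-1", simplified] iter_partial_translate)
      moreover have "0 \<le> schwartz_seminorm N ?f" by (rule schwartz_seminorm_nonneg[OF sf])
      ultimately show ?thesis by (meson abs_ge_self abs_ge_zero mult_mono order_trans mult_right_mono mult_left_mono)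
    qed
    finally show ?thesis unfolding eq by (simp add: sum_distrib_right[symmetric] mult_ac)
  qed
  then have "(\<bar>K\<bar> * (\<Sum>js | length js \<le> N. L js))-lipschitz_on (cball 0 R) (\<lambda>a. u (\<lambda>x. \<phi> (x - a)))"
    by (intro lipschitz_onI mult_nonneg_nonneg sum_nonneg L0) (auto simp: dist_norm)
  then show ?thesis by blast
qed

subsection \<open>Uniqueness of representing functions\<close>

text \<open>
  Products of a Gaussian with polynomials in the coordinates and in logistic functions of the
  coordinates are Schwartz, and the logistic functions converge to indicators of half lines.
\<close>

inductive_set logistic_algebra :: "real \<Rightarrow> ('d \<Rightarrow> real) \<Rightarrow> (real^'d \<Rightarrow> complex) set"
  for b :: real and c :: "'d \<Rightarrow> real" where
  const: "(\<lambda>x. z) \<in> logistic_algebra b c"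
| coord: "(\<lambda>x. complex_of_real (x $ j)) \<in> logistic_algebra b c"
| logistic: "(\<lambda>x. complex_of_real (1 / (1 + exp (b * x $ j + c j)))) \<in> logistic_algebra b c"
| add: "p \<in> logistic_algebra b c \<Longrightarrow> q \<in> logistic_algebra b c \<Longrightarrow> (\<lambda>x. p x + q x) \<in> logistic_algebra b c"
| mult: "p \<in> logistic_algebra b c \<Longrightarrow> q \<in> logistic_algebra b c \<Longrightarrow> (\<lambda>x. p x * q x) \<in> logistic_algebra b c"

lemma logistic_algebra_prod:
  assumes "finite J" "\<And>j. j \<in> J \<Longrightarrow> p j \<in> logistic_algebra b c"
  shows "(\<lambda>x. \<Prod>j\<in>J. p j x) \<in> logistic_algebra b c"
  using assms by (induction J rule: finite_induct) (auto intro: logistic_algebra.intros)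

lemma abs_logistic_le_1: "\<bar>1 / (1 + exp t)\<bar> \<le> (1::real)"
  by (simp add: add_pos_pos abs_of_pos)

text \<open>The logistic function solves L' = - b L (1 - L), so its derivative is a polynomial in L
  itself and \<open>logistic_algebra\<close> is closed under differentiation. The right-hand side is
  written with the operations of that algebra.\<close>

lemma has_derivative_logistic:
  fixes c :: "'d::finite \<Rightarrow> real"
  shows "((\<lambda>x. complex_of_real (1 / (1 + exp (b * x $ j + c j)))) has_derivative
    (\<lambda>h. complex_of_real (- b * (h $ j)) * (complex_of_real (1 / (1 + exp (b * x $ j + c j))) *
       (1 + - 1 * complex_of_real (1 / (1 + exp (b * x $ j + c j))))))) (at x)"
proof -
  have pos: "1 + exp t \<noteq> 0" for t :: real by (metis add_pos_pos exp_gt_zero less_irrefl zero_less_one)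
  have "((\<lambda>x::real^'d. b * x $ j) has_derivative (\<lambda>h. b * h $ j)) (at x)"
    by (intro has_derivative_mult_right bounded_linear_imp_has_derivative bounded_linear_vec_nth)
  from has_derivative_add[OF this has_derivative_const[of "c j"]]
  have lin: "((\<lambda>x::real^'d. b * x $ j + c j) has_derivative (\<lambda>h. b * h $ j)) (at x)" by simp
  have "((\<lambda>t. complex_of_real (1 / (1 + exp t))) has_derivative
     (\<lambda>h. complex_of_real (h * (- exp t / (1 + exp t)\<^sup>2)))) (at t)" for t
  proof (rule has_derivative_of_real)
    have "((\<lambda>t. 1 / (1 + exp t)) has_real_derivative - exp t / (1 + exp t)\<^sup>2) (at t)"
      using pos by (auto intro!: derivative_eq_intros simp: power2_eq_square)
    then show "((\<lambda>t. 1 / (1 + exp t)) has_derivative (\<lambda>h. h * (- exp t / (1 + exp t)\<^sup>2))) (at t)"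
      unfolding has_field_derivative_def by (rule has_derivative_eq_rhs) (simp add: fun_eq_iff)
  qed
  from has_derivative_compose[OF lin this]
  have D: "((\<lambda>x. complex_of_real (1 / (1 + exp (b * x $ j + c j)))) has_derivative
    (\<lambda>h. complex_of_real (b * h $ j * (- exp (b * x $ j + c j) / (1 + exp (b * x $ j + c j))\<^sup>2)))) (at x)" .
  have e: "b * h * (- exp t / (1 + exp t)\<^sup>2) = - b * h * (1 / (1 + exp t) * (1 + -1 * (1 / (1 + exp t))))" for h t :: real
    using pos[of t] by (simp add: power2_eq_square field_simps)
  show ?thesis by (rule has_derivative_eq_rhs[OF D]) (simp only: e of_real_mult of_real_add of_real_1 of_real_minus)
qed

lemma logistic_algebra_deriv:
  assumes "p \<in> logistic_algebra b c"
  shows "(\<forall>x. p differentiable (at x)) \<and> (\<forall>j. partial_deriv j p \<in> logistic_algebra b c)"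
  using assms
proof induction
  case (const z)
  have "partial_deriv j (\<lambda>x. z) = (\<lambda>x. 0)" for j :: 'a
    by (rule ext, rule partial_deriv_eqI) auto
  then show ?case by (auto intro: logistic_algebra.const)
next
  case (coord i)
  have D: "((\<lambda>x. complex_of_real (x $ i)) has_derivative (\<lambda>h. complex_of_real (h $ i))) (at x)" for x :: "real^'a"
    by (intro bounded_linear_imp_has_derivative bounded_linear_compose[OF bounded_linear_of_real bounded_linear_vec_nth])
  have "partial_deriv j (\<lambda>x. complex_of_real (x $ i)) = (\<lambda>x. complex_of_real (axis j 1 $ i))" for j :: 'a
    by (rule ext) (rule partial_deriv_eqI[OF D])
  then show ?case using differentiableI[OF D] by (auto intro: logistic_algebra.const)
next
  case (logistic i)
  let ?L = "\<lambda>x::real^'a. complex_of_real (1 / (1 + exp (b * x $ i + c i)))"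
  have eq: "partial_deriv j ?L = (\<lambda>x. complex_of_real (- b * (axis j 1 $ i)) * (?L x * (1 + - 1 * ?L x)))" for j :: 'a
    by (rule ext) (rule partial_deriv_eqI[OF has_derivative_logistic])
  have mem: "(\<lambda>x. complex_of_real (- b * (axis j 1 $ i)) * (?L x * (1 + - 1 * ?L x))) \<in> logistic_algebra b c" for j
    by (intro logistic_algebra.intros)
  show ?case unfolding eq by (intro conjI allI mem differentiableI[OF has_derivative_logistic])
next
  case (add p q)
  have D: "((\<lambda>x. p x + q x) has_derivative (\<lambda>h. frechet_derivative p (at x) h + frechet_derivative q (at x) h)) (at x)" for x
    using add.IH frechet_derivative_works by (blast intro: has_derivative_add)
  have "partial_deriv j (\<lambda>x. p x + q x) = (\<lambda>x. partial_deriv j p x + partial_deriv j q x)" for j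
    using partial_deriv_eqI[OF D] by (auto simp: partial_deriv_def)
  then show ?case using add.IH by (auto intro: logistic_algebra.intros differentiable_add)
next
  case (mult p q)
  have D: "((\<lambda>x. p x * q x) has_derivative (\<lambda>h. p x * frechet_derivative q (at x) h + frechet_derivative p (at x) h * q x)) (at x)" for x
    using mult.IH frechet_derivative_works by (blast intro: has_derivative_mult)
  have "partial_deriv j (\<lambda>x. p x * q x) = (\<lambda>x. p x * partial_deriv j q x + partial_deriv j p x * q x)" for j
    using partial_deriv_eqI[OF D] by (auto simp: partial_deriv_def)
  then show ?case using mult.IH mult.hyps by (auto intro!: logistic_algebra.intros(4-5) differentiable_mult)
qed

lemma logistic_algebra_growth:
  assumes "p \<in> logistic_algebra b c"
  shows "\<exists>K m. \<forall>x. cmod (p x) \<le> K * (1 + norm x) ^ m"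
  using assms
proof induction
  case (const z)
  show ?case by (intro exI[of _ "cmod z"] exI[of _ 0]) auto
next
  case (coord j)
  have "\<bar>x $ j\<bar> \<le> 1 * (1 + norm x) ^ 1" for x :: "real^'a" using component_le_norm_cart[of x j] by simp
  then show ?case unfolding norm_of_real by blast
next
  case (logistic j)
  have "\<bar>1 / (1 + exp (b * x $ j + c j))\<bar> \<le> 1 * (1 + norm x) ^ 0" for x :: "real^'a"
    using abs_logistic_le_1 by simp
  then show ?case unfolding norm_of_real by blast
next
  case (add p q)
  then obtain K m L n where K: "\<And>x. cmod (p x) \<le> K * (1 + norm x) ^ m" and L: "\<And>x. cmod (q x) \<le> L * (1 + norm x) ^ n" by blast
  have "cmod (p x + q x) \<le> (\<bar>K\<bar> + \<bar>L\<bar>) * (1 + norm x) ^ (m + n)" for x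
  proof -
    have "K * (1 + norm x) ^ m \<le> \<bar>K\<bar> * (1 + norm x) ^ (m + n)" "L * (1 + norm x) ^ n \<le> \<bar>L\<bar> * (1 + norm x) ^ (m + n)"
      by (auto intro!: mult_mono power_increasing)
    then show ?thesis using norm_triangle_ineq[of "p x" "q x"] K[of x] L[of x] by (simp add: distrib_right)
  qed
  then show ?case by blast
next
  case (mult p q)
  then obtain K m L n where K: "\<And>x. cmod (p x) \<le> K * (1 + norm x) ^ m" and L: "\<And>x. cmod (q x) \<le> L * (1 + norm x) ^ n" by blast
  have "cmod (p x * q x) \<le> (K * L) * (1 + norm x) ^ (m + n)" for x
  proof -
    have "cmod (p x * q x) \<le> (K * (1 + norm x) ^ m) * (L * (1 + norm x) ^ n)"
      unfolding norm_mult by (intro mult_mono K L) (auto intro: order_trans[OF norm_ge_zero K])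
    then show ?thesis by (simp add: power_add mult_ac)
  qed
  then show ?case by blast
qed

lemma power_le_exp:
  fixes z :: real assumes "0 \<le> z" shows "z ^ k \<le> real k ^ k * exp z"
proof (cases "k = 0")
  case False
  have "(z / real k) ^ k \<le> exp (z / real k) ^ k"
    using exp_ge_add_one_self[of "z / real k"] assms by (intro power_mono) (linarith, simp)
  also have "\<dots> = exp z" using False by (simp add: exp_of_nat_mult[symmetric])
  finally show ?thesis using False by (simp add: power_divide field_simps)
qed (use assms in simp)

lemma gaussian_decay:
  "(1 + r) ^ k * exp (- r\<^sup>2) \<le> real k ^ k * exp (5/4)" if "0 \<le> r" for r :: real
proof -
  have "(1 + r) ^ k * exp (- r\<^sup>2) \<le> real k ^ k * exp (1 + r) * exp (- r\<^sup>2)"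
    using that by (intro mult_right_mono power_le_exp) auto
  also have "\<dots> = real k ^ k * exp (1 + r - r\<^sup>2)" by (simp add: exp_add exp_diff exp_minus divide_inverse)
  \<comment> \<open>The maximum of 1 + r - r^2 is 5/4, attained at r = 1/2.\<close>
  also have "\<dots> \<le> real k ^ k * exp (5/4)"
    using zero_le_power2[of "r - 1/2"] by (intro mult_left_mono) (auto simp: power2_eq_square field_simps)
  finally show ?thesis .
qed

lemma schwartz_gaussian_logistic:
  assumes "p \<in> logistic_algebra b c"
  shows "schwartz (\<lambda>x. exp (- complex_of_real (x \<bullet> x)) * p x)"
proof (rule schwartzI_closed)
  define G :: "real^'a \<Rightarrow> complex" where "G x = exp (- complex_of_real (x \<bullet> x))" for x
  let ?S = "{f. \<exists>p \<in> logistic_algebra b c. f = (\<lambda>x. exp (- complex_of_real (x \<bullet> x)) * p x)}"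
  show "(\<lambda>x. exp (- complex_of_real (x \<bullet> x)) * p x) \<in> ?S" using assms by blast
  fix f assume "f \<in> ?S"
  then obtain p where p: "p \<in> logistic_algebra b c" and f: "f = (\<lambda>x. G x * p x)" by (auto simp: G_def)
  have E: "(G has_derivative (\<lambda>h. complex_of_real (- 2 * (x \<bullet> h)) * G x)) (at x)" for x
  proof -
    have "((\<lambda>x. - complex_of_real (x \<bullet> x)) has_derivative (\<lambda>h. complex_of_real (- 2 * (x \<bullet> h)))) (at x)"
      by (auto intro!: derivative_eq_intros simp: inner_commute)
    from has_derivative_compose[OF this DERIV_exp[unfolded has_field_derivative_def]]
    show ?thesis by (simp add: G_def[abs_def] mult_ac)
  qed
  have D: "(f has_derivative (\<lambda>h. G x * frechet_derivative p (at x) h + complex_of_real (- 2 * (x \<bullet> h)) * G x * p x)) (at x)" for x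
    unfolding f using logistic_algebra_deriv[OF p] frechet_derivative_works by (blast intro: has_derivative_mult[OF E])
  then show "f differentiable (at x)" for x using differentiableI by blast
  have "partial_deriv j f = (\<lambda>x. G x * (partial_deriv j p x + (- 2) * (complex_of_real (x $ j) * p x)))" for j
    using partial_deriv_eqI[OF D, of j]
    by (auto simp: partial_deriv_def algebra_simps inner_axis fun_eq_iff)
  moreover have "(\<lambda>x. partial_deriv j p x + (- 2) * (complex_of_real (x $ j) * p x)) \<in> logistic_algebra b c" for j
    using logistic_algebra_deriv[OF p] p by (intro logistic_algebra.intros) auto
  ultimately show "partial_deriv j f \<in> ?S" for j
    unfolding G_def mem_Collect_eq by (rule bexI)
  fix k
  obtain K m where K: "\<And>x. cmod (p x) \<le> K * (1 + norm x) ^ m" using logistic_algebra_growth[OF p] by blast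
  have "0 \<le> K" using K[of 0] norm_ge_zero[of "p 0"] by (metis norm_zero add.right_neutral mult.right_neutral order_trans power_one)
  have "(1 + norm x) ^ k * cmod (f x) \<le> K * (real (k + m) ^ (k + m) * exp (5/4))" for x
  proof -
    have "cmod (G x) = exp (- (norm x)\<^sup>2)" unfolding G_def by (simp add: dot_square_norm flip: of_real_minus)
    then have "(1 + norm x) ^ k * cmod (f x) \<le> (1 + norm x) ^ k * (exp (- (norm x)\<^sup>2) * (K * (1 + norm x) ^ m))"
      unfolding f norm_mult using K by (intro mult_left_mono) auto
    also have "\<dots> = K * ((1 + norm x) ^ (k + m) * exp (- (norm x)\<^sup>2))" by (simp add: power_add mult_ac)
    also have "\<dots> \<le> K * (real (k + m) ^ (k + m) * exp (5/4))"
      using \<open>0 \<le> K\<close> by (intro mult_left_mono gaussian_decay) auto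
    finally show ?thesis .
  qed
  then show "\<exists>K. \<forall>x. (1 + norm x) ^ k * cmod (f x) \<le> K" by blast
qed

text \<open>The exponent is n^2 (y - a) + n. The slope n^2 beats the shift n when y < a, and the
  shift sends the exponent to infinity also at y = a, so the limit is the indicator of the open half
  line at every point.\<close>

lemma logistic_tendsto_indicator:
  "(\<lambda>n. 1 / (1 + exp ((real n)\<^sup>2 * y + (real n - (real n)\<^sup>2 * a)))) \<longlonglongrightarrow> (if y < a then 1 else 0)"
proof (cases "y < a")
  case True
  have e: "(real n)\<^sup>2 * y + (real n - (real n)\<^sup>2 * a) = - ((- 1 + (a - y) * real n) * real n)" for n
    by (simp add: power2_eq_square algebra_simps)
  have "filterlim (\<lambda>n. (- 1 + (a - y) * real n) * real n) at_top sequentially"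
    using True by (intro filterlim_at_top_mult_at_top filterlim_tendsto_add_at_top[OF tendsto_const]
        filterlim_tendsto_pos_mult_at_top[OF tendsto_const _ filterlim_real_sequentially]
        filterlim_real_sequentially) auto
  then have "filterlim (\<lambda>n. - ((- 1 + (a - y) * real n) * real n)) at_bot sequentially"
    by (simp only: filterlim_uminus_at_top)
  then have "(\<lambda>n. exp (- ((- 1 + (a - y) * real n) * real n))) \<longlonglongrightarrow> 0"
    using exp_at_bot filterlim_compose by blast
  then have "(\<lambda>n. 1 / (1 + exp (- ((- 1 + (a - y) * real n) * real n)))) \<longlonglongrightarrow> 1 / (1 + 0)"
    by (intro tendsto_intros) auto
  then show ?thesis using True unfolding e by simp
next
  case False
  have "filterlim (\<lambda>n. (real n)\<^sup>2 * y + (real n - (real n)\<^sup>2 * a)) at_top sequentially"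
  proof (rule filterlim_at_top_mono[OF filterlim_real_sequentially], rule always_eventually, rule allI)
    show "real n \<le> (real n)\<^sup>2 * y + (real n - (real n)\<^sup>2 * a)" for n
      using False mult_left_mono[of a y "(real n)\<^sup>2"] by simp
  qed
  then have "filterlim (\<lambda>n. 1 + exp ((real n)\<^sup>2 * y + (real n - (real n)\<^sup>2 * a))) at_top sequentially"
    by (intro filterlim_tendsto_add_at_top[OF tendsto_const] filterlim_compose[OF exp_at_top])
  then have "(\<lambda>n. 1 / (1 + exp ((real n)\<^sup>2 * y + (real n - (real n)\<^sup>2 * a)))) \<longlonglongrightarrow> 0"
    by (intro tendsto_divide_0[OF tendsto_const] filterlim_at_top_imp_at_infinity)
  then show ?thesis using False by simp
qed

lemma eucl_less_cart: "eucl_less x a \<longleftrightarrow> (\<forall>j. x $ j < a $ j)" for x a :: "real^'d"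
  by (auto simp: eucl_less_def Basis_vec_def inner_axis)

text \<open>Multiplying by a Gaussian makes \<open>g\<close> an integrable function
  \<open>h\<close>. Testing \<open>g\<close> against Gaussian times logistic products shows, by
  dominated convergence, that \<open>h\<close> has integral zero over every open lower orthant.
  These orthants form an intersection-stable generator of the Borel sets, so \<open>h\<close> has
  integral zero over every Borel set.\<close>

lemma schwartz_separates:
  fixes g :: "real^'d \<Rightarrow> complex"
  assumes g: "g \<in> borel_measurable lborel"
    and int: "\<And>\<phi>. schwartz \<phi> \<Longrightarrow> integrable lborel (\<lambda>x. g x * \<phi> x)"
    and zero: "\<And>\<phi>. schwartz \<phi> \<Longrightarrow> (\<integral>x. g x * \<phi> x \<partial>lborel) = 0"
  shows "AE x in lborel. g x = 0"
proof -
  define h where "h x = g x * exp (- complex_of_real (x \<bullet> x))" for x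
  have s1: "schwartz (\<lambda>x::real^'d. exp (- complex_of_real (x \<bullet> x)) * 1)"
    by (rule schwartz_gaussian_logistic[OF logistic_algebra.const[of 1 0 "\<lambda>_. 0"]])
  have h: "integrable lborel h" "(\<integral>x. h x \<partial>lborel) = 0"
    using int[OF s1] zero[OF s1] by (simp_all add: h_def[abs_def])
  have orth: "(LINT x:{x. eucl_less x a}|lborel. h x) = 0" for a :: "real^'d"
  proof -
    define L where "L n x = (\<Prod>j\<in>UNIV. complex_of_real (1 / (1 + exp ((real n)\<^sup>2 * x $ j + (real n - (real n)\<^sup>2 * a $ j)))))" for n and x :: "real^'d"
    have sL: "schwartz (\<lambda>x. exp (- complex_of_real (x \<bullet> x)) * L n x)" for n
      unfolding L_def
      by (intro schwartz_gaussian_logistic[where b = "(real n)\<^sup>2" and c = "\<lambda>j. real n - (real n)\<^sup>2 * a $ j"]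
          logistic_algebra_prod logistic_algebra.logistic) auto
    have L: "integrable lborel (\<lambda>x. h x * L n x)" "(\<integral>x. h x * L n x \<partial>lborel) = 0" for n
      using int[OF sL] zero[OF sL] by (simp_all add: h_def mult.assoc)
    have lim: "(\<lambda>n. h x * L n x) \<longlonglongrightarrow> indicator {x. eucl_less x a} x *\<^sub>R h x" for x
    proof -
      have "(\<lambda>n. L n x) \<longlonglongrightarrow> (\<Prod>j\<in>UNIV. complex_of_real (if x $ j < a $ j then 1 else 0))"
        unfolding L_def by (intro tendsto_prod tendsto_of_real logistic_tendsto_indicator)
      also have "(\<Prod>j\<in>UNIV. complex_of_real (if x $ j < a $ j then 1 else 0)) = indicator {x. eucl_less x a} x"
        by (auto simp: indicator_def eucl_less_cart prod_zero_iff)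
      finally have "(\<lambda>n. h x * L n x) \<longlonglongrightarrow> h x * indicator {x. eucl_less x a} x"
        by (intro tendsto_mult tendsto_const)
      then show ?thesis by (cases "eucl_less x a") simp_all
    qed
    have "(\<lambda>n. \<integral>x. h x * L n x \<partial>lborel) \<longlonglongrightarrow> (\<integral>x. indicator {x. eucl_less x a} x *\<^sub>R h x \<partial>lborel)"
    proof (rule integral_dominated_convergence[where w = "\<lambda>x. norm (h x)"])
      show "AE x in lborel. (\<lambda>n. h x * L n x) \<longlonglongrightarrow> indicator {x. eucl_less x a} x *\<^sub>R h x"
        using lim by simp
      show "(\<lambda>x. indicator {x. eucl_less x a} x *\<^sub>R h x) \<in> borel_measurable lborel"
        using borel_measurable_LIMSEQ_metric[OF borel_measurable_integrable[OF L(1)] lim] by simp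
      have "cmod (L n x) \<le> 1" for n x
        unfolding L_def prod_norm[symmetric] norm_of_real by (intro prod_le_1 conjI abs_ge_zero abs_logistic_le_1)
      then show "AE x in lborel. norm (h x * L n x) \<le> norm (h x)" for n
        by (simp add: norm_mult mult_left_le)
    qed (use h L in auto)
    then show ?thesis using LIMSEQ_unique[OF _ tendsto_const] by (simp add: L(2) set_lebesgue_integral_def LIMSEQ_const_iff)
  qed
  have "AE x in lborel. h x = 0"
  proof (rule sigma_finite_measure.density_zero[OF sigma_finite_lborel h(1)])
    fix A :: "(real^'d) set" assume A: "A \<in> sets lborel"
    let ?G = "range (\<lambda>a::real^'d. {x. eucl_less x a})"
    have sG: "sets borel = sigma_sets UNIV ?G"
      by (subst borel_eq_lessThan) auto
    have si: "set_integrable lborel B h" if "B \<in> sets borel" for B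
      unfolding set_integrable_def using that h(1) by (intro integrable_mult_indicator) auto
    have AG: "A \<in> sigma_sets UNIV ?G" using A sG by simp
    have IS: "Int_stable ?G"
    proof (rule Int_stableI)
      fix A B assume "A \<in> ?G" "B \<in> ?G"
      then obtain a b where "A = {x. eucl_less x a}" "B = {x. eucl_less x b}" by auto
      then have "A \<inter> B = {x. eucl_less x (\<chi> i. min (a $ i) (b $ i))}" by (auto simp: eucl_less_cart)
      then show "A \<inter> B \<in> ?G" by blast
    qed
    have "?G \<subseteq> Pow UNIV" by simp
    from IS this AG show "set_lebesgue_integral lborel A h = 0"
    proof (induction rule: sigma_sets_induct_disjoint)
      case (basic A) then show ?case using orth by auto
    next
      case empty show ?case by (simp add: set_lebesgue_integral_def)
    next
      case (compl A)
      then have "A \<in> sets borel" using sG by simp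
      then have "(LINT x:A \<union> (UNIV - A)|lborel. h x) = (LINT x:A|lborel. h x) + (LINT x:UNIV - A|lborel. h x)"
        by (intro set_integral_Un si) auto
      then show ?case using compl h(2) by (simp add: set_lebesgue_integral_def)
    next
      case (union A)
      then have A: "range A \<subseteq> sets borel" using sG by auto
      have "(LINT x:(\<Union>i. A i)|lborel. h x) = (\<Sum>i. LINT x:A i|lborel. h x)"
        using A union.hyps(1) by (intro lebesgue_integral_countable_add si) (auto simp: disjoint_family_on_def)
      then show ?case using union by simp
    qed
  qed
  then show ?thesis by (simp add: h_def)
qed

section \<open>The averaging operator as a Fourier multiplier\<close>

lemma represented_by_unique:
  assumes "represented_by u g" "represented_by u g'"
  shows "AE x in lborel. g x = g' x"
proof -
  have "AE x in lborel. g x - g' x = 0"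
    using assms unfolding represented_by_def
    by (intro schwartz_separates) (auto simp: left_diff_distrib)
  then show ?thesis by simp
qed

lemma FL_represented:
  "u \<in> FL \<alpha> \<Longrightarrow> represented_by (fourier_distribution u) (fourier_function u)"
  unfolding FL_def fourier_function_def mem_Collect_eq by (intro someI_ex[of "represented_by (fourier_distribution u)"]) blast

lemma fourier_function_AE_eq:
  assumes "represented_by (fourier_distribution u) g"
  shows "AE \<xi> in lborel. fourier_function u \<xi> = g \<xi>"
  by (rule represented_by_unique[OF _ assms])
    (auto simp: fourier_function_def intro: someI[of "represented_by (fourier_distribution u)", OF assms])

lemma FL_norm_nonneg: "0 \<le> FL_norm \<alpha> u"
  unfolding FL_norm_def by simp

text \<open>The multiplier bound cancels the extra weight
  \<open>(1 + norm \<xi>) powr \<rho>\<close> pointwise, so \<open>D\<close> is the same for every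
  \<open>\<alpha>\<close>; this is where the uniformity in \<open>\<alpha>\<close> originates. The
  comparison holds almost everywhere only, as \<open>fourier_function v\<close> is a chosen
  representative.\<close>

lemma FL_multiplier:
  assumes u: "u \<in> FL \<alpha>"
    and v: "represented_by (fourier_distribution v) (\<lambda>\<xi>. fourier_function u \<xi> * m \<xi>)"
    and m: "\<And>\<xi>. cmod (m \<xi>) \<le> D * (1 + norm \<xi>) powr - \<rho>"
  shows "integrable lborel (\<lambda>\<xi>. cmod (fourier_function v \<xi>) * (1 + norm \<xi>) powr (\<alpha> + \<rho>))"
    and "FL_norm (\<alpha> + \<rho>) v \<le> D * FL_norm \<alpha> u"
proof -
  let ?F = "\<lambda>\<xi>. cmod (fourier_function v \<xi>) * (1 + norm \<xi>) powr (\<alpha> + \<rho>)"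
  let ?G = "\<lambda>\<xi>. D * (cmod (fourier_function u \<xi>) * (1 + norm \<xi>) powr \<alpha>)"
  have G: "integrable lborel ?G" using u unfolding FL_def by (intro integrable_mult_right) simp
  have le: "cmod (fourier_function u \<xi> * m \<xi>) * (1 + norm \<xi>) powr (\<alpha> + \<rho>) \<le> ?G \<xi>" for \<xi>
  proof -
    have pos: "0 < 1 + norm \<xi>" by (simp add: add_pos_nonneg)
    have "cmod (fourier_function u \<xi> * m \<xi>) * (1 + norm \<xi>) powr (\<alpha> + \<rho>) \<le>
        cmod (fourier_function u \<xi>) * (D * (1 + norm \<xi>) powr - \<rho>) * (1 + norm \<xi>) powr (\<alpha> + \<rho>)"
      unfolding norm_mult by (intro mult_right_mono mult_left_mono m) auto
    also have "\<dots> = D * (cmod (fourier_function u \<xi>) * ((1 + norm \<xi>) powr - \<rho> * (1 + norm \<xi>) powr (\<alpha> + \<rho>)))"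
      by (simp only: mult_ac)
    also have "\<dots> = ?G \<xi>" by (simp add: powr_add[symmetric])
    finally show ?thesis .
  qed
  have AE_le: "AE \<xi> in lborel. norm (?F \<xi>) \<le> ?G \<xi>"
    using fourier_function_AE_eq[OF v]
  proof eventually_elim
    case (elim \<xi>) then show ?case using le[of \<xi>] by (simp add: abs_mult)
  qed
  have mv: "fourier_function v \<in> borel_measurable lborel"
    using someI[of "represented_by (fourier_distribution v)", OF v]
    unfolding fourier_function_def represented_by_def by blast
  have mF: "?F \<in> borel_measurable lborel" using mv by measurable
  have AE_le': "AE \<xi> in lborel. norm (?F \<xi>) \<le> norm (?G \<xi>)"
    using AE_le by eventually_elim (metis abs_ge_self order_trans real_norm_def)
  show F: "integrable lborel ?F" by (rule Bochner_Integration.integrable_bound[OF G mF AE_le'])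
  have "FL_norm (\<alpha> + \<rho>) v \<le> integral\<^sup>L lborel ?G"
    unfolding FL_norm_def using AE_le by (intro integral_mono_AE F G) auto
  then show "FL_norm (\<alpha> + \<rho>) v \<le> D * FL_norm \<alpha> u" by (simp add: FL_norm_def)
qed

section \<open>The multiplier of a path and the Fubini identity behind it\<close>

lemma integrable_indicator_Icc: "integrable lborel (indicator {a..b::real} :: real \<Rightarrow> real)"
  using borel_integrable_atLeastAtMost'[of a b "\<lambda>_. 1::real"] by (simp add: set_integrable_def)

text \<open>The symbol written \<open>\<Phi>\<^sub>t(\<xi>)\<close> in the overview.\<close>

definition osc :: "(real \<Rightarrow> real^'d) \<Rightarrow> real \<Rightarrow> real^'d \<Rightarrow> complex" where
  "osc w t \<xi> = (LINT r:{0..t}|lborel. iexp (\<xi> \<bullet> w r))"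

lemma path_bounded:
  fixes w :: "real \<Rightarrow> real^'d"
  assumes "continuous_on {0..T} w"
  shows "\<exists>W. \<forall>r\<in>{0..T}. norm (w r) \<le> W"
  using compact_imp_bounded[OF compact_continuous_image[OF assms compact_Icc]]
  unfolding bounded_iff by auto

context
  fixes w :: "real \<Rightarrow> real^'d" and T t :: real
  assumes w: "continuous_on {0..T} w" and t: "0 \<le> t" "t \<le> T"
begin

lemma averaging_integrand:
  assumes u: "tempered_distribution u" and s: "schwartz \<phi>"
  shows "set_integrable lborel {0..t} (\<lambda>r. u (\<lambda>x. \<phi> (x - w r)))"
proof -
  obtain W where W: "\<And>r. r \<in> {0..T} \<Longrightarrow> norm (w r) \<le> W" using path_bounded[OF w] by blast
  obtain L where "L-lipschitz_on (cball 0 W) (\<lambda>a. u (\<lambda>x. \<phi> (x - a)))"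
    using tempered_distribution_translate_lipschitz[OF u s] by blast
  from lipschitz_on_continuous_on[OF this]
  have "continuous_on {0..t} (\<lambda>r. u (\<lambda>x. \<phi> (x - w r)))"
    by (rule continuous_on_compose2) (use w W t in \<open>auto intro: continuous_on_subset\<close>)
  then show ?thesis by (rule borel_integrable_atLeastAtMost')
qed

lemma tempered_distribution_averaging:
  assumes u: "tempered_distribution u"
  shows "tempered_distribution (averaging w t u)"
proof -
  obtain W where W: "\<And>r. r \<in> {0..T} \<Longrightarrow> norm (w r) \<le> W" using path_bounded[OF w] by blast
  have nonschwartz: "averaging w t u \<phi> = 0" if "\<not> schwartz \<phi>" for \<phi>
  proof -
    have "u (\<lambda>x. \<phi> (x - w r)) = 0" for r
      using u that unfolding tempered_distribution_def by (auto simp: schwartz_translate_iff)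
    then show ?thesis by (simp add: averaging_def set_lebesgue_integral_def)
  qed
  have add: "averaging w t u (\<lambda>x. \<phi> x + \<psi> x) = averaging w t u \<phi> + averaging w t u \<psi>"
    if "schwartz \<phi>" "schwartz \<psi>" for \<phi> \<psi>
  proof -
    have "u (\<lambda>x. \<phi> (x - a) + \<psi> (x - a)) = u (\<lambda>x. \<phi> (x - a)) + u (\<lambda>x. \<psi> (x - a))" for a
      using u schwartz_translate[OF that(1), of a] schwartz_translate[OF that(2), of a]
      unfolding tempered_distribution_def by blast
    then show ?thesis unfolding averaging_def
      using set_integral_add(2)[OF averaging_integrand[OF u that(1)] averaging_integrand[OF u that(2)]] by simp
  qed
  have scale: "averaging w t u (\<lambda>x. c * \<phi> x) = c * averaging w t u \<phi>" if "schwartz \<phi>" for c \<phi>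
  proof -
    have "u (\<lambda>x. c * \<phi> (x - a)) = c * u (\<lambda>x. \<phi> (x - a))" for a
      using u schwartz_translate[OF that, of a] unfolding tempered_distribution_def by blast
    then show ?thesis unfolding averaging_def by simp
  qed
  obtain N K where K: "\<And>\<phi>. schwartz \<phi> \<Longrightarrow> cmod (u \<phi>) \<le> K * schwartz_seminorm N \<phi>"
    using u unfolding tempered_distribution_def by blast
  have "cmod (averaging w t u \<phi>) \<le> (\<bar>K\<bar> * (1 + W) ^ N * t) * schwartz_seminorm N \<phi>" if s: "schwartz \<phi>" for \<phi>
  proof -
    have b: "cmod (u (\<lambda>x. \<phi> (x - w r))) \<le> \<bar>K\<bar> * ((1 + W) ^ N * schwartz_seminorm N \<phi>)" if "r \<in> {0..t}" for r
    proof -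
      have "schwartz_seminorm N (\<lambda>x. \<phi> (x - w r)) \<le> (1 + norm (w r)) ^ N * schwartz_seminorm N \<phi>"
        by (rule schwartz_seminorm_translate[OF s])
      also have "\<dots> \<le> (1 + W) ^ N * schwartz_seminorm N \<phi>"
        using that t W[of r] by (intro mult_right_mono power_mono schwartz_seminorm_nonneg s) auto
      finally have *: "schwartz_seminorm N (\<lambda>x. \<phi> (x - w r)) \<le> (1 + W) ^ N * schwartz_seminorm N \<phi>" .
      have "cmod (u (\<lambda>x. \<phi> (x - w r))) \<le> K * schwartz_seminorm N (\<lambda>x. \<phi> (x - w r))"
        by (rule K[OF schwartz_translate[OF s]])
      also have "\<dots> \<le> \<bar>K\<bar> * schwartz_seminorm N (\<lambda>x. \<phi> (x - w r))"
        by (intro mult_right_mono schwartz_seminorm_nonneg schwartz_translate s) auto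
      also have "\<dots> \<le> \<bar>K\<bar> * ((1 + W) ^ N * schwartz_seminorm N \<phi>)"
        by (intro mult_left_mono *) auto
      finally show ?thesis .
    qed
    have "cmod (averaging w t u \<phi>) \<le> (LINT r:{0..t}|lborel. \<bar>K\<bar> * ((1 + W) ^ N * schwartz_seminorm N \<phi>))"
      unfolding averaging_def set_lebesgue_integral_def
    proof (intro order_trans[OF integral_norm_bound] integral_mono integrable_norm)
      show "integrable lborel (\<lambda>r. indicator {0..t} r *\<^sub>R u (\<lambda>x. \<phi> (x - w r)))"
        using averaging_integrand[OF u s] by (simp add: set_integrable_def)
      show "integrable lborel (\<lambda>r. indicator {0..t} r *\<^sub>R (\<bar>K\<bar> * ((1 + W) ^ N * schwartz_seminorm N \<phi>)))"
        by (intro integrable_scaleR_left integrable_indicator_Icc)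
      show "cmod (indicator {0..t} r *\<^sub>R u (\<lambda>x. \<phi> (x - w r))) \<le> indicator {0..t} r *\<^sub>R (\<bar>K\<bar> * ((1 + W) ^ N * schwartz_seminorm N \<phi>))" for r
        using b by (cases "r \<in> {0..t}") auto
    qed
    then show ?thesis using t by (simp add: set_lebesgue_integral_def mult_ac)
  qed
  then show ?thesis unfolding tempered_distribution_def using nonschwartz add scale by blast
qed

lemma osc_measurable: "(\<lambda>\<xi>. osc w t \<xi>) \<in> borel_measurable lborel"
  and osc_phase_measurable: "(\<lambda>(r, \<xi>). indicator {0..t} r *\<^sub>R iexp (\<xi> \<bullet> w r)) \<in> borel_measurable (lborel \<Otimes>\<^sub>M lborel)"
proof -
  \<comment> \<open>\<open>w\<close> is arbitrary outside \<open>{0..T}\<close>; clamping the time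
    gives a function continuous on the whole line, hence Borel, that agrees with \<open>w\<close>
    wherever the indicator is nonzero.\<close>
  define w' where "w' r = w (max 0 (min T r))" for r
  have "continuous_on UNIV w'"
    unfolding w'_def by (rule continuous_on_compose2[OF w]) (use t in \<open>auto intro!: continuous_intros\<close>)
  then have w'[measurable]: "w' \<in> borel_measurable borel" by (rule borel_measurable_continuous_onI)
  have eq: "indicator {0..t} r *\<^sub>R iexp (\<xi> \<bullet> w r) = indicator {0..t} r *\<^sub>R iexp (\<xi> \<bullet> w' r)" for r \<xi>
    using t by (auto simp: w'_def indicator_def)
  show "(\<lambda>(r, \<xi>). indicator {0..t} r *\<^sub>R iexp (\<xi> \<bullet> w r)) \<in> borel_measurable (lborel \<Otimes>\<^sub>M lborel)"
    unfolding eq by measurable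
  show "(\<lambda>\<xi>. osc w t \<xi>) \<in> borel_measurable lborel"
    unfolding osc_def set_lebesgue_integral_def eq by measurable
qed

lemma norm_osc_le: "cmod (osc w t \<xi>) \<le> t"
proof -
  have "cmod (osc w t \<xi>) \<le> (\<integral>r. cmod (indicator {0..t} r *\<^sub>R iexp (\<xi> \<bullet> w r)) \<partial>lborel)"
    unfolding osc_def set_lebesgue_integral_def by (rule integral_norm_bound)
  also have "\<dots> = (\<integral>r. indicator {0..t} r \<partial>lborel)" by simp
  also have "\<dots> = t" using t by simp
  finally show ?thesis .
qed

text \<open>On the Fourier side the shift by \<open>w r\<close> becomes a modulation of
  \<open>\<phi>\<close>, so the Fourier transform of \<open>u\<close> is tested on a Schwartz
  function and can be replaced by integration against \<open>g\<close>. Fubini, with the majorant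
  \<open>indicator {0..t} r * cmod (g \<xi> * \<phi> \<xi>)\<close>, then moves the time integral
  onto the phase.\<close>

lemma represented_by_averaging:
  assumes u: "represented_by (fourier_distribution u) g"
  shows "represented_by (fourier_distribution (averaging w t u)) (\<lambda>\<xi>. g \<xi> * osc w t \<xi>)"
  unfolding represented_by_def
proof (intro conjI allI impI)
  note [measurable] = osc_measurable osc_phase_measurable
  have g[measurable]: "g \<in> borel_measurable lborel" using u by (simp add: represented_by_def)
  then show "(\<lambda>\<xi>. g \<xi> * osc w t \<xi>) \<in> borel_measurable lborel" by measurable
  fix \<phi> :: "real^'d \<Rightarrow> complex" assume s: "schwartz \<phi>"
  have i: "integrable lborel (\<lambda>\<xi>. g \<xi> * \<phi> \<xi>)" using u s unfolding represented_by_def by blast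
  have "continuous_on UNIV \<phi>"
    using schwartz_differentiable[OF s] by (intro continuous_at_imp_continuous_on ballI differentiable_imp_continuous_within)
  then have p[measurable]: "\<phi> \<in> borel_measurable borel" by (rule borel_measurable_continuous_onI)
  show "integrable lborel (\<lambda>\<xi>. g \<xi> * osc w t \<xi> * \<phi> \<xi>)"
  proof (rule Bochner_Integration.integrable_bound[OF integrable_mult_right[OF i, of "complex_of_real t"]])
    show "(\<lambda>\<xi>. g \<xi> * osc w t \<xi> * \<phi> \<xi>) \<in> borel_measurable lborel" by measurable
    have "cmod (g \<xi> * osc w t \<xi> * \<phi> \<xi>) \<le> cmod (complex_of_real t * (g \<xi> * \<phi> \<xi>))" for \<xi>
      using mult_right_mono[OF norm_osc_le[of \<xi>], of "cmod (g \<xi>) * cmod (\<phi> \<xi>)"] t by (simp add: norm_mult mult_ac)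
    then show "AE \<xi> in lborel. cmod (g \<xi> * osc w t \<xi> * \<phi> \<xi>) \<le> cmod (complex_of_real t * (g \<xi> * \<phi> \<xi>))" by simp
  qed
  let ?f = "\<lambda>r \<xi>. (indicator {0..t} r *\<^sub>R iexp (\<xi> \<bullet> w r)) * (g \<xi> * \<phi> \<xi>)"
  have int: "integrable (lborel \<Otimes>\<^sub>M lborel) (case_prod ?f)"
  proof (rule lborel_pair.Fubini_integrable)
    have "(\<lambda>x. (case x of (r, \<xi>) \<Rightarrow> indicator {0..t} r *\<^sub>R iexp (\<xi> \<bullet> w r)) * (g (snd x) * \<phi> (snd x)))
       \<in> borel_measurable (lborel \<Otimes>\<^sub>M lborel)" by measurable
    then show "case_prod ?f \<in> borel_measurable (lborel \<Otimes>\<^sub>M lborel)" by (simp add: case_prod_unfold)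
    have "integrable lborel (\<lambda>r. indicator {0..t} r * (\<integral>\<xi>. cmod (g \<xi> * \<phi> \<xi>) \<partial>lborel))"
      by (intro integrable_mult_left integrable_indicator_Icc)
    then show "integrable lborel (\<lambda>r. \<integral>\<xi>. norm (case (r, \<xi>) of (r, \<xi>) \<Rightarrow> ?f r \<xi>) \<partial>lborel)"
      by (simp add: norm_mult mult.assoc)
    have "integrable lborel (\<lambda>\<xi>. ?f r \<xi>)" for r
    proof (rule Bochner_Integration.integrable_bound[OF i])
      show "(\<lambda>\<xi>. ?f r \<xi>) \<in> borel_measurable lborel" by measurable
    qed (auto simp: norm_mult indicator_def)
    then show "AE r in lborel. integrable lborel (\<lambda>\<xi>. case (r, \<xi>) of (r, \<xi>) \<Rightarrow> ?f r \<xi>)" by simp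
  qed
  have "fourier_distribution (averaging w t u) \<phi> = (LINT r:{0..t}|lborel. u (\<lambda>x. fourier \<phi> (x - w r)))"
    using s by (simp add: fourier_distribution_def averaging_def)
  also have "\<dots> = (\<integral>r. \<integral>\<xi>. ?f r \<xi> \<partial>lborel \<partial>lborel)"
    unfolding set_lebesgue_integral_def
  proof (rule Bochner_Integration.integral_cong[OF refl])
    fix r
    let ?m = "\<lambda>y. iexp (y \<bullet> w r) * \<phi> y"
    have m: "schwartz ?m" by (rule schwartz_modulate[OF s])
    have "u (\<lambda>x. fourier \<phi> (x - w r)) = fourier_distribution u ?m"
      using m by (simp add: fourier_distribution_def fourier_translate[abs_def])
    also have "\<dots> = (\<integral>\<xi>. g \<xi> * ?m \<xi> \<partial>lborel)"
      using u m unfolding represented_by_def by blast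
    finally show "indicator {0..t} r *\<^sub>R u (\<lambda>x. fourier \<phi> (x - w r)) = (\<integral>\<xi>. ?f r \<xi> \<partial>lborel)"
      by (simp add: mult_ac)
  qed
  also have "\<dots> = (\<integral>\<xi>. \<integral>r. ?f r \<xi> \<partial>lborel \<partial>lborel)"
    using lborel_pair.Fubini_integral[OF int] by simp
  also have "\<dots> = (\<integral>\<xi>. osc w t \<xi> * (g \<xi> * \<phi> \<xi>) \<partial>lborel)"
    unfolding osc_def set_lebesgue_integral_def by (simp only: integral_mult_left_zero)
  also have "\<dots> = (\<integral>\<xi>. g \<xi> * osc w t \<xi> * \<phi> \<xi> \<partial>lborel)" by (simp only: mult_ac)
  finally show "fourier_distribution (averaging w t u) \<phi> = (\<integral>\<xi>. g \<xi> * osc w t \<xi> * \<phi> \<xi> \<partial>lborel)" .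
qed

end

lemma zero_in_FL: "((\<lambda>_. 0) :: ('d::finite) functional) \<in> FL \<alpha>" (is "?z \<in> _")
proof -
  have r: "represented_by (fourier_distribution ?z) (\<lambda>_. 0)"
    by (simp add: represented_by_def fourier_distribution_def)
  have t: "tempered_distribution ?z"
    unfolding tempered_distribution_def by (auto intro!: exI[of _ 0])
  have m: "fourier_function ?z \<in> borel_measurable lborel"
    using someI[of "represented_by (fourier_distribution ?z)", OF r]
    unfolding fourier_function_def represented_by_def by blast
  have "integrable lborel (\<lambda>\<xi>. cmod (fourier_function ?z \<xi>) * (1 + norm \<xi>) powr \<alpha>)"
  proof (rule integrable_cong_AE_imp[OF integrable_zero])
    show "(\<lambda>\<xi>. cmod (fourier_function ?z \<xi>) * (1 + norm \<xi>) powr \<alpha>) \<in> borel_measurable lborel"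
      using m by measurable
    show "AE \<xi> in lborel. 0 = cmod (fourier_function ?z \<xi>) * (1 + norm \<xi>) powr \<alpha>"
      using fourier_function_AE_eq[OF r] by eventually_elim simp
  qed
  then show ?thesis using r t unfolding FL_def by blast
qed

lemma represented_by_diff:
  assumes "represented_by u g" "represented_by v h"
  shows "represented_by (\<lambda>\<phi>. u \<phi> - v \<phi>) (\<lambda>x. g x - h x)"
  using assms unfolding represented_by_def by (auto simp: left_diff_distrib)

text \<open>The deterministic half of the theorem: one pointwise bound on the increments of
  \<open>osc\<close>, for a single path, gives boundedness and the Holder estimate for all
  \<open>\<alpha>\<close> with the same \<open>C\<close>.\<close>

lemma averaging_FL_bounds:
  fixes w :: "real \<Rightarrow> real^'d"
  assumes w: "continuous_on {0..T} w"
    and C: "\<And>s t \<xi>. 0 \<le> s \<Longrightarrow> s \<le> t \<Longrightarrow> t \<le> T \<Longrightarrow>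
        cmod (osc w t \<xi> - osc w s \<xi>) \<le> C * \<bar>t - s\<bar> powr \<gamma> * (1 + norm \<xi>) powr - \<rho>"
  shows "t \<in> {0..T} \<Longrightarrow> FL_bounded_operator \<alpha> (\<alpha> + \<rho>) (averaging w t)"
    and "0 \<le> s \<Longrightarrow> s \<le> t \<Longrightarrow> t \<le> T \<Longrightarrow>
      FL_onorm \<alpha> (\<alpha> + \<rho>) (\<lambda>f \<phi>. averaging w t f \<phi> - averaging w s f \<phi>) \<le> C * \<bar>t - s\<bar> powr \<gamma>"
proof -
  show "FL_bounded_operator \<alpha> (\<alpha> + \<rho>) (averaging w t)" if t': "t \<in> {0..T}"
  proof -
    have t: "0 \<le> t" "t \<le> T" using t' by auto
    \<comment> \<open>\<open>osc\<close> vanishes at time 0, so the increment bound with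
      \<open>s = 0\<close> bounds \<open>osc w t\<close> itself.\<close>
    have "osc w 0 \<xi> = 0" for \<xi> using norm_osc_le[OF w, of 0 \<xi>] t by simp
    then have C': "cmod (osc w t \<xi>) \<le> (C * t powr \<gamma>) * (1 + norm \<xi>) powr - \<rho>" for \<xi>
      using C[of 0 t \<xi>] t by simp
    have lin: "averaging w t (\<lambda>\<phi>. u \<phi> + v \<phi>) = (\<lambda>\<phi>. averaging w t u \<phi> + averaging w t v \<phi>)"
      if "u \<in> FL \<alpha>" "v \<in> FL \<alpha>" for u v
    proof
      fix \<phi>
      have tu: "tempered_distribution u" "tempered_distribution v" using that by (auto simp: FL_def)
      show "averaging w t (\<lambda>\<phi>. u \<phi> + v \<phi>) \<phi> = averaging w t u \<phi> + averaging w t v \<phi>"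
      proof (cases "schwartz \<phi>")
        case True
        show ?thesis unfolding averaging_def
          using set_integral_add(2)[OF averaging_integrand[OF w t tu(1) True] averaging_integrand[OF w t tu(2) True]] .
      next
        case False
        then have "u (\<lambda>x. \<phi> (x - w r)) = 0" "v (\<lambda>x. \<phi> (x - w r)) = 0" for r
          using tu unfolding tempered_distribution_def by (auto simp: schwartz_translate_iff)
        then show ?thesis by (simp add: averaging_def)
      qed
    qed
    have scale: "averaging w t (\<lambda>\<phi>. c * u \<phi>) = (\<lambda>\<phi>. c * averaging w t u \<phi>)" for c u
      by (simp add: averaging_def)
    note rep = represented_by_averaging[OF w t FL_represented]
    have "averaging w t u \<in> FL (\<alpha> + \<rho>)" if u: "u \<in> FL \<alpha>" for u
      using FL_multiplier(1)[OF u rep[OF u] C'] tempered_distribution_averaging[OF w t, of u] rep[OF u] u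
      unfolding FL_def by blast
    then show ?thesis unfolding FL_bounded_operator_def
      using lin scale FL_multiplier(2)[OF _ rep C'] by blast
  qed
  show "FL_onorm \<alpha> (\<alpha> + \<rho>) (\<lambda>f \<phi>. averaging w t f \<phi> - averaging w s f \<phi>) \<le> C * \<bar>t - s\<bar> powr \<gamma>"
    if st: "0 \<le> s" "s \<le> t" "t \<le> T"
    unfolding FL_onorm_def
  proof (rule cSUP_least)
    show "FL \<alpha> \<noteq> {}" using zero_in_FL by blast
    fix u :: "'d functional" assume u: "u \<in> FL \<alpha>"
    have "represented_by (fourier_distribution (\<lambda>\<phi>. averaging w t u \<phi> - averaging w s u \<phi>))
       (\<lambda>\<xi>. fourier_function u \<xi> * osc w t \<xi> - fourier_function u \<xi> * osc w s \<xi>)"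
    proof -
      have "fourier_distribution (\<lambda>\<phi>. averaging w t u \<phi> - averaging w s u \<phi>) =
        (\<lambda>\<phi>. fourier_distribution (averaging w t u) \<phi> - fourier_distribution (averaging w s u) \<phi>)"
        by (auto simp: fourier_distribution_def)
      then show ?thesis
        using represented_by_diff[OF represented_by_averaging[OF w _ _ FL_represented[OF u], of t]
            represented_by_averaging[OF w _ _ FL_represented[OF u], of s]] st by simp
    qed
    then have "FL_norm (\<alpha> + \<rho>) (\<lambda>\<phi>. averaging w t u \<phi> - averaging w s u \<phi>) \<le> (C * \<bar>t - s\<bar> powr \<gamma>) * FL_norm \<alpha> u"
      by (intro FL_multiplier(2)[OF u _ C[OF st]]) (simp add: right_diff_distrib)
    \<comment> \<open>The sign is read off from the bound at frequency 0. It settles the case of a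
      vanishing norm, where the quotient is 0.\<close>
    moreover have "0 \<le> C * \<bar>t - s\<bar> powr \<gamma>"
      using order_trans[OF norm_ge_zero C[OF st, of 0]] by simp
    ultimately show "FL_norm (\<alpha> + \<rho>) (\<lambda>\<phi>. averaging w t u \<phi> - averaging w s u \<phi>) / FL_norm \<alpha> u \<le> C * \<bar>t - s\<bar> powr \<gamma>"
      using FL_norm_nonneg[of \<alpha> u] by (cases "FL_norm \<alpha> u = 0") (auto simp: divide_le_eq)
  qed
qed

section \<open>Local nondeterminism\<close>

lemma has_bochner_integral_powr_from_0:
  fixes e c :: real
  assumes "-1 < e" "0 \<le> c"
  shows "has_bochner_integral lborel (\<lambda>x. indicator {0..c} x * x powr e) (c powr (e + 1) / (e + 1))"
proof (rule has_bochner_integral_nn_integral)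
  show "(\<integral>\<^sup>+x. ennreal (indicator {0..c} x * x powr e) \<partial>lborel) = ennreal (c powr (e + 1) / (e + 1))"
    using nn_integral_has_integral_lebesgue[OF _ has_integral_powr_from_0[OF assms]] by simp
qed (use assms in auto)

lemma integrable_powr_to_inf:
  fixes e :: real
  assumes "e < -1"
  shows "integrable lborel (\<lambda>x. indicator {1..} x * x powr e)"
proof -
  have "has_bochner_integral lborel (\<lambda>x. indicator {1..} x * x powr e) (-(1 powr (e + 1)) / (e + 1))"
  proof (rule has_bochner_integral_nn_integral)
    show "(\<integral>\<^sup>+x. ennreal (indicator {1..} x * x powr e) \<partial>lborel) = ennreal (-(1 powr (e + 1)) / (e + 1))"
      using nn_integral_has_integral_lebesgue[OF _ has_integral_powr_to_inf[OF assms, of 1]] by simp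
  qed (use assms in \<open>auto simp: divide_nonpos_neg\<close>)
  then show ?thesis by (simp add: has_bochner_integral_iff)
qed

text \<open>The function x_+^a. As \<open>0 powr a = 0\<close> for every exponent, it vanishes on
  the closed negative half line even when a \<le> 0; for a = H - 1/2 this is the case H \<le>
  1/2.\<close>

definition pos_powr :: "real \<Rightarrow> real \<Rightarrow> real" where
  "pos_powr a x = (max 0 x) powr a"

lemma pos_powr_measurable[measurable]: "pos_powr a \<in> borel_measurable borel"
  unfolding pos_powr_def[abs_def] by measurable

lemma pos_powr_nonpos: "x \<le> 0 \<Longrightarrow> pos_powr a x = 0"
  by (simp add: pos_powr_def max_def)

lemma pos_powr_scale: "0 < h \<Longrightarrow> pos_powr a (h * x) = h powr a * pos_powr a x"
  by (cases "0 < x") (simp_all add: pos_powr_def powr_mult mult_nonneg_nonpos max_absorb1)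

lemma pos_powr_sq: "(pos_powr a x)\<^sup>2 = pos_powr (2 * a) x"
  by (simp add: pos_powr_def power2_eq_square powr_add[symmetric])

text \<open>Both terms are square integrable near their singularities because 2H - 1 > -1. At
  infinity the mean value theorem gives a squared increment of order v^(2H - 3), integrable because
  H < 1.\<close>

lemma integrable_unit_increment_sq:
  assumes "0 < H" "H < 1"
  shows "integrable lborel (\<lambda>v. (pos_powr (H - 1/2) (1 + v) - pos_powr (H - 1/2) v)\<^sup>2)"
proof -
  define a where "a = H - 1/2"
  have e: "-1 < 2 * a" "2 * a - 2 < -1" "a < 1" using assms by (auto simp: a_def)
  let ?p = "\<lambda>c x. indicator {0..c} x * x powr (2 * a)"
  define G where "G v = 2 * ?p 2 (1 + 1 * v) + 2 * ?p 1 v + a\<^sup>2 * (indicator {1..} v * v powr (2 * a - 2))" for v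
  have p: "integrable lborel (?p c)" if "0 \<le> c" for c
    using has_bochner_integral_powr_from_0[OF e(1) that] by (simp add: has_bochner_integral_iff)
  have G: "integrable lborel G"
    unfolding G_def by (intro Bochner_Integration.integrable_add integrable_mult_right p
        lborel_integrable_real_affine integrable_powr_to_inf e) auto
  have le: "norm ((pos_powr a (1 + v) - pos_powr a v)\<^sup>2) \<le> norm (G v)" for v
  proof -
    have "(pos_powr a (1 + v) - pos_powr a v)\<^sup>2 \<le> G v"
    proof (cases "v \<le> 1")
      case True
      have *: "pos_powr (2 * a) (1 + v) = ?p 2 (1 + 1 * v)" "pos_powr (2 * a) v = ?p 1 v"
        using True by (auto simp: pos_powr_def max_def indicator_def)
      have "(pos_powr a (1 + v) - pos_powr a v)\<^sup>2 \<le> 2 * (pos_powr a (1 + v))\<^sup>2 + 2 * (pos_powr a v)\<^sup>2"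
        using zero_le_power2[of "pos_powr a (1 + v) + pos_powr a v"] by (simp add: power2_eq_square algebra_simps)
      also have "\<dots> = 2 * ?p 2 (1 + 1 * v) + 2 * ?p 1 v" by (simp only: pos_powr_sq *)
      also have "\<dots> \<le> G v" by (simp add: G_def)
      finally show ?thesis .
    next
      case False
      then have v: "1 < v" by simp
      have "\<exists>z>v. z < 1 + v \<and> (1 + v) powr a - v powr a = ((1 + v) - v) * (a * z powr (a - 1))"
        using v by (intro MVT2) (auto intro!: derivative_eq_intros)
      then obtain z where z: "v < z" "(1 + v) powr a - v powr a = a * z powr (a - 1)" by auto
      have "z powr (a - 1) \<le> v powr (a - 1)" using z v e by (intro powr_mono2') auto
      then have "(z powr (a - 1))\<^sup>2 \<le> (v powr (a - 1))\<^sup>2" by (intro power_mono) auto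
      also have "(v powr (a - 1))\<^sup>2 = v powr (2 * a - 2)"
        by (simp add: power2_eq_square powr_add[symmetric])
      finally have "(a * z powr (a - 1))\<^sup>2 \<le> a\<^sup>2 * v powr (2 * a - 2)"
        by (simp add: power_mult_distrib mult_left_mono)
      then have "(pos_powr a (1 + v) - pos_powr a v)\<^sup>2 \<le> a\<^sup>2 * v powr (2 * a - 2)"
        using v z(2) by (simp add: pos_powr_def)
      also have "\<dots> \<le> G v" using v by (simp add: G_def)
      finally show ?thesis .
    qed
    then show ?thesis by (simp add: order_trans[OF _ abs_ge_self])
  qed
  show ?thesis unfolding a_def[symmetric]
    by (rule Bochner_Integration.integrable_bound[OF G]) (use le in auto)
qed

text \<open>The Mandelbrot--Van Ness kernel: up to a factor, fractional Brownian motion has the covariance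
  of the white noise integrals of \<open>fbm_kernel H t\<close>.\<close>

definition fbm_kernel :: "real \<Rightarrow> real \<Rightarrow> real \<Rightarrow> real" where
  "fbm_kernel H t u = pos_powr (H - 1/2) (t - u) - pos_powr (H - 1/2) (- u)"

definition fbm_const :: "real \<Rightarrow> real" where
  "fbm_const H = (\<integral>v. (pos_powr (H - 1/2) (1 + v) - pos_powr (H - 1/2) v)\<^sup>2 \<partial>lborel)"

lemma fbm_kernel_measurable[measurable]: "fbm_kernel H t \<in> borel_measurable borel"
  unfolding fbm_kernel_def[abs_def] by measurable

lemma fbm_kernel_0[simp]: "fbm_kernel H 0 u = 0"
  by (simp add: fbm_kernel_def)

text \<open>Self-similarity: with h = t - s the substitution u = s - h v takes h^(H - 1/2) out of
  both kernels, and the square together with the Jacobian h yields h^(2H). The base terms at time 0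
  cancel in the difference.\<close>

lemma fbm_kernel_increment:
  assumes H: "0 < H" "H < 1"
  shows "has_bochner_integral lborel (\<lambda>u. (fbm_kernel H t u - fbm_kernel H s u)\<^sup>2)
    (fbm_const H * \<bar>t - s\<bar> powr (2 * H))"
proof -
  let ?a = "H - 1/2"
  have main: "has_bochner_integral lborel (\<lambda>u. (fbm_kernel H t u - fbm_kernel H s u)\<^sup>2)
    (fbm_const H * \<bar>t - s\<bar> powr (2 * H))" if "s < t" for s t
  proof -
    define h where "h = t - s"
    have h: "0 < h" using that by (simp add: h_def)
    have "has_bochner_integral lborel (\<lambda>v. (pos_powr ?a (1 + v) - pos_powr ?a v)\<^sup>2) (fbm_const H)"
      using integrable_unit_increment_sq[OF H] by (simp add: has_bochner_integral_iff fbm_const_def)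
    then have "has_bochner_integral lborel (\<lambda>v. (h powr ?a)\<^sup>2 * (pos_powr ?a (1 + v) - pos_powr ?a v)\<^sup>2) ((h powr ?a)\<^sup>2 * fbm_const H)"
      by (rule has_bochner_integral_mult_right)
    moreover have "fbm_kernel H t (s + (- h) * v) - fbm_kernel H s (s + (- h) * v) =
        h powr ?a * (pos_powr ?a (1 + v) - pos_powr ?a v)" for v
    proof -
      have "fbm_kernel H t (s + (- h) * v) - fbm_kernel H s (s + (- h) * v) = pos_powr ?a (h * (1 + v)) - pos_powr ?a (h * v)"
        by (simp add: fbm_kernel_def h_def algebra_simps)
      then show ?thesis using h by (simp only: pos_powr_scale right_diff_distrib)
    qed
    ultimately have "has_bochner_integral lborel (\<lambda>v. (fbm_kernel H t (s + (- h) * v) - fbm_kernel H s (s + (- h) * v))\<^sup>2)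
        ((h powr ?a)\<^sup>2 * fbm_const H)"
      by (simp only: power_mult_distrib)
    moreover have "(h powr ?a)\<^sup>2 * fbm_const H = (fbm_const H * h powr (2 * H)) /\<^sub>R \<bar>- h\<bar>"
    proof -
      have "h powr (2 * H) = h powr ?a * h powr ?a * h powr 1" by (simp only: powr_add[symmetric]) simp
      then show ?thesis using h by (simp add: power2_eq_square)
    qed
    ultimately have "has_bochner_integral lborel (\<lambda>u. (fbm_kernel H t u - fbm_kernel H s u)\<^sup>2) (fbm_const H * h powr (2 * H))"
      using lborel_has_bochner_integral_real_affine_iff[of "- h" "\<lambda>u. (fbm_kernel H t u - fbm_kernel H s u)\<^sup>2" "fbm_const H * h powr (2 * H)" s] h
      by (metis neg_equal_0_iff_equal less_irrefl)
    then show ?thesis using h by (simp add: h_def)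
  qed
  consider "s < t" | "t < s" | "s = t" by linarith
  then show ?thesis
  proof cases
    case 2 then show ?thesis using main[of t s] by (simp add: power2_commute abs_minus_commute)
  qed (use main in \<open>auto simp: has_bochner_integral_zero\<close>)
qed

lemma fbm_kernel_square:
  assumes "0 < H" "H < 1"
  shows "has_bochner_integral lborel (\<lambda>u. (fbm_kernel H t u)\<^sup>2) (fbm_const H * \<bar>t\<bar> powr (2 * H))"
  using fbm_kernel_increment[OF assms, of t 0] by simp

text \<open>Polarisation of \<open>fbm_kernel_increment\<close>; the kernel at time 0 vanishes, so
  the squares are themselves increments.\<close>

lemma fbm_kernel_covariance:
  assumes "0 < H" "H < 1"
  shows "has_bochner_integral lborel (\<lambda>u. fbm_kernel H s u * fbm_kernel H t u)
    (fbm_const H / 2 * (\<bar>t\<bar> powr (2 * H) + \<bar>s\<bar> powr (2 * H) - \<bar>t - s\<bar> powr (2 * H)))"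
proof -
  note sq = fbm_kernel_square[OF assms]
  have "has_bochner_integral lborel (\<lambda>u. 1/2 * ((fbm_kernel H t u)\<^sup>2 + (fbm_kernel H s u)\<^sup>2 - (fbm_kernel H t u - fbm_kernel H s u)\<^sup>2))
    (1/2 * (fbm_const H * \<bar>t\<bar> powr (2 * H) + fbm_const H * \<bar>s\<bar> powr (2 * H) - fbm_const H * \<bar>t - s\<bar> powr (2 * H)))"
    by (intro has_bochner_integral_mult_right has_bochner_integral_diff has_bochner_integral_add sq fbm_kernel_increment assms)
  then show ?thesis by (simp add: power2_eq_square algebra_simps)
qed

lemma fbm_kernel_quadratic_form:
  assumes "0 < H" "H < 1" "finite I"
  shows "has_bochner_integral lborel (\<lambda>u. (\<Sum>i\<in>I. b i * fbm_kernel H (x i) u)\<^sup>2)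
    (\<Sum>i\<in>I. \<Sum>j\<in>I. b i * b j * (fbm_const H / 2 * (\<bar>x j\<bar> powr (2 * H) + \<bar>x i\<bar> powr (2 * H) - \<bar>x j - x i\<bar> powr (2 * H))))"
proof -
  have "(\<Sum>i\<in>I. b i * fbm_kernel H (x i) u)\<^sup>2 = (\<Sum>i\<in>I. \<Sum>j\<in>I. b i * b j * (fbm_kernel H (x i) u * fbm_kernel H (x j) u))" for u
    by (simp add: power2_eq_square sum_product mult_ac)
  then show ?thesis
    by (simp only:) (intro has_bochner_integral_sum has_bochner_integral_mult_right fbm_kernel_covariance assms)
qed

lemma integrable_fbm_kernel_comb_sq:
  assumes "0 < H" "H < 1"
  shows "integrable lborel (\<lambda>u. (\<Sum>k<m. c k * (fbm_kernel H (y k) u - fbm_kernel H (z k) u))\<^sup>2)"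
proof -
  have i: "integrable lborel (\<lambda>u. fbm_kernel H s u * fbm_kernel H t u)" for s t
    using fbm_kernel_covariance[OF assms] by (simp add: has_bochner_integral_iff)
  have "(\<Sum>k<m. c k * (fbm_kernel H (y k) u - fbm_kernel H (z k) u))\<^sup>2 =
     (\<Sum>k<m. \<Sum>j<m. c k * c j * (fbm_kernel H (y k) u * fbm_kernel H (y j) u - fbm_kernel H (y k) u * fbm_kernel H (z j) u
       - (fbm_kernel H (z k) u * fbm_kernel H (y j) u - fbm_kernel H (z k) u * fbm_kernel H (z j) u)))" for u
    by (simp add: power2_eq_square sum_product algebra_simps)
  then show ?thesis
    by (auto intro!: Bochner_Integration.integrable_sum integrable_mult_right Bochner_Integration.integrable_diff i)
qed

abbreviation fbm_increment :: "real \<Rightarrow> (nat \<Rightarrow> real) \<Rightarrow> nat \<Rightarrow> real \<Rightarrow> real" where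
  "fbm_increment H \<tau> k u \<equiv> fbm_kernel H (\<tau> (Suc k)) u - fbm_kernel H (\<tau> k) u"

text \<open>Only the newest increment charges the interval between the last two times. This gives the
  conditional variance bound of one-sided local nondeterminism, which is then iterated.\<close>

lemma fbm_kernel_last_increment:
  assumes H: "0 < H" "H < 1" and "0 \<le> \<tau> 0" and mono: "\<And>k. k < Suc m \<Longrightarrow> \<tau> k \<le> \<tau> (Suc k)"
  shows "(c m)\<^sup>2 * (\<tau> (Suc m) - \<tau> m) powr (2 * H) / (2 * H)
    \<le> (\<integral>u. (\<Sum>k<Suc m. c k * fbm_increment H \<tau> k u)\<^sup>2 \<partial>lborel)"
proof -
  have le: "\<tau> k \<le> \<tau> m" if "k \<le> m" for k
    using that by (induction rule: inc_induct) (auto intro: order_trans[OF mono])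
  have m0: "0 \<le> \<tau> m" using le[of 0] assms(3) by simp
  define g where "g = \<tau> (Suc m) - \<tau> m"
  have g: "0 \<le> g" using mono[of m] by (simp add: g_def)
  let ?f = "\<lambda>u. (c m)\<^sup>2 * (indicator {0..g} (\<tau> (Suc m) + (- 1) * u) * (\<tau> (Suc m) + (- 1) * u) powr (2 * H - 1))"
  have "has_bochner_integral lborel (\<lambda>x. indicator {0..g} x * x powr (2 * H - 1)) (g powr (2 * H) / (2 * H))"
    using has_bochner_integral_powr_from_0[of "2 * H - 1" g] H g by simp
  then have "has_bochner_integral lborel ?f ((c m)\<^sup>2 * (g powr (2 * H) / (2 * H)))"
    by (intro has_bochner_integral_mult_right)
      (subst (asm) lborel_has_bochner_integral_real_affine_iff[of "-1" _ _ "\<tau> (Suc m)"], auto)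
  then have f: "integrable lborel ?f" "(c m)\<^sup>2 * g powr (2 * H) / (2 * H) = integral\<^sup>L lborel ?f"
    by (simp_all add: has_bochner_integral_iff)
  have "?f u \<le> (\<Sum>k<Suc m. c k * fbm_increment H \<tau> k u)\<^sup>2" for u
  proof (cases "\<tau> m \<le> u \<and> u \<le> \<tau> (Suc m)")
    case True
    \<comment> \<open>Here u \<ge> \<tau> m \<ge> 0, so both truncated powers in the older kernels
      have nonpositive arguments.\<close>
    have z: "fbm_kernel H (\<tau> k) u = 0" if "k \<le> m" for k
      using True m0 le[OF that] by (simp add: fbm_kernel_def pos_powr_nonpos)
    have "(\<Sum>k<Suc m. c k * fbm_increment H \<tau> k u) = c m * fbm_kernel H (\<tau> (Suc m)) u"
      by (simp add: z)
    also have "fbm_kernel H (\<tau> (Suc m)) u = pos_powr (H - 1/2) (\<tau> (Suc m) - u)"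
      using True m0 by (simp add: fbm_kernel_def pos_powr_nonpos)
    finally have "(\<Sum>k<Suc m. c k * fbm_increment H \<tau> k u)\<^sup>2 =
        (c m)\<^sup>2 * pos_powr (2 * (H - 1/2)) (\<tau> (Suc m) - u)"
      by (simp only: power_mult_distrib pos_powr_sq)
    then show ?thesis using True by (simp add: g_def pos_powr_def)
  next
    case False
    then have "indicator {0..g} (\<tau> (Suc m) + (- 1) * u) = (0::real)" by (auto simp: g_def indicator_def)
    then show ?thesis by simp
  qed
  then show ?thesis unfolding f(2)[unfolded g_def]
    using f(1) integrable_fbm_kernel_comb_sq[OF H] unfolding g_def by (intro integral_mono) (auto simp del: sum.lessThan_Suc)
qed

text \<open>Induction over the newest increment. The full norm \<open>J\<close> controls that
  increment by \<open>fbm_kernel_last_increment\<close>; removing it from the sum costs a factor 2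
  and twice its own squared norm, which is again a multiple of \<open>J\<close>, so the induction
  hypothesis applies to the rest. The constant degrades with \<open>m\<close> but does not depend on
  the times or the coefficients.\<close>

lemma fbm_kernel_nondeterminism:
  assumes H: "0 < H" "H < 1"
  shows "\<exists>\<delta>>0. \<forall>c \<tau>. 0 \<le> \<tau> 0 \<longrightarrow> (\<forall>k<m. \<tau> k \<le> \<tau> (Suc k)) \<longrightarrow>
    \<delta> * (\<Sum>k<m. (c k)\<^sup>2 * (\<tau> (Suc k) - \<tau> k) powr (2 * H))
      \<le> (\<integral>u. (\<Sum>k<m. c k * fbm_increment H \<tau> k u)\<^sup>2 \<partial>lborel)"
proof (induction m)
  case 0 show ?case by (intro exI[of _ 1]) simp
next
  case (Suc m)
  then obtain \<delta> where \<delta>: "0 < \<delta>" and IH: "\<And>c \<tau>. 0 \<le> \<tau> 0 \<Longrightarrow> (\<And>k. k < m \<Longrightarrow> \<tau> k \<le> \<tau> (Suc k)) \<Longrightarrow>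
    \<delta> * (\<Sum>k<m. (c k)\<^sup>2 * (\<tau> (Suc k) - \<tau> k) powr (2 * H))
      \<le> (\<integral>u. (\<Sum>k<m. c k * fbm_increment H \<tau> k u)\<^sup>2 \<partial>lborel)" by blast
  have c0: "0 \<le> fbm_const H" by (simp add: fbm_const_def)
  \<comment> \<open>The first summand of \<open>R\<close> pays for the older increments,
    \<open>2 * H\<close> for the newest one; the new constant is 1 / R.\<close>
  define R where "R = (2 + 4 * H * fbm_const H) / \<delta> + 2 * H"
  have R: "0 < R" using H c0 \<delta> unfolding R_def by (intro add_pos_pos divide_pos_pos add_pos_nonneg mult_nonneg_nonneg) auto
  have "1 / R * (\<Sum>k<Suc m. (c k)\<^sup>2 * (\<tau> (Suc k) - \<tau> k) powr (2 * H))
      \<le> (\<integral>u. (\<Sum>k<Suc m. c k * fbm_increment H \<tau> k u)\<^sup>2 \<partial>lborel)"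
    if \<tau>: "0 \<le> \<tau> 0" "\<And>k. k < Suc m \<Longrightarrow> \<tau> k \<le> \<tau> (Suc k)" for c \<tau>
  proof -
    let ?S = "\<lambda>m u. \<Sum>k<m. c k * fbm_increment H \<tau> k u"
    let ?\<Delta> = "\<lambda>u. fbm_kernel H (\<tau> (Suc m)) u - fbm_kernel H (\<tau> m) u"
    define g where "g = (c m)\<^sup>2 * (\<tau> (Suc m) - \<tau> m) powr (2 * H)"
    define J where "J = (\<integral>u. (?S (Suc m) u)\<^sup>2 \<partial>lborel)"
    have g: "g \<le> 2 * H * J"
      using fbm_kernel_last_increment[OF H \<tau>, of m c] H by (simp add: g_def J_def field_simps)
    have \<Delta>: "integrable lborel (\<lambda>u. (?\<Delta> u)\<^sup>2)" "(\<integral>u. (?\<Delta> u)\<^sup>2 \<partial>lborel) = fbm_const H * (\<tau> (Suc m) - \<tau> m) powr (2 * H)"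
      using fbm_kernel_increment[OF H, of "\<tau> (Suc m)" "\<tau> m"] \<tau>(2)[of m] by (simp_all add: has_bochner_integral_iff)
    have "(\<integral>u. (?S m u)\<^sup>2 \<partial>lborel) \<le> (\<integral>u. 2 * (?S (Suc m) u)\<^sup>2 + 2 * (c m)\<^sup>2 * (?\<Delta> u)\<^sup>2 \<partial>lborel)"
    proof (rule integral_mono)
      \<comment> \<open>With x = \<open>?S m u\<close> and y = \<open>c m * ?\<Delta> u\<close>, the
        right-hand side minus the left is (x + 2 y)^2.\<close>
      show "(?S m u)\<^sup>2 \<le> 2 * (?S (Suc m) u)\<^sup>2 + 2 * (c m)\<^sup>2 * (?\<Delta> u)\<^sup>2" for u
        using zero_le_power2[of "?S m u + 2 * (c m * ?\<Delta> u)"] by (simp add: power2_eq_square algebra_simps)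
    qed (intro integrable_fbm_kernel_comb_sq H Bochner_Integration.integrable_add integrable_mult_right \<Delta>)+
    also have "\<dots> = 2 * J + 2 * (c m)\<^sup>2 * (fbm_const H * (\<tau> (Suc m) - \<tau> m) powr (2 * H))"
      using integrable_fbm_kernel_comb_sq[OF H] \<Delta>
      by (subst Bochner_Integration.integral_add) (auto simp: J_def simp del: sum.lessThan_Suc)
    also have "\<dots> = 2 * J + 2 * fbm_const H * g" by (simp add: g_def)
    also have "\<dots> \<le> (2 + 4 * H * fbm_const H) * J"
      using mult_left_mono[OF g, of "2 * fbm_const H"] c0 by (simp add: algebra_simps)
    finally have "\<delta> * (\<Sum>k<m. (c k)\<^sup>2 * (\<tau> (Suc k) - \<tau> k) powr (2 * H)) \<le> (2 + 4 * H * fbm_const H) * J"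
      using IH[of \<tau> c] \<tau> by (meson less_SucI order_trans)
    then have "(\<Sum>k<m. (c k)\<^sup>2 * (\<tau> (Suc k) - \<tau> k) powr (2 * H)) \<le> (2 + 4 * H * fbm_const H) * J / \<delta>"
      using \<delta> by (simp add: pos_le_divide_eq mult.commute)
    then have "(\<Sum>k<Suc m. (c k)\<^sup>2 * (\<tau> (Suc k) - \<tau> k) powr (2 * H)) \<le> R * J"
      using g by (simp add: R_def g_def[symmetric] distrib_right)
    then show ?thesis using R unfolding J_def[symmetric] by (simp add: pos_divide_le_eq mult.commute)
  qed
  then show ?case using R by (intro exI[of _ "1 / R"]) auto
qed

text \<open>Turns a signed sum of values into a sum of increments whose coefficients are tail sums
  of the signs, the form that \<open>fbm_kernel_nondeterminism\<close> accepts.\<close>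

lemma abel_summation:
  fixes e f :: "nat \<Rightarrow> real"
  shows "(\<Sum>k<m. (\<Sum>j=k..<m. e j) * (f (Suc k) - f k)) = (\<Sum>j<m. e j * (f (Suc j) - f 0))"
proof (induction m)
  case (Suc m)
  have "(\<Sum>k<Suc m. (\<Sum>j=k..<Suc m. e j) * (f (Suc k) - f k)) =
      (\<Sum>k<Suc m. (\<Sum>j=k..<m. e j) * (f (Suc k) - f k) + e m * (f (Suc k) - f k))"
    by (intro sum.cong) (auto simp: distrib_right)
  also have "\<dots> = (\<Sum>j<m. e j * (f (Suc j) - f 0)) + e m * (\<Sum>k<Suc m. f (Suc k) - f k)"
    by (simp add: sum.distrib Suc sum_distrib_left distrib_left)
  also have "(\<Sum>k<Suc m. f (Suc k) - f k) = f (Suc m) - f 0" by (rule sum_lessThan_telescope)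
  finally show ?case by simp
qed simp

text \<open>A sum of an odd number of signs is an odd integer, hence nonzero.\<close>

lemma sum_signs_sq_ge_1:
  fixes e :: "'a \<Rightarrow> real"
  assumes "finite A" "odd (card A)" "\<And>j. j \<in> A \<Longrightarrow> e j = 1 \<or> e j = -1"
  shows "1 \<le> (\<Sum>j\<in>A. e j)\<^sup>2"
proof -
  have "\<exists>z::int. (\<Sum>j\<in>A. e j) = of_int z \<and> (odd z \<longleftrightarrow> odd (card A))"
    using assms(1,3)
  proof (induction A rule: finite_induct)
    case empty show ?case by (intro exI[of _ 0]) simp
  next
    case (insert a A)
    then obtain z where z: "(\<Sum>j\<in>A. e j) = of_int z" "odd z \<longleftrightarrow> odd (card A)" by auto
    have "\<exists>y::int. e a = of_int y \<and> odd y"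
      using insert.prems[of a] by (auto intro: exI[of _ 1] exI[of _ "-1"])
    then obtain y :: int where y: "e a = of_int y" "odd y" by blast
    show ?case using insert z y by (intro exI[of _ "y + z"]) auto
  qed
  then obtain z :: int where z: "(\<Sum>j\<in>A. e j) = of_int z" "odd z" using assms(2) by blast
  have "1 \<le> \<bar>z\<bar>" using z(2) by (cases "z = 0") auto
  then have "1 \<le> z\<^sup>2" by (metis abs_le_square_iff abs_1 one_power2 power2_abs)
  then show ?thesis unfolding z(1) by (metis of_int_1_le_iff of_int_power)
qed

text \<open>The partial sums of an even number of signs are nonzero at every second place.\<close>

lemma fbm_kernel_signs_sorted:
  assumes H: "0 < H" "H < 1"
  shows "\<exists>\<delta>>0. \<forall>e \<sigma>. (\<forall>k<2*n. e k = 1 \<or> e k = -1) \<longrightarrow> (\<forall>k<2*n. 0 \<le> \<sigma> k) \<longrightarrow>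
      (\<forall>k. Suc k < 2*n \<longrightarrow> \<sigma> k \<le> \<sigma> (Suc k)) \<longrightarrow>
    \<delta> * (\<Sum>k<n. (\<sigma> (Suc (2*k)) - \<sigma> (2*k)) powr (2 * H))
      \<le> (\<integral>u. (\<Sum>k<2*n. e k * fbm_kernel H (\<sigma> k) u)\<^sup>2 \<partial>lborel)"
proof -
  obtain \<delta> where \<delta>: "0 < \<delta>" and nd: "\<And>c \<tau>. 0 \<le> \<tau> 0 \<Longrightarrow> (\<And>k. k < 2*n \<Longrightarrow> \<tau> k \<le> \<tau> (Suc k)) \<Longrightarrow>
    \<delta> * (\<Sum>k<2*n. (c k)\<^sup>2 * (\<tau> (Suc k) - \<tau> k) powr (2 * H))
      \<le> (\<integral>u. (\<Sum>k<2*n. c k * fbm_increment H \<tau> k u)\<^sup>2 \<partial>lborel)"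
    using fbm_kernel_nondeterminism[OF H, of "2*n"] by blast
  have "\<delta> * (\<Sum>k<n. (\<sigma> (Suc (2*k)) - \<sigma> (2*k)) powr (2 * H))
      \<le> (\<integral>u. (\<Sum>k<2*n. e k * fbm_kernel H (\<sigma> k) u)\<^sup>2 \<partial>lborel)"
    if e: "\<And>k. k < 2*n \<Longrightarrow> e k = 1 \<or> e k = -1" and \<sigma>: "\<And>k. k < 2*n \<Longrightarrow> 0 \<le> \<sigma> k"
      "\<And>k. Suc k < 2*n \<Longrightarrow> \<sigma> k \<le> \<sigma> (Suc k)" for e \<sigma>
  proof -
    \<comment> \<open>The time 0, whose kernel vanishes, is put in front, so every index moves up by
      one: the gap between \<open>\<sigma> (2*k)\<close> and \<open>\<sigma> (Suc (2*k))\<close> is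
      increment number \<open>Suc (2*k)\<close> of \<open>\<tau>\<close>, and its tail sum runs over
      the odd number 2n - 2k - 1 of signs.\<close>
    define \<tau> where "\<tau> = case_nat (0::real) \<sigma>"
    define c where "c k = (\<Sum>j=k..<2*n. e j)" for k
    have \<tau>: "\<tau> 0 = 0" "\<tau> (Suc k) = \<sigma> k" for k by (auto simp: \<tau>_def)
    have m: "\<tau> k \<le> \<tau> (Suc k)" if "k < 2*n" for k using that \<sigma> by (cases k) (auto simp: \<tau>)
    have "(\<Sum>k<n. (\<sigma> (Suc (2*k)) - \<sigma> (2*k)) powr (2 * H)) =
        (\<Sum>k\<in>(\<lambda>k. Suc (2*k)) ` {..<n}. (\<tau> (Suc k) - \<tau> k) powr (2 * H))"
      by (subst sum.reindex) (auto simp: inj_on_def \<tau>)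
    also have "\<dots> \<le> (\<Sum>k\<in>(\<lambda>k. Suc (2*k)) ` {..<n}. (c k)\<^sup>2 * (\<tau> (Suc k) - \<tau> k) powr (2 * H))"
    proof (intro sum_mono)
      fix k assume "k \<in> (\<lambda>k. Suc (2*k)) ` {..<n}"
      then obtain i where i: "i < n" "k = Suc (2*i)" by auto
      then have "odd (card {k..<2*n})" by auto
      then have "1 \<le> (c k)\<^sup>2" unfolding c_def using e by (intro sum_signs_sq_ge_1) auto
      then show "(\<tau> (Suc k) - \<tau> k) powr (2 * H) \<le> (c k)\<^sup>2 * (\<tau> (Suc k) - \<tau> k) powr (2 * H)"
        using mult_right_mono[of 1 "(c k)\<^sup>2" "(\<tau> (Suc k) - \<tau> k) powr (2 * H)"] by simp
    qed
    also have "\<dots> \<le> (\<Sum>k<2*n. (c k)\<^sup>2 * (\<tau> (Suc k) - \<tau> k) powr (2 * H))"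
      by (intro sum_mono2) auto
    finally have "\<delta> * (\<Sum>k<n. (\<sigma> (Suc (2*k)) - \<sigma> (2*k)) powr (2 * H)) \<le>
       \<delta> * (\<Sum>k<2*n. (c k)\<^sup>2 * (\<tau> (Suc k) - \<tau> k) powr (2 * H))"
      using \<delta> by (simp add: mult_left_mono)
    also have "\<dots> \<le> (\<integral>u. (\<Sum>k<2*n. c k * fbm_increment H \<tau> k u)\<^sup>2 \<partial>lborel)"
      by (rule nd) (use m in \<open>auto simp: \<tau>\<close>)
    also have "(\<lambda>u. \<Sum>k<2*n. c k * fbm_increment H \<tau> k u) =
        (\<lambda>u. \<Sum>k<2*n. e k * fbm_kernel H (\<sigma> k) u)"
      using abel_summation[of e "2*n" "\<lambda>k. fbm_kernel H (\<tau> k) _"] by (simp add: c_def \<tau>)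
    finally show ?thesis .
  qed
  then show ?thesis using \<delta> by blast
qed

lemma exists_sorting_permutation:
  fixes x :: "nat \<Rightarrow> real"
  shows "\<exists>p. p permutes {..<m} \<and> (\<forall>k. Suc k < m \<longrightarrow> x (p k) \<le> x (p (Suc k)))"
proof -
  let ?ys = "map x [0..<m]"
  obtain p where p: "p permutes {..<length ?ys}" "permute_list p ?ys = sort ?ys"
    using mset_eq_permutation[of "sort ?ys" ?ys] by auto
  have pm: "p permutes {..<m}" using p(1) by simp
  have nth: "sort ?ys ! k = x (p k)" if "k < m" for k
    using that permutes_in_image[OF pm, of k] by (simp add: p(2)[symmetric] permute_list_def)
  have "x (p k) \<le> x (p (Suc k))" if "Suc k < m" for k
    using sorted_nth_mono[OF sorted_sort[of ?ys], of k "Suc k"] that nth by simp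
  then show ?thesis using pm by blast
qed

text \<open>Sorting reduces to the ordered case, as the kernel sum is invariant when signs and times
  are permuted together. The permutation depends on \<open>x\<close>, but \<open>\<delta>\<close>
  does not.\<close>

lemma fbm_kernel_signs:
  assumes H: "0 < H" "H < 1"
  shows "\<exists>\<delta>>0. \<forall>e x. (\<forall>k<2*n. e k = 1 \<or> e k = -1) \<longrightarrow> (\<forall>k<2*n. 0 \<le> x k) \<longrightarrow>
    (\<exists>p. p permutes {..<2*n} \<and> \<delta> * (\<Sum>k<n. \<bar>x (p (Suc (2*k))) - x (p (2*k))\<bar> powr (2 * H))
      \<le> (\<integral>u. (\<Sum>k<2*n. e k * fbm_kernel H (x k) u)\<^sup>2 \<partial>lborel))"
proof -
  obtain \<delta> where \<delta>: "0 < \<delta>" and nd: "\<And>e \<sigma>. (\<And>k. k < 2*n \<Longrightarrow> e k = 1 \<or> e k = -1) \<Longrightarrow> (\<And>k. k < 2*n \<Longrightarrow> 0 \<le> \<sigma> k) \<Longrightarrow>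
      (\<And>k. Suc k < 2*n \<Longrightarrow> \<sigma> k \<le> \<sigma> (Suc k)) \<Longrightarrow>
    \<delta> * (\<Sum>k<n. (\<sigma> (Suc (2*k)) - \<sigma> (2*k)) powr (2 * H))
      \<le> (\<integral>u. (\<Sum>k<2*n. e k * fbm_kernel H (\<sigma> k) u)\<^sup>2 \<partial>lborel)"
    using fbm_kernel_signs_sorted[OF H, of n] by blast
  have "\<exists>p. p permutes {..<2*n} \<and> \<delta> * (\<Sum>k<n. \<bar>x (p (Suc (2*k))) - x (p (2*k))\<bar> powr (2 * H))
      \<le> (\<integral>u. (\<Sum>k<2*n. e k * fbm_kernel H (x k) u)\<^sup>2 \<partial>lborel)"
    if e: "\<And>k. k < 2*n \<Longrightarrow> e k = 1 \<or> e k = -1" and x: "\<And>k. k < 2*n \<Longrightarrow> 0 \<le> x k" for e x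
  proof -
    obtain p where p: "p permutes {..<2*n}" "\<And>k. Suc k < 2*n \<Longrightarrow> x (p k) \<le> x (p (Suc k))"
      using exists_sorting_permutation[of "2*n" x] by blast
    have pl: "p k < 2*n" if "k < 2*n" for k using permutes_in_image[OF p(1), of k] that by simp
    have "\<delta> * (\<Sum>k<n. (x (p (Suc (2*k))) - x (p (2*k))) powr (2 * H))
      \<le> (\<integral>u. (\<Sum>k<2*n. e (p k) * fbm_kernel H (x (p k)) u)\<^sup>2 \<partial>lborel)"
      using nd[of "\<lambda>k. e (p k)" "\<lambda>k. x (p k)"] e x p(2) pl by simp
    also have "(\<lambda>u. \<Sum>k<2*n. e (p k) * fbm_kernel H (x (p k)) u) = (\<lambda>u. \<Sum>k<2*n. e k * fbm_kernel H (x k) u)"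
      using sum.permute[OF p(1), of "\<lambda>k. e k * fbm_kernel H (x k) _"] by (simp add: comp_def)
    also have "(\<Sum>k<n. (x (p (Suc (2*k))) - x (p (2*k))) powr (2 * H)) = (\<Sum>k<n. \<bar>x (p (Suc (2*k))) - x (p (2*k))\<bar> powr (2 * H))"
      using p(2) by (intro sum.cong) auto
    finally show ?thesis using p(1) by blast
  qed
  then show ?thesis using \<delta> by blast
qed

section \<open>Moments of the oscillatory integral\<close>

text \<open>A single step from time 0 to time 1 in \<open>fbm_kernel_last_increment\<close> gives
  the lower bound 1 / (2H).\<close>

lemma fbm_const_pos:
  assumes "0 < H" "H < 1" shows "0 < fbm_const H"
proof -
  have "1 / (2 * H) \<le> fbm_const H"
    using fbm_kernel_last_increment[OF assms, of "\<lambda>k. real k" 0 "\<lambda>_. 1"] fbm_kernel_square[OF assms, of 1]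
    by (simp add: has_bochner_integral_iff)
  then show ?thesis using assms by (smt (verit) divide_pos_pos)
qed

section \<open>Characteristic functions of Gaussian processes\<close>

context prob_space begin

text \<open>The moments in \<open>scalar_fbm\<close> are Bochner integrals, which are 0 for
  nonintegrable functions; integrability has to be drawn from the Gaussian law.\<close>

lemma gaussian_rv_integrable:
  assumes "gaussian_rv M X"
  shows "integrable M X" "integrable M (\<lambda>\<omega>. (X \<omega>)\<^sup>2)"
proof -
  have X[measurable]: "X \<in> borel_measurable M" using assms by (simp add: gaussian_rv_def)
  have "integrable M X \<and> integrable M (\<lambda>\<omega>. (X \<omega>)\<^sup>2)"
  proof (cases "\<exists>m. AE \<omega> in M. X \<omega> = m")
    case True
    then obtain m where m: "AE \<omega> in M. X \<omega> = m" by blast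
    have "integrable M X"
      by (rule integrable_cong_AE_imp[of M "\<lambda>_. m"]) (use m in auto)
    moreover have "integrable M (\<lambda>\<omega>. (X \<omega>)\<^sup>2)"
      by (rule integrable_cong_AE_imp[of M "\<lambda>_. m\<^sup>2"]) (use m in auto)
    ultimately show ?thesis by blast
  next
    case False
    then obtain m \<sigma> where \<sigma>: "0 < \<sigma>" and D: "distributed M lborel X (\<lambda>x. ennreal (normal_density m \<sigma> x))"
      using assms by (auto simp: gaussian_rv_def)
    have i: "integrable M (\<lambda>\<omega>. g (X \<omega>))" if "integrable lborel (\<lambda>x. normal_density m \<sigma> x * g x)" "g \<in> borel_measurable borel" for g :: "real \<Rightarrow> real"
      using distributed_integrable[OF D, of g] that by simp
    have 1: "integrable lborel (\<lambda>x. normal_density m \<sigma> x * x)" by (rule integrable_normal_moment_nz_1[OF \<sigma>])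
    have "integrable lborel (\<lambda>x. normal_density m \<sigma> x * (x - m) ^ 2 + 2 * m * (normal_density m \<sigma> x * x) - m\<^sup>2 * normal_density m \<sigma> x)"
      using 1 \<sigma> by (intro Bochner_Integration.integrable_diff Bochner_Integration.integrable_add integrable_mult_right integrable_normal_moment) auto
    also have "(\<lambda>x. normal_density m \<sigma> x * (x - m) ^ 2 + 2 * m * (normal_density m \<sigma> x * x) - m\<^sup>2 * normal_density m \<sigma> x) =
        (\<lambda>x. normal_density m \<sigma> x * x\<^sup>2)"
      by (simp add: power2_eq_square algebra_simps)
    finally show ?thesis using i[of "\<lambda>x. x"] i[of "\<lambda>x. x\<^sup>2"] 1 by simp
  qed
  then show "integrable M X" "integrable M (\<lambda>\<omega>. (X \<omega>)\<^sup>2)" by auto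
qed

lemma gaussian_rv_char:
  assumes G: "gaussian_rv M X" and mean: "expectation X = 0"
  shows "expectation (\<lambda>\<omega>. iexp (X \<omega>)) = complex_of_real (exp (- expectation (\<lambda>\<omega>. (X \<omega>)\<^sup>2) / 2))"
proof (cases "\<exists>m. AE \<omega> in M. X \<omega> = m")
  have X[measurable]: "X \<in> borel_measurable M" using G by (simp add: gaussian_rv_def)
  case True
  then obtain m where m: "AE \<omega> in M. X \<omega> = m" by blast
  have "expectation X = expectation (\<lambda>_. m)" by (rule integral_cong_AE) (use m in auto)
  then have "m = 0" using mean by (simp add: prob_space)
  then have m: "AE \<omega> in M. X \<omega> = 0" using m by simp
  have "expectation (\<lambda>\<omega>. (X \<omega>)\<^sup>2) = expectation (\<lambda>_. 0)" by (rule integral_cong_AE) (use m in auto)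
  moreover have "expectation (\<lambda>\<omega>. iexp (X \<omega>)) = expectation (\<lambda>_. 1)"
    by (rule integral_cong_AE) (use m in auto)
  ultimately show ?thesis by (simp add: prob_space)
next
  have X[measurable]: "X \<in> borel_measurable M" using G by (simp add: gaussian_rv_def)
  case False
  then obtain m \<sigma> where \<sigma>: "0 < \<sigma>" and D: "distributed M lborel X (\<lambda>x. ennreal (normal_density m \<sigma> x))"
    using G by (auto simp: gaussian_rv_def)
  have m: "m = 0" using normal_distributed_expectation[OF \<sigma> D] mean by simp
  have var: "expectation (\<lambda>\<omega>. (X \<omega>)\<^sup>2) = \<sigma>\<^sup>2"
    using normal_distributed_variance[OF \<sigma> D] mean by simp
  have "distributed M lborel (\<lambda>\<omega>. (X \<omega> - m) / \<sigma>) std_normal_density"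
    using D normal_standard_normal_convert[OF \<sigma>] by blast
  then have d: "distr M lborel (\<lambda>\<omega>. X \<omega> / \<sigma>) = density lborel std_normal_density"
    using m by (simp add: distributed_def)
  have "char std_normal_distribution \<sigma> = (CLINT x|distr M lborel (\<lambda>\<omega>. X \<omega> / \<sigma>). iexp (\<sigma> * x))"
    unfolding char_def d by (intro arg_cong2[where f = "integral\<^sup>L"]) (auto intro!: density_cong)
  also have "\<dots> = expectation (\<lambda>\<omega>. iexp (\<sigma> * (X \<omega> / \<sigma>)))"
    by (subst integral_distr) auto
  finally show ?thesis using \<sigma> by (simp add: char_std_normal_distribution var)
qed

end

text \<open>\<open>gaussian_process\<close> speaks of finite sets of times, while the moments
  involve families in which times may repeat; coefficients of equal times are added up.\<close>

lemma gaussian_process_comb: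
  assumes "gaussian_process M J X" "finite I" "\<And>i. i \<in> I \<Longrightarrow> x i \<in> J"
  shows "gaussian_rv M (\<lambda>\<omega>. \<Sum>i\<in>I. b i * X (x i) \<omega>)"
proof -
  have "(\<Sum>i\<in>I. b i * X (x i) \<omega>) = (\<Sum>t\<in>x ` I. (\<Sum>i | i \<in> I \<and> x i = t. b i) * X t \<omega>)" for \<omega>
    unfolding sum.image_gen[OF assms(2), of _ x] by (auto simp: sum_distrib_right intro!: sum.cong)
  moreover have "gaussian_rv M (\<lambda>\<omega>. \<Sum>t\<in>x ` I. (\<Sum>i | i \<in> I \<and> x i = t. b i) * X t \<omega>)"
    using assms unfolding gaussian_process_def by (elim allE impE) auto
  ultimately show ?thesis by simp
qed

text \<open>The quantity \<open>V\<close> of the overview up to a constant factor: the variance of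
  the sum of the \<open>b i * X (x i)\<close> is a fixed multiple of it.\<close>

definition kernel_norm :: "real \<Rightarrow> nat \<Rightarrow> (nat \<Rightarrow> real) \<Rightarrow> (nat \<Rightarrow> real) \<Rightarrow> real" where
  "kernel_norm H m b x = (\<integral>u. (\<Sum>i<m. b i * fbm_kernel H (x i) u)\<^sup>2 \<partial>lborel)"

text \<open>The variance is computed from the covariance and compared with
  \<open>fbm_kernel_quadratic_form\<close>: the two quadratic forms agree up to the factor
  \<open>2 * c / fbm_const H\<close>. The kernel representation thus enters as an identity of
  quadratic forms, not as a stochastic integral.\<close>

lemma scalar_fbm_char:
  assumes M: "prob_space M" and H: "0 < H" "H < 1" and X: "scalar_fbm M H c T X"
    and x: "\<And>i. i < m \<Longrightarrow> x i \<in> {0..T}"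
  shows "(\<integral>\<omega>. iexp (a * (\<Sum>i<m. b i * X (x i) \<omega>)) \<partial>M) =
    complex_of_real (exp (- (a\<^sup>2 / 2 * (2 * c / fbm_const H * kernel_norm H m b x))))"
proof -
  interpret prob_space M by (rule M)
  have gp: "gaussian_process M {0..T} X" and mean: "\<And>t. t \<in> {0..T} \<Longrightarrow> expectation (X t) = 0"
    and cov: "\<And>s t. s \<in> {0..T} \<Longrightarrow> t \<in> {0..T} \<Longrightarrow>
       expectation (\<lambda>\<omega>. X s \<omega> * X t \<omega>) = c * (t powr (2 * H) + s powr (2 * H) - \<bar>t - s\<bar> powr (2 * H))"
    using X by (auto simp: scalar_fbm_def)
  have G: "gaussian_rv M (X t)" if "t \<in> {0..T}" for t
    using gaussian_process_comb[OF gp, of "{0::nat}" "\<lambda>_. t" "\<lambda>_. 1"] that by simp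
  have int: "integrable M (X t)" if "t \<in> {0..T}" for t using gaussian_rv_integrable[OF G[OF that]] by simp
  have int2: "integrable M (\<lambda>\<omega>. X s \<omega> * X t \<omega>)" if "s \<in> {0..T}" "t \<in> {0..T}" for s t
  proof (rule Bochner_Integration.integrable_bound)
    show "integrable M (\<lambda>\<omega>. (X s \<omega>)\<^sup>2 + (X t \<omega>)\<^sup>2)"
      using gaussian_rv_integrable(2)[OF G] that by auto
    show "(\<lambda>\<omega>. X s \<omega> * X t \<omega>) \<in> borel_measurable M"
      using int[OF that(1)] int[OF that(2)] by auto
    have "\<bar>p * q\<bar> \<le> \<bar>p\<^sup>2 + q\<^sup>2\<bar>" for p q :: real
      using sum_squares_bound[of "\<bar>p\<bar>" "\<bar>q\<bar>"] abs_ge_zero[of "p * q"] unfolding abs_mult power2_abs by linarith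
    then show "AE \<omega> in M. norm (X s \<omega> * X t \<omega>) \<le> norm ((X s \<omega>)\<^sup>2 + (X t \<omega>)\<^sup>2)" by simp
  qed
  let ?Z = "\<lambda>\<omega>. \<Sum>i<m. (a * b i) * X (x i) \<omega>"
  have Z: "gaussian_rv M ?Z" using x by (intro gaussian_process_comb[OF gp]) auto
  have EZ: "expectation ?Z = 0" using x int mean by simp
  have "expectation (\<lambda>\<omega>. (?Z \<omega>)\<^sup>2) = (\<Sum>i<m. \<Sum>j<m. expectation (\<lambda>\<omega>. (a * b i) * (a * b j) * (X (x i) \<omega> * X (x j) \<omega>)))"
  proof -
    have "(?Z \<omega>)\<^sup>2 = (\<Sum>i<m. \<Sum>j<m. (a * b i) * (a * b j) * (X (x i) \<omega> * X (x j) \<omega>))" for \<omega>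
      by (simp add: power2_eq_square sum_product mult_ac)
    then have "expectation (\<lambda>\<omega>. (?Z \<omega>)\<^sup>2) = expectation (\<lambda>\<omega>. \<Sum>i<m. \<Sum>j<m. (a * b i) * (a * b j) * (X (x i) \<omega> * X (x j) \<omega>))"
      by (simp only:)
    also have "\<dots> = (\<Sum>i<m. expectation (\<lambda>\<omega>. \<Sum>j<m. (a * b i) * (a * b j) * (X (x i) \<omega> * X (x j) \<omega>)))"
      by (intro Bochner_Integration.integral_sum Bochner_Integration.integrable_sum integrable_mult_right int2 x) auto
    also have "\<dots> = (\<Sum>i<m. \<Sum>j<m. expectation (\<lambda>\<omega>. (a * b i) * (a * b j) * (X (x i) \<omega> * X (x j) \<omega>)))"
      by (intro sum.cong refl Bochner_Integration.integral_sum integrable_mult_right int2 x) auto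
    finally show ?thesis .
  qed
  also have "\<dots> = (\<Sum>i<m. \<Sum>j<m. (a * b i) * (a * b j) * (c * (x j powr (2 * H) + x i powr (2 * H) - \<bar>x j - x i\<bar> powr (2 * H))))"
    using x by (intro sum.cong refl) (simp add: cov)
  also have "\<dots> = (\<Sum>i<m. \<Sum>j<m. a\<^sup>2 * (2 * c / fbm_const H) * (b i * b j *
       (fbm_const H / 2 * (\<bar>x j\<bar> powr (2 * H) + \<bar>x i\<bar> powr (2 * H) - \<bar>x j - x i\<bar> powr (2 * H)))))"
    using x fbm_const_pos[OF H] by (intro sum.cong refl) (simp add: power2_eq_square)
  also have "\<dots> = a\<^sup>2 * (2 * c / fbm_const H) * kernel_norm H m b x"
    unfolding kernel_norm_def has_bochner_integral_integral_eq[OF fbm_kernel_quadratic_form[OF H finite_lessThan]]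
    by (simp only: sum_distrib_left)
  also have "\<dots> = a\<^sup>2 * (2 * c / fbm_const H * kernel_norm H m b x)" by (simp only: mult.assoc)
  finally have "expectation (\<lambda>\<omega>. (?Z \<omega>)\<^sup>2) = a\<^sup>2 * (2 * c / fbm_const H * kernel_norm H m b x)" .
  then show ?thesis using gaussian_rv_char[OF Z EZ] by (simp add: sum_distrib_left mult.assoc)
qed

text \<open>Independence factors the characteristic function over the components. They share one
  covariance, so the squares of the components of \<open>\<xi>\<close> add up to
  \<open>(norm \<xi>)\<^sup>2\<close>.\<close>

lemma fbm_char:
  fixes B :: "real \<Rightarrow> 'w \<Rightarrow> real^'d"
  assumes H: "0 < H" "H < 1" and B: "fractional_brownian_motion M H T B"
  shows "\<exists>c>0. \<forall>m b x \<xi>. (\<forall>i<m. x i \<in> {0..T}) \<longrightarrow>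
    (\<integral>\<omega>. iexp (\<Sum>i<m. b i * (\<xi> \<bullet> B (x i) \<omega>)) \<partial>M) =
      complex_of_real (exp (- (c * (norm \<xi>)\<^sup>2 * kernel_norm H m b x)))"
proof -
  have M: "prob_space M" using B by (simp add: fractional_brownian_motion_def)
  interpret prob_space M by (rule M)
  obtain c where c: "0 < c" and X: "\<And>j. scalar_fbm M H c T (\<lambda>t \<omega>. B t \<omega> $ j)"
    using B by (auto simp: fractional_brownian_motion_def)
  have ind: "indep_vars (\<lambda>_. \<Pi>\<^sub>M t\<in>{0..T}. borel) (\<lambda>j \<omega>. \<lambda>t\<in>{0..T}. B t \<omega> $ j) UNIV"
    using B by (simp add: fractional_brownian_motion_def)
  have "expectation (\<lambda>\<omega>. iexp (\<Sum>i<m. b i * (\<xi> \<bullet> B (x i) \<omega>))) =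
      complex_of_real (exp (- (c / fbm_const H * (norm \<xi>)\<^sup>2 * kernel_norm H m b x)))"
    if x: "\<And>i. i < m \<Longrightarrow> x i \<in> {0..T}" for m b x and \<xi> :: "real^'d"
  proof -
    let ?Y = "\<lambda>j f. iexp (\<xi> $ j * (\<Sum>i<m. b i * f (x i)))"
    let ?E = "\<lambda>j \<omega>. iexp (\<xi> $ j * (\<Sum>i<m. b i * B (x i) \<omega> $ j))"
    have Y: "?Y j \<in> borel_measurable (\<Pi>\<^sub>M t\<in>{0..T}. borel)" for j
    proof -
      have [measurable]: "(\<lambda>f. f (x i)) \<in> borel_measurable (\<Pi>\<^sub>M t\<in>{0..T}. borel :: real measure)" if "i < m" for i
        using measurable_component_singleton[OF x[OF that], of "\<lambda>_. borel :: real measure"] .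
      have "(\<lambda>f. \<Sum>i<m. b i * f (x i)) \<in> borel_measurable (\<Pi>\<^sub>M t\<in>{0..T}. borel :: real measure)"
        by (intro borel_measurable_sum borel_measurable_times) auto
      then show ?thesis by measurable
    qed
    have "indep_vars (\<lambda>_. borel) (\<lambda>j \<omega>. ?Y j (\<lambda>t\<in>{0..T}. B t \<omega> $ j)) UNIV"
      by (rule indep_vars_compose2[OF ind Y])
    moreover have eq: "?Y j (\<lambda>t\<in>{0..T}. B t \<omega> $ j) = ?E j \<omega>" for j \<omega>
      using x by (intro arg_cong[where f = exp]) simp
    ultimately have i: "indep_vars (\<lambda>_. borel) ?E UNIV" by simp
    have int: "integrable M (?E j)" for j
    proof (rule integrable_const_bound[where B = 1])
      show "?E j \<in> borel_measurable M" using i by (auto simp: indep_vars_def)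
    qed auto
    have "iexp (\<Sum>i<m. b i * (\<xi> \<bullet> B (x i) \<omega>)) = (\<Prod>j\<in>UNIV. ?E j \<omega>)" for \<omega>
    proof -
      have "(\<Sum>i<m. b i * (\<xi> \<bullet> B (x i) \<omega>)) = (\<Sum>j\<in>UNIV. \<xi> $ j * (\<Sum>i<m. b i * B (x i) \<omega> $ j))"
        by (simp add: inner_vec_def sum_distrib_left sum.swap[of _ "{..<m}"] mult_ac)
      then show ?thesis by (simp only: of_real_sum sum_distrib_left exp_sum[OF finite])
    qed
    then have "expectation (\<lambda>\<omega>. iexp (\<Sum>i<m. b i * (\<xi> \<bullet> B (x i) \<omega>))) = (\<Prod>j\<in>UNIV. expectation (?E j))"
      using indep_vars_lebesgue_integral[OF finite i int] by simp
    also have "\<dots> = (\<Prod>j\<in>UNIV. complex_of_real (exp (- ((\<xi> $ j)\<^sup>2 / 2 * (2 * c / fbm_const H * kernel_norm H m b x)))))"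
      by (intro prod.cong refl scalar_fbm_char[OF M H X x])
    also have "\<dots> = complex_of_real (exp (\<Sum>j\<in>UNIV. - ((\<xi> $ j)\<^sup>2 / 2 * (2 * c / fbm_const H * kernel_norm H m b x))))"
      by (simp only: of_real_prod[symmetric] exp_sum[OF finite])
    also have "(\<Sum>j\<in>UNIV. - ((\<xi> $ j)\<^sup>2 / 2 * (2 * c / fbm_const H * kernel_norm H m b x))) = - (c / fbm_const H * (norm \<xi>)\<^sup>2 * kernel_norm H m b x)"
    proof -
      have "(norm \<xi>)\<^sup>2 = (\<Sum>j\<in>UNIV. (\<xi> $ j)\<^sup>2)" unfolding power2_norm_eq_inner inner_vec_def by (simp add: power2_eq_square)
      then show ?thesis by (simp add: sum_negf sum_distrib_left sum_distrib_right sum_divide_distrib mult_ac)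
    qed
    finally show ?thesis .
  qed
  then show ?thesis using c fbm_const_pos[OF H] by (intro exI[of _ "c / fbm_const H"]) auto
qed

section \<open>The law on path space and joint measurability\<close>

lemma fbm_path_measurable:
  fixes B :: "real \<Rightarrow> 'w \<Rightarrow> real^'d"
  assumes B: "fractional_brownian_motion M H T B"
  shows "(\<lambda>\<omega>. \<lambda>t\<in>{0..T}. B t \<omega>) \<in> M \<rightarrow>\<^sub>M path_space T"
proof -
  obtain c where X: "\<And>j. scalar_fbm M H c T (\<lambda>t \<omega>. B t \<omega> $ j)"
    using B by (auto simp: fractional_brownian_motion_def)
  have G: "gaussian_rv M (\<lambda>\<omega>. B t \<omega> $ j)" if "t \<in> {0..T}" for t j
    using gaussian_process_comb[of M "{0..T}" "\<lambda>t \<omega>. B t \<omega> $ j" "{0::nat}" "\<lambda>_. t" "\<lambda>_. 1"] X[of j] that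
    by (simp add: scalar_fbm_def)
  have m: "B t \<in> borel_measurable M" if t: "t \<in> {0..T}" for t
  proof (subst borel_measurable_euclidean_space, intro ballI)
    fix i :: "real^'d" assume "i \<in> Basis"
    then obtain j where "i = axis j 1" by (auto simp: Basis_vec_def)
    then show "(\<lambda>\<omega>. B t \<omega> \<bullet> i) \<in> borel_measurable M"
      using G[OF t, of j] by (simp add: inner_axis gaussian_rv_def)
  qed
  have c: "continuous_on {0..T} (\<lambda>t. B t \<omega>)" if "\<omega> \<in> space M" for \<omega>
  proof -
    have "continuous_on {0..T} (\<lambda>t. \<chi> j. B t \<omega> $ j)"
      using X that by (intro continuous_on_vec_lambda) (auto simp: scalar_fbm_def)
    then show ?thesis by simp
  qed
  show ?thesis unfolding path_space_def
  proof (rule measurable_restrict_space2)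
    show "(\<lambda>\<omega>. \<lambda>t\<in>{0..T}. B t \<omega>) \<in> space M \<rightarrow> {w. continuous_on {0..T} w}"
    proof (intro funcsetI CollectI)
      show "continuous_on {0..T} (\<lambda>t\<in>{0..T}. B t \<omega>)" if "\<omega> \<in> space M" for \<omega>
        by (rule continuous_on_eq[OF c[OF that]]) simp
    qed
    show "(\<lambda>\<omega>. \<lambda>t\<in>{0..T}. B t \<omega>) \<in> M \<rightarrow>\<^sub>M (\<Pi>\<^sub>M t\<in>{0..T}. borel)"
      by (rule measurable_restrict) (rule m)
  qed
qed

lemma path_space_component:
  "t \<in> {0..T} \<Longrightarrow> (\<lambda>w. w t) \<in> borel_measurable (path_space T)"
  unfolding path_space_def by (intro measurable_restrict_space1 measurable_component_singleton)

text \<open>The form in which the Gaussian structure enters the moment estimate: all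
  finite-dimensional information is now stated for the law on path space.\<close>

lemma path_law_char:
  fixes B :: "real \<Rightarrow> 'w \<Rightarrow> real^'d"
  assumes H: "0 < H" "H < 1" and B: "fractional_brownian_motion M H T B"
  shows "\<exists>c>0. \<forall>m b x \<xi>. (\<forall>i<m. x i \<in> {0..T}) \<longrightarrow>
    (\<integral>w. iexp (\<Sum>i<m. b i * (\<xi> \<bullet> w (x i))) \<partial>path_law M T B) =
      complex_of_real (exp (- (c * (norm \<xi>)\<^sup>2 * kernel_norm H m b x)))"
proof -
  obtain c where c: "0 < c" and char: "\<And>m b x \<xi>. (\<And>i. i < m \<Longrightarrow> x i \<in> {0..T}) \<Longrightarrow>
    (\<integral>\<omega>. iexp (\<Sum>i<m. b i * (\<xi> \<bullet> B (x i) \<omega>)) \<partial>M) =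
      complex_of_real (exp (- (c * (norm \<xi>)\<^sup>2 * kernel_norm H m b x)))"
    using fbm_char[OF H B] by blast
  have "(\<integral>w. iexp (\<Sum>i<m. b i * (\<xi> \<bullet> w (x i))) \<partial>path_law M T B) =
      complex_of_real (exp (- (c * (norm \<xi>)\<^sup>2 * kernel_norm H m b x)))"
    if x: "\<And>i. i < m \<Longrightarrow> x i \<in> {0..T}" for m b x and \<xi> :: "real^'d"
  proof -
    have [measurable]: "(\<lambda>w. w (x i)) \<in> borel_measurable (path_space T)" if "i < m" for i
      using path_space_component[OF x[OF that]] .
    have "(\<lambda>w. \<Sum>i<m. b i * (\<xi> \<bullet> w (x i))) \<in> borel_measurable (path_space T)"
      by (intro borel_measurable_sum borel_measurable_times borel_measurable_inner) auto
    then have m: "(\<lambda>w. iexp (\<Sum>i<m. b i * (\<xi> \<bullet> w (x i)))) \<in> borel_measurable (path_space T)"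
      by measurable
    have eq: "(\<Sum>i<m. b i * (\<xi> \<bullet> (\<lambda>t\<in>{0..T}. B t \<omega>) (x i))) = (\<Sum>i<m. b i * (\<xi> \<bullet> B (x i) \<omega>))" for \<omega>
      using x by simp
    show ?thesis unfolding path_law_def integral_distr[OF fbm_path_measurable[OF B] m] eq
      using char x by blast
  qed
  then show ?thesis using c by blast
qed

text \<open>The sigma-algebra only knows evaluations at fixed times. Freezing the time at the grid
  point below it, with mesh 1 / (n + 1), gives jointly measurable functions, each built from
  countably many evaluations, and continuity of the paths gives the limit.\<close>

lemma path_clamped_measurable:
  assumes T: "0 \<le> T"
  shows "(\<lambda>(r, w). w (max 0 (min T r)) :: real^'d) \<in> borel_measurable (lborel \<Otimes>\<^sub>M path_space T)"
proof -
  let ?c = "\<lambda>r. max 0 (min T r)"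
  define f where "f n i p = (snd p (?c (of_int i / real (Suc n))) :: real^'d)" for n :: nat and i :: int and p :: "real \<times> (real \<Rightarrow> real^'d)"
  have f: "f n i \<in> borel_measurable (lborel \<Otimes>\<^sub>M path_space T)" for n i
    unfolding f_def by (rule measurable_compose[OF measurable_snd path_space_component]) (use T in auto)
  have fl: "(\<lambda>p. f n \<lfloor>fst p * real (Suc n)\<rfloor> p) \<in> borel_measurable (lborel \<Otimes>\<^sub>M path_space T)" for n
  proof (rule measurable_compose_countable[OF f])
    show "(\<lambda>p. \<lfloor>fst p * real (Suc n)\<rfloor>) \<in> (lborel \<Otimes>\<^sub>M path_space T) \<rightarrow>\<^sub>M count_space UNIV"
      by (rule measurable_compose[OF _ measurable_real_floor]) simp
  qed
  show ?thesis unfolding case_prod_unfold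
  proof (rule borel_measurable_LIMSEQ_metric[OF fl])
    fix p :: "real \<times> (real \<Rightarrow> real^'d)" assume "p \<in> space (lborel \<Otimes>\<^sub>M path_space T)"
    then have w: "continuous_on {0..T} (snd p)"
      by (auto simp: space_pair_measure path_space_def space_restrict_space)
    have "(\<lambda>n. of_int \<lfloor>fst p * real (Suc n)\<rfloor> / real (Suc n)) \<longlonglongrightarrow> fst p"
    proof (rule tendsto_sandwich)
      show "\<forall>\<^sub>F n in sequentially. fst p - 1 / real (Suc n) \<le> of_int \<lfloor>fst p * real (Suc n)\<rfloor> / real (Suc n)"
      proof (intro always_eventually allI)
        show "fst p - 1 / real (Suc n) \<le> of_int \<lfloor>fst p * real (Suc n)\<rfloor> / real (Suc n)" for n
        proof -
          have "fst p - 1 / real (Suc n) = (fst p * real (Suc n) - 1) / real (Suc n)"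
            by (simp add: diff_divide_distrib del: of_nat_Suc)
          also have "\<dots> \<le> of_int \<lfloor>fst p * real (Suc n)\<rfloor> / real (Suc n)"
            using real_of_int_floor_gt_diff_one[of "fst p * real (Suc n)"] by (intro divide_right_mono) auto
          finally show ?thesis .
        qed
      qed
      show "\<forall>\<^sub>F n in sequentially. of_int \<lfloor>fst p * real (Suc n)\<rfloor> / real (Suc n) \<le> fst p"
        by (intro always_eventually allI) (simp add: pos_divide_le_eq del: of_nat_Suc)
      have "(\<lambda>n. fst p - 1 / real (Suc n)) \<longlonglongrightarrow> fst p - 0"
        by (intro tendsto_diff tendsto_const lim_1_over_n[THEN LIMSEQ_Suc])
      then show "(\<lambda>n. fst p - 1 / real (Suc n)) \<longlonglongrightarrow> fst p" by simp
    qed simp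
    then have "(\<lambda>n. ?c (of_int \<lfloor>fst p * real (Suc n)\<rfloor> / real (Suc n))) \<longlonglongrightarrow> ?c (fst p)"
      by (intro tendsto_max tendsto_min tendsto_const)
    then show "(\<lambda>n. f n \<lfloor>fst p * real (Suc n)\<rfloor> p) \<longlonglongrightarrow> snd p (?c (fst p))"
      unfolding f_def by (rule continuous_on_tendsto_compose[OF w]) (use T in auto)
  qed
qed

lemma phase_measurable:
  assumes "0 \<le> s" "t \<le> T"
  shows "(\<lambda>(r, w). indicator {s<..t} r *\<^sub>R iexp (b * (\<xi> \<bullet> (w r :: real^'d)))) \<in> borel_measurable (lborel \<Otimes>\<^sub>M path_space T)"
proof (cases "0 \<le> T")
  case True
  note [measurable] = path_clamped_measurable[OF True]
  have "indicator {s<..t} r *\<^sub>R iexp (b * (\<xi> \<bullet> w r)) =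
     indicator {s<..t} r *\<^sub>R iexp (b * (\<xi> \<bullet> (w (max 0 (min T r)))))" for r and w :: "real \<Rightarrow> real^'d"
  proof (cases "r \<in> {s<..t}")
    case True
    then have "max 0 (min T r) = r" using assms by auto
    then show ?thesis by (simp only:)
  qed simp
  then show ?thesis by (simp only:) measurable
next
  case False
  then have "{s<..t} = {}" using assms by auto
  then show ?thesis by simp
qed

lemma osc_diff:
  fixes w :: "real \<Rightarrow> real^'d"
  assumes w: "continuous_on {0..T} w" and "0 \<le> s" "s \<le> t" "t \<le> T"
  shows "osc w t \<xi> - osc w s \<xi> = (\<integral>r. indicator {s<..t} r *\<^sub>R iexp (\<xi> \<bullet> w r) \<partial>lborel)"
    and "integrable lborel (\<lambda>r. indicator {s<..t} r *\<^sub>R iexp (\<xi> \<bullet> w r))"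
proof -
  let ?f = "\<lambda>r. iexp (\<xi> \<bullet> w r)"
  have "continuous_on {0..t} ?f"
    using assms by (intro continuous_intros continuous_on_subset[OF w]) auto
  then have i: "set_integrable lborel {0..t} ?f" by (rule borel_integrable_atLeastAtMost')
  have i2: "set_integrable lborel {s<..t} ?f" "set_integrable lborel {0..s} ?f"
    by (rule set_integrable_subset[OF i]; use assms in auto)+
  have "{0..t} = {0..s} \<union> {s<..t}" using assms by auto
  then have "osc w t \<xi> = osc w s \<xi> + (LINT r:{s<..t}|lborel. ?f r)"
    unfolding osc_def by (simp only:) (rule set_integral_Un; use i2 in auto)
  then show "osc w t \<xi> - osc w s \<xi> = (\<integral>r. indicator {s<..t} r *\<^sub>R ?f r \<partial>lborel)"
    by (simp add: set_lebesgue_integral_def)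
  show "integrable lborel (\<lambda>r. indicator {s<..t} r *\<^sub>R ?f r)"
    using i2 by (simp add: set_integrable_def)
qed

section \<open>Integrals over pairs of times\<close>

interpretation lborel_product: product_sigma_finite "\<lambda>_::nat. lborel :: real measure" ..

text \<open>As \<open>p\<close> is injective the pairs occupy disjoint coordinates, so the integral
  factors. Taking the image of \<open>p\<close> as index set lets the induction peel off the last
  pair.\<close>

lemma nn_integral_pairs:
  fixes F :: "real \<Rightarrow> real \<Rightarrow> ennreal" and p :: "nat \<Rightarrow> nat"
  assumes F[measurable]: "case_prod F \<in> borel_measurable (lborel \<Otimes>\<^sub>M lborel)" and p: "inj_on p {..<2*n}"
  shows "(\<integral>\<^sup>+x. (\<Prod>k<n. F (x (p (Suc (2*k)))) (x (p (2*k)))) \<partial>(\<Pi>\<^sub>M i\<in>p ` {..<2*n}. lborel)) =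
    (\<integral>\<^sup>+a. \<integral>\<^sup>+b. F a b \<partial>lborel \<partial>lborel) ^ n"
  using p
proof (induction n)
  case 0
  then show ?case by (simp add: PiM_empty nn_integral_count_space_finite)
next
  case (Suc n)
  let ?I = "p ` {..<2*n}"
  let ?a = "p (Suc (2*n))" and ?b = "p (2*n)"
  have I: "p ` {..<2 * Suc n} = insert ?a (insert ?b ?I)" by (auto simp: lessThan_Suc)
  have inj: "inj_on p {..<2*n}" using Suc.prems by (rule inj_on_subset) auto
  have ni: "?b \<notin> ?I" "?a \<notin> insert ?b ?I"
    using Suc.prems by (auto simp: inj_on_def) force+
  have [measurable]: "(\<lambda>x. x i) \<in> borel_measurable (\<Pi>\<^sub>M i\<in>J. lborel :: real measure)" if "i \<in> J" for i :: nat and J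
    using measurable_component_singleton[OF that, of "\<lambda>_. lborel :: real measure"] by simp
  have m: "(\<lambda>x. \<Prod>k<m. F (x (p (Suc (2*k)))) (x (p (2*k)))) \<in> borel_measurable (\<Pi>\<^sub>M i\<in>J. lborel)" if "p ` {..<2*m} \<subseteq> J" for J m
  proof (intro borel_measurable_prod_ennreal)
    fix k assume "k \<in> {..<m}"
    then have "p (Suc (2*k)) \<in> J" "p (2*k) \<in> J" using that by auto
    then show "(\<lambda>x. F (x (p (Suc (2*k)))) (x (p (2*k)))) \<in> borel_measurable (\<Pi>\<^sub>M i\<in>J. lborel)" by measurable
  qed
  let ?G = "\<lambda>x. \<Prod>k<n. F (x (p (Suc (2*k)))) (x (p (2*k)))"
  have G: "?G (x(?b := u, ?a := v)) = ?G x" for x u v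
  proof (intro prod.cong refl)
    fix k assume "k \<in> {..<n}"
    then have "p (Suc (2*k)) \<in> ?I" "p (2*k) \<in> ?I" by auto
    then have "p (Suc (2*k)) \<noteq> ?a" "p (Suc (2*k)) \<noteq> ?b" "p (2*k) \<noteq> ?a" "p (2*k) \<noteq> ?b" using ni by auto
    then show "F ((x(?b := u, ?a := v)) (p (Suc (2*k)))) ((x(?b := u, ?a := v)) (p (2*k))) = F (x (p (Suc (2*k)))) (x (p (2*k)))" by simp
  qed
  let ?P = "\<lambda>x. \<Prod>k<Suc n. F (x (p (Suc (2*k)))) (x (p (2*k)))"
  have ab: "?a \<noteq> ?b" using ni by auto
  have meas1: "(\<lambda>x. ?P x) \<in> borel_measurable (\<Pi>\<^sub>M i\<in>insert ?a (insert ?b ?I). lborel)"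
    by (rule m) (auto simp: lessThan_Suc)
  have "(\<integral>\<^sup>+x. ?P x \<partial>(\<Pi>\<^sub>M i\<in>p ` {..<2 * Suc n}. lborel)) =
     (\<integral>\<^sup>+v. \<integral>\<^sup>+x. ?P (x(?a := v)) \<partial>(\<Pi>\<^sub>M i\<in>insert ?b ?I. lborel) \<partial>lborel)"
    unfolding I by (rule lborel_product.product_nn_integral_insert_rev[OF _ ni(2) meas1]) simp
  also have "\<dots> = (\<integral>\<^sup>+v. \<integral>\<^sup>+u. \<integral>\<^sup>+x. ?P (x(?b := u, ?a := v)) \<partial>(\<Pi>\<^sub>M i\<in>?I. lborel) \<partial>lborel \<partial>lborel)"
  proof (intro nn_integral_cong lborel_product.product_nn_integral_insert_rev[OF _ ni(1)])
    fix v :: real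
    have "(\<lambda>x. x(?a := v)) \<in> (\<Pi>\<^sub>M i\<in>insert ?b ?I. lborel) \<rightarrow>\<^sub>M (\<Pi>\<^sub>M i\<in>insert ?a (insert ?b ?I). lborel)"
      by (intro measurable_fun_upd[where J = "insert ?b ?I"]) auto
    from measurable_compose[OF this meas1]
    show "(\<lambda>x. ?P (x(?a := v))) \<in> borel_measurable (\<Pi>\<^sub>M i\<in>insert ?b ?I. lborel)" .
  qed simp
  also have "\<dots> = (\<integral>\<^sup>+v. \<integral>\<^sup>+u. \<integral>\<^sup>+x. ?G x * F v u \<partial>(\<Pi>\<^sub>M i\<in>?I. lborel) \<partial>lborel \<partial>lborel)"
    using G ab by (simp add: prod.lessThan_Suc)
  also have "\<dots> = (\<integral>\<^sup>+v. \<integral>\<^sup>+u. (\<integral>\<^sup>+x. ?G x \<partial>(\<Pi>\<^sub>M i\<in>?I. lborel)) * F v u \<partial>lborel \<partial>lborel)"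
    by (intro nn_integral_cong nn_integral_multc m) simp
  also have "\<dots> = (\<integral>\<^sup>+x. ?G x \<partial>(\<Pi>\<^sub>M i\<in>?I. lborel)) * (\<integral>\<^sup>+v. \<integral>\<^sup>+u. F v u \<partial>lborel \<partial>lborel)"
    by (simp add: nn_integral_cmult)
  finally show ?case using Suc.IH[OF inj] by (simp add: mult.commute)
qed

text \<open>From u \<le> exp u at u = z / \<beta>, raised to the power \<beta>. It trades
  exponential decay for polynomial decay of a chosen order.\<close>

lemma powr_le_exp:
  fixes z \<beta> :: real assumes "0 < z" "0 < \<beta>" shows "exp (- z) \<le> \<beta> powr \<beta> * z powr - \<beta>"
proof -
  have "(z / \<beta>) powr \<beta> \<le> exp (z / \<beta>) powr \<beta>"
    using exp_ge_add_one_self[of "z / \<beta>"] assms by (intro powr_mono2) (auto intro: order_trans[of _ "1 + z / \<beta>"])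
  also have "\<dots> = exp z" using assms by (simp add: powr_def)
  finally have "z powr \<beta> / \<beta> powr \<beta> \<le> exp z" using assms by (simp add: powr_divide)
  then show ?thesis using assms by (simp add: exp_minus powr_minus field_simps)
qed

text \<open>The singularity at b = a is integrable because \<theta> < 1. Each side of
  \<open>a\<close> contributes at most the integral of x^(-\<theta>) over an interval of length t -
  s, hence the factor 2.\<close>

lemma nn_integral_abs_powr_le:
  fixes a s t \<theta> :: real
  assumes "\<theta> < 1" "a \<in> {s..t}"
  shows "(\<integral>\<^sup>+b. ennreal (indicator {s..t} b * \<bar>a - b\<bar> powr - \<theta>) \<partial>lborel) \<le> ennreal (2 / (1 - \<theta>) * (t - s) powr (1 - \<theta>))"
proof -
  let ?h = "\<lambda>x. ennreal (indicator {0..t - s} x * x powr - \<theta>)"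
  have st: "0 \<le> t - s" using assms by auto
  have h: "(\<integral>\<^sup>+x. ?h x \<partial>lborel) = ennreal ((t - s) powr (1 - \<theta>) / (1 - \<theta>))"
  proof -
    have hb: "has_bochner_integral lborel (\<lambda>x. indicator {0..t - s} x * x powr - \<theta>) ((t - s) powr (- \<theta> + 1) / (- \<theta> + 1))"
      by (rule has_bochner_integral_powr_from_0) (use assms st in auto)
    then have "(\<integral>\<^sup>+x. ?h x \<partial>lborel) = ennreal (\<integral>x. indicator {0..t - s} x * x powr - \<theta> \<partial>lborel)"
      by (intro nn_integral_eq_integral) (auto simp: has_bochner_integral_iff)
    then show ?thesis using hb by (simp add: has_bochner_integral_iff add.commute)
  qed
  have "(\<integral>\<^sup>+b. ennreal (indicator {s..t} b * \<bar>a - b\<bar> powr - \<theta>) \<partial>lborel) \<le> (\<integral>\<^sup>+b. ?h (a + (- 1) * b) + ?h ((- a) + 1 * b) \<partial>lborel)"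
  proof (rule nn_integral_mono)
    fix b
    show "ennreal (indicator {s..t} b * \<bar>a - b\<bar> powr - \<theta>) \<le> ?h (a + (- 1) * b) + ?h ((- a) + 1 * b)"
    proof (cases "b \<in> {s..t}")
      case True
      have "indicator {s..t} b * \<bar>a - b\<bar> powr - \<theta> \<le> indicator {0..t - s} (a + (- 1) * b) * (a + (- 1) * b) powr - \<theta> + indicator {0..t - s} ((- a) + 1 * b) * ((- a) + 1 * b) powr - \<theta>"
        using True assms(2) by (cases "b \<le> a") auto
      then show ?thesis by (simp add: ennreal_plus[symmetric] del: ennreal_plus)
    qed simp
  qed
  also have "\<dots> = (\<integral>\<^sup>+b. ?h (a + (- 1) * b) \<partial>lborel) + (\<integral>\<^sup>+b. ?h ((- a) + 1 * b) \<partial>lborel)"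
    by (rule nn_integral_add) auto
  also have "\<dots> = (\<integral>\<^sup>+x. ?h x \<partial>lborel) + (\<integral>\<^sup>+x. ?h x \<partial>lborel)"
    using nn_integral_real_affine[of ?h "- 1" a] nn_integral_real_affine[of ?h 1 "- a"] by simp
  also have "\<dots> = ennreal (2 / (1 - \<theta>) * (t - s) powr (1 - \<theta>))"
    unfolding h using assms by (simp add: ennreal_plus[symmetric] del: ennreal_plus)
  finally show ?thesis .
qed

text \<open>\<open>powr_le_exp\<close> with \<beta> = \<theta> / (2H) turns the exponential into
  \<kappa>^(-\<beta>) |a - b|^(-\<theta>), so that the frequency, hidden in \<kappa>, separates from
  the times. The inner integral then gives (t - s)^(1 - \<theta>) and the outer one another factor t
  - s.\<close>

lemma exp_pair_integral_le:
  fixes s t \<theta> H \<kappa> :: real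
  assumes "0 < \<theta>" "\<theta> < 1" "0 < H" "s \<le> t" "0 < \<kappa>"
  shows "(\<integral>\<^sup>+a. \<integral>\<^sup>+b. ennreal (indicator {s..t} a * indicator {s..t} b * exp (- (\<kappa> * \<bar>a - b\<bar> powr (2 * H)))) \<partial>lborel \<partial>lborel)
    \<le> ennreal ((\<theta> / (2 * H)) powr (\<theta> / (2 * H)) * (2 / (1 - \<theta>)) * \<kappa> powr - (\<theta> / (2 * H)) * (t - s) powr (2 - \<theta>))"
proof -
  let ?E = "\<lambda>a b. ennreal (indicator {s..t} a * indicator {s..t} b * exp (- (\<kappa> * \<bar>a - b\<bar> powr (2 * H))))"
  let ?D = "\<lambda>a b. ennreal (indicator {s..t} b * \<bar>a - b\<bar> powr - \<theta>)"
  define \<beta> where "\<beta> = \<theta> / (2 * H)"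
  define K where "K = \<beta> powr \<beta> * \<kappa> powr - \<beta>"
  have \<beta>: "0 < \<beta>" "2 * H * \<beta> = \<theta>" using assms by (auto simp: \<beta>_def)
  have le: "(\<integral>\<^sup>+b. ?E a b \<partial>lborel)
     \<le> ennreal (indicator {s..t} a * (K * (2 / (1 - \<theta>) * (t - s) powr (1 - \<theta>))))" for a
  proof (cases "a \<in> {s..t}")
    case True
    have "(\<integral>\<^sup>+b. ?E a b \<partial>lborel)
      \<le> (\<integral>\<^sup>+b. ennreal K * ?D a b \<partial>lborel)"
    proof (rule nn_integral_mono_AE)
      \<comment> \<open>On the diagonal \<open>0 powr - \<theta> = 0\<close> and the bound fails;
        the diagonal is a null set.\<close>
      have "AE b in lborel. b \<noteq> a" by (rule AE_lborel_singleton)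
      then show "AE b in lborel. ?E a b
        \<le> ennreal K * ?D a b"
      proof eventually_elim
        case (elim b)
        then have pos: "0 < \<bar>a - b\<bar>" by simp
        then have "exp (- (\<kappa> * \<bar>a - b\<bar> powr (2 * H))) \<le> \<beta> powr \<beta> * (\<kappa> * \<bar>a - b\<bar> powr (2 * H)) powr - \<beta>"
          using assms \<beta> by (intro powr_le_exp) auto
        also have "\<dots> = K * \<bar>a - b\<bar> powr - \<theta>"
          using assms pos \<beta>(2) by (simp add: K_def powr_mult powr_powr mult_ac)
        finally have "exp (- (\<kappa> * \<bar>a - b\<bar> powr (2 * H))) \<le> K * \<bar>a - b\<bar> powr - \<theta>" .
        then show ?case using True by (cases "b \<in> {s..t}") (auto simp: ennreal_mult''[symmetric] intro!: ennreal_leI)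
      qed
    qed
    also have "\<dots> = ennreal K * (\<integral>\<^sup>+b. ?D a b \<partial>lborel)"
      by (rule nn_integral_cmult) measurable
    also have "\<dots> \<le> ennreal K * ennreal (2 / (1 - \<theta>) * (t - s) powr (1 - \<theta>))"
      by (intro mult_left_mono nn_integral_abs_powr_le assms True) simp
    also have "\<dots> = ennreal (K * (2 / (1 - \<theta>) * (t - s) powr (1 - \<theta>)))"
      using assms by (intro ennreal_mult[symmetric]) (auto simp: K_def)
    finally show ?thesis using True by simp
  qed simp
  have "(\<integral>\<^sup>+a. \<integral>\<^sup>+b. ?E a b \<partial>lborel \<partial>lborel)
    \<le> (\<integral>\<^sup>+a. ennreal (K * (2 / (1 - \<theta>) * (t - s) powr (1 - \<theta>))) * indicator {s..t} a \<partial>lborel)"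
    by (intro nn_integral_mono order_trans[OF le]) (simp add: indicator_def)
  also have "\<dots> = ennreal (K * (2 / (1 - \<theta>) * (t - s) powr (1 - \<theta>))) * ennreal (t - s)"
    using assms by (simp add: nn_integral_cmult)
  also have "\<dots> = ennreal (K * (2 / (1 - \<theta>)) * ((t - s) powr (1 - \<theta>) * (t - s)))"
    using assms by (subst ennreal_mult[symmetric]) (auto simp: K_def mult_ac)
  also have "(t - s) powr (1 - \<theta>) * (t - s) = (t - s) powr (2 - \<theta>)"
    using assms powr_add[of "t - s" "1 - \<theta>" 1] by simp
  finally show ?thesis by (simp add: K_def \<beta>_def mult_ac)
qed

lemma prod_alternating:
  fixes a b :: "'a::comm_monoid_mult"
  shows "(\<Prod>i<2*n. if even i then a else b) = (a * b) ^ n"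
  by (induction n) (simp_all add: prod.lessThan_Suc mult_ac)

lemma prob_space_path_law:
  assumes "fractional_brownian_motion M H T B" shows "prob_space (path_law M T B)"
  unfolding path_law_def using assms
  by (intro prob_space.prob_space_distr fbm_path_measurable) (auto simp: fractional_brownian_motion_def)

lemma sets_path_law: "sets (path_law M T B) = sets (path_space T)"
  by (simp add: path_law_def)

lemma path_law_continuous: "w \<in> space (path_law M T B) \<Longrightarrow> continuous_on {0..T} w"
  by (auto simp: path_law_def path_space_def space_restrict_space)

text \<open>Uses (1 + x)^2 / 2 \<le> 1 + x^2. Since the gaps \<open>g\<close> stay bounded, decay in
  |\<xi>| is replaced by decay in 1 + |\<xi>| at the price of a constant, which removes the
  degeneracy at \<xi> = 0.\<close>

lemma exp_frequency_shift:
  fixes c g G x :: real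
  assumes "0 \<le> c" "0 \<le> g" "g \<le> G" "0 \<le> x"
  shows "exp (- (c * x\<^sup>2 * g)) \<le> exp (c * G) * exp (- (c / 2 * (1 + x)\<^sup>2 * g))"
proof -
  have "(1 + x)\<^sup>2 / 2 \<le> 1 + x\<^sup>2" using zero_le_power2[of "1 - x"] by (simp add: power2_eq_square algebra_simps)
  then have "(c * g) * ((1 + x)\<^sup>2 / 2) \<le> (c * g) * (1 + x\<^sup>2)" using assms by (intro mult_left_mono) auto
  moreover have "c * g \<le> c * G" using assms by (intro mult_left_mono) auto
  ultimately show ?thesis unfolding exp_add[symmetric] by (simp add: algebra_simps)
qed

text \<open>The power 2n is a product of n increments and n complex conjugates, which makes the
  moment a 2n-fold time integral of characteristic functions. The constant may grow with
  \<open>n\<close>, which is harmless because \<open>n\<close> is fixed once the exponents are; what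
  matters is that it does not depend on \<open>\<xi>\<close>, \<open>s\<close> and
  \<open>t\<close>.\<close>

lemma osc_moment:
  fixes B :: "real \<Rightarrow> 'w \<Rightarrow> real^'d"
  assumes H: "0 < H" "H < 1" and B: "fractional_brownian_motion M H T B" and \<theta>: "0 < \<theta>" "\<theta> < 1"
  shows "\<exists>C\<ge>0. \<forall>\<xi> s t. 0 \<le> s \<longrightarrow> s \<le> t \<longrightarrow> t \<le> T \<longrightarrow>
    (\<integral>\<^sup>+w. ennreal (cmod (osc w t \<xi> - osc w s \<xi>) ^ (2*n)) \<partial>path_law M T B)
      \<le> ennreal (C * ((t - s) powr (2 - \<theta>)) ^ n * ((1 + norm \<xi>) powr - (\<theta> / H)) ^ n)"
proof -
  let ?N = "path_law M T B"
  obtain c where c: "0 < c" and char: "\<And>m b x \<xi>. (\<And>i. i < m \<Longrightarrow> x i \<in> {0..T}) \<Longrightarrow>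
    (\<integral>w. iexp (\<Sum>i<m. b i * (\<xi> \<bullet> w (x i))) \<partial>?N) =
      complex_of_real (exp (- (c * (norm \<xi>)\<^sup>2 * kernel_norm H m b x)))"
    using path_law_char[OF H B] by blast
  obtain \<delta> where \<delta>: "0 < \<delta>" and nd: "\<And>e x. (\<And>k. k < 2*n \<Longrightarrow> e k = 1 \<or> e k = -1) \<Longrightarrow> (\<And>k. k < 2*n \<Longrightarrow> 0 \<le> x k) \<Longrightarrow>
    \<exists>p. p permutes {..<2*n} \<and> \<delta> * (\<Sum>k<n. \<bar>x (p (Suc (2*k))) - x (p (2*k))\<bar> powr (2 * H)) \<le> kernel_norm H (2*n) e x"
    using fbm_kernel_signs[OF H, of n] unfolding kernel_norm_def by blast
  define c0 where "c0 = c * \<delta>"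
  have c0: "0 < c0" using c \<delta> by (simp add: c0_def)
  define \<beta> where "\<beta> = \<theta> / (2 * H)"
  define E0 where "E0 = exp (c0 * T powr (2 * H))"
  define A where "A = \<beta> powr \<beta> * (2 / (1 - \<theta>)) * (c0 / 2) powr - \<beta>"
  define S where "S = {p. p permutes {..<2*n}}"
  have A0: "0 \<le> A" using \<theta> by (simp add: A_def)
  have S: "finite S" unfolding S_def by (rule finite_permutations) simp
  \<comment> \<open>Even indices will carry the increment and odd ones its conjugate, n of each, so
    the product of all factors is the 2n-th power of the modulus.\<close>
  define e where "e i = (if even i then 1 else - 1 :: real)" for i :: nat
  interpret N: prob_space "?N" by (rule prob_space_path_law[OF B])
  define P where "P = (\<Pi>\<^sub>M i\<in>{..<2*n}. (lborel :: real measure))"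
  interpret P: sigma_finite_measure P unfolding P_def by (rule lborel_product.sigma_finite) simp
  interpret PN: pair_sigma_finite P "?N" ..
  have Pc: "(\<lambda>x. x i) \<in> P \<rightarrow>\<^sub>M lborel" if "i < 2*n" for i
    unfolding P_def by (rule measurable_component_singleton) (use that in simp)
  have "(\<integral>\<^sup>+w. ennreal (cmod (osc w t \<xi> - osc w s \<xi>) ^ (2*n)) \<partial>?N)
      \<le> ennreal ((real (card S) * (E0 * A) ^ n) * ((t - s) powr (2 - \<theta>)) ^ n * ((1 + norm \<xi>) powr - (\<theta> / H)) ^ n)"
    if st: "0 \<le> s" "s \<le> t" "t \<le> T" for \<xi> :: "real^'d" and s t
  proof -
    define D where "D w = osc w t \<xi> - osc w s \<xi>" for w :: "real \<Rightarrow> real^'d"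
    define f where "f i r w = indicator {s<..t} r *\<^sub>R iexp (e i * (\<xi> \<bullet> w r))" for i r and w :: "real \<Rightarrow> real^'d"
    define G where "G x w = (\<Prod>i<2*n. f i (x i) w)" for x w
    define I where "I x = (\<Prod>i<2*n. indicator {s<..t} (x i) :: real)" for x :: "nat \<Rightarrow> real"
    define \<kappa> where "\<kappa> = c0 / 2 * (1 + norm \<xi>)\<^sup>2"
    have \<kappa>: "0 < \<kappa>" unfolding \<kappa>_def using c0 by (intro mult_pos_pos zero_less_power add_pos_nonneg) auto
    define F where "F a b = ennreal E0 * ennreal (indicator {s..t} a * indicator {s..t} b * exp (- (\<kappa> * \<bar>a - b\<bar> powr (2 * H))))" for a b :: real
    let ?Q = "\<lambda>p x. \<Prod>k<n. F (x (p (Suc (2*k)))) (x (p (2*k)))"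
    let ?J = "\<integral>\<^sup>+a. \<integral>\<^sup>+b. F a b \<partial>lborel \<partial>lborel"
    let ?V = "\<lambda>x. exp (- (c * (norm \<xi>)\<^sup>2 * kernel_norm H (2*n) e x))"
    have I0: "0 \<le> I x" for x by (simp add: I_def prod_nonneg)
    have fi: "integrable lborel (\<lambda>r. f i r w)" "integral\<^sup>L lborel (\<lambda>r. f i r w) = (if even i then D w else cnj (D w))"
      if "w \<in> space ?N" for i w
    proof -
      note o = osc_diff[OF path_law_continuous[OF that] st, of \<xi>]
      have ev: "f i r w = indicator {s<..t} r *\<^sub>R iexp (\<xi> \<bullet> w r)" if "even i" for r
        using that by (simp add: f_def e_def)
      have od: "f i r w = cnj (indicator {s<..t} r *\<^sub>R iexp (\<xi> \<bullet> w r))" if "odd i" for r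
        using that by (simp add: f_def e_def exp_cnj)
      have "integrable lborel (\<lambda>r. f i r w) \<and> integral\<^sup>L lborel (\<lambda>r. f i r w) = (if even i then D w else cnj (D w))"
      proof (cases "even i")
        case True
        show ?thesis using True o unfolding D_def ev[OF True] by simp
      next
        case False
        have "integrable lborel (\<lambda>r. cnj (indicator {s<..t} r *\<^sub>R iexp (\<xi> \<bullet> w r)))"
          using o(2) by (subst complex_integrable_cnj)
        then show ?thesis using False unfolding D_def od[OF False] o(1) by (simp only: Bochner_Integration.integral_cnj if_False simp_thms)
      qed
      then show "integrable lborel (\<lambda>r. f i r w)" "integral\<^sup>L lborel (\<lambda>r. f i r w) = (if even i then D w else cnj (D w))"
        by blast+
    qed
    have stepA: "complex_of_real (cmod (D w) ^ (2*n)) = (\<integral>x. G x w \<partial>P)" if w: "w \<in> space ?N" for w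
    proof -
      have "(\<integral>x. G x w \<partial>P) = (\<Prod>i<2*n. if even i then D w else cnj (D w))"
        unfolding G_def P_def using fi[OF w] by (subst lborel_product.product_integral_prod) simp_all
      also have "\<dots> = (D w * cnj (D w)) ^ n" by (rule prod_alternating)
      finally show ?thesis by (simp add: complex_norm_square[symmetric] power_mult)
    qed
    have Gm: "case_prod G \<in> borel_measurable (P \<Otimes>\<^sub>M ?N)"
      unfolding G_def case_prod_unfold
    proof (rule borel_measurable_prod)
      fix i assume "i \<in> {..<2*n}"
      then have i: "i < 2*n" by simp
      have fm: "(\<lambda>(r, w). f i r w) \<in> borel_measurable (lborel \<Otimes>\<^sub>M ?N)"
        using phase_measurable[OF st(1,3), of "e i" \<xi>] unfolding f_def
        by (subst measurable_cong_sets[OF sets_pair_measure_cong[OF refl sets_path_law] refl])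
      have "(\<lambda>p. (fst p i, snd p)) \<in> (P \<Otimes>\<^sub>M ?N) \<rightarrow>\<^sub>M (lborel \<Otimes>\<^sub>M ?N)"
        by (rule measurable_Pair[OF measurable_compose[OF measurable_fst Pc[OF i]] measurable_snd])
      from measurable_compose[OF this fm]
      show "(\<lambda>p. f i (fst p i) (snd p)) \<in> borel_measurable (P \<Otimes>\<^sub>M ?N)" by simp
    qed
    have Gn: "norm (G x w) = I x" for x w
      unfolding G_def I_def prod_norm[symmetric] by (intro prod.cong refl) (simp add: f_def)
    have Gi: "integrable (?N) (\<lambda>w. G x w)" if "x \<in> space P" for x
    proof (rule N.integrable_const_bound[where B = "I x"])
      show "(\<lambda>w. G x w) \<in> borel_measurable ?N"
        using measurable_Pair2[OF Gm that] by simp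
    qed (simp add: Gn)
    have Ii: "integrable P I"
      unfolding I_def P_def
    proof (rule lborel_product.product_integrable_prod)
      show "integrable lborel (indicator {s<..t} :: real \<Rightarrow> real)"
        by (rule integrable_real_indicator) (use st in auto)
    qed simp
    have int: "integrable (P \<Otimes>\<^sub>M ?N) (case_prod G)"
    proof (rule PN.Fubini_integrable[OF Gm])
      show "integrable P (\<lambda>x. \<integral>w. norm (case (x, w) of (x, w) \<Rightarrow> G x w) \<partial>?N)"
        using Ii by (simp add: Gn N.prob_space)
      show "AE x in P. integrable (?N) (\<lambda>w. case (x, w) of (x, w) \<Rightarrow> G x w)"
        using Gi by (intro AE_I2) simp
    qed
    have stepC: "norm (\<integral>w. G x w \<partial>?N) \<le> I x * ?V x" for x
    proof (cases "\<forall>i<2*n. x i \<in> {s<..t}")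
      case True
      then have x: "\<And>i. i < 2*n \<Longrightarrow> x i \<in> {0..T}" using st by auto
      have "G x w = iexp (\<Sum>i<2*n. e i * (\<xi> \<bullet> w (x i)))" for w
        using True by (simp add: G_def f_def exp_sum[symmetric] sum_distrib_left)
      moreover have "I x = 1" using True by (simp add: I_def)
      ultimately show ?thesis using char[where m = "2*n" and b = e and x = x and \<xi> = \<xi>, OF x] by simp
    next
      case False
      then obtain i where "i < 2*n" "x i \<notin> {s<..t}" by blast
      then have "I x = 0" by (auto simp: I_def intro!: prod_zero bexI[of _ i])
      then have "G x w = 0" for w using Gn[of x w] by simp
      then show ?thesis using \<open>I x = 0\<close> by simp
    qed
    \<comment> \<open>The good permutation depends on x. Summing over all permutations bounds the
      integrand by products over pairs, each for a fixed permutation, at the price of the factor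
      \<open>card S\<close>.\<close>
    have stepD: "ennreal (I x * ?V x) \<le> (\<Sum>p\<in>S. ?Q p x)" for x
    proof (cases "\<forall>i<2*n. x i \<in> {s<..t}")
      case True
      then have "I x = 1" by (simp add: I_def)
      obtain p where p: "p permutes {..<2*n}" and k: "\<delta> * (\<Sum>k<n. \<bar>x (p (Suc (2*k))) - x (p (2*k))\<bar> powr (2 * H)) \<le> kernel_norm H (2*n) e x"
      proof -
        have "e k = 1 \<or> e k = - 1" for k by (simp add: e_def)
        moreover have "0 \<le> x k" if "k < 2*n" for k
          using True that st(1) by (meson greaterThanAtMost_iff less_imp_le order_trans)
        ultimately show ?thesis using nd[of e x] that by blast
      qed
      let ?g = "\<lambda>k. \<bar>x (p (Suc (2*k))) - x (p (2*k))\<bar> powr (2 * H)"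
      have "c0 * (norm \<xi>)\<^sup>2 * (\<Sum>k<n. ?g k) \<le> c * (norm \<xi>)\<^sup>2 * kernel_norm H (2*n) e x"
        using mult_left_mono[OF k, of "c * (norm \<xi>)\<^sup>2"] c by (simp add: c0_def mult_ac)
      then have "?V x \<le> exp (\<Sum>k<n. - (c0 * (norm \<xi>)\<^sup>2 * ?g k))"
        by (simp add: sum_distrib_left sum_negf)
      also have "\<dots> = (\<Prod>k<n. exp (- (c0 * (norm \<xi>)\<^sup>2 * ?g k)))" by (rule exp_sum) simp
      finally have "ennreal (?V x) \<le> ennreal (\<Prod>k<n. exp (- (c0 * (norm \<xi>)\<^sup>2 * ?g k)))"
        by (rule ennreal_leI)
      also have "\<dots> = (\<Prod>k<n. ennreal (exp (- (c0 * (norm \<xi>)\<^sup>2 * ?g k))))" by (simp add: prod_ennreal)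
      also have "\<dots> \<le> ?Q p x"
      proof (rule prod_mono_ennreal)
        fix k assume "k \<in> {..<n}"
        then have "Suc (2*k) < 2*n" "2*k < 2*n" by auto
        then have "p (Suc (2*k)) < 2*n" "p (2*k) < 2*n" using permutes_in_image[OF p] by auto
        then have x: "x (p (Suc (2*k))) \<in> {s<..t}" "x (p (2*k)) \<in> {s<..t}" using True by auto
        \<comment> \<open>Times in \<open>{s<..t}\<close> differ by at most T, which supplies the
          bound on the gap that \<open>exp_frequency_shift\<close> requires; each pair contributes
          one factor \<open>E0\<close>.\<close>
        have "?g k \<le> T powr (2 * H)" using x st H by (intro powr_mono2) auto
        then have "exp (- (c0 * (norm \<xi>)\<^sup>2 * ?g k)) \<le> E0 * exp (- (\<kappa> * ?g k))"
          unfolding E0_def \<kappa>_def using c0 by (intro exp_frequency_shift) auto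
        then show "ennreal (exp (- (c0 * (norm \<xi>)\<^sup>2 * ?g k))) \<le> F (x (p (Suc (2*k)))) (x (p (2*k)))"
          using x by (auto simp: F_def E0_def ennreal_mult[symmetric] intro!: ennreal_leI)
      qed
      also have "\<dots> \<le> (\<Sum>p\<in>S. ?Q p x)"
        using p S by (intro member_le_sum) (auto simp: S_def)
      finally show ?thesis using \<open>I x = 1\<close> by simp
    next
      case False
      then obtain i where "i < 2*n" "x i \<notin> {s<..t}" by blast
      then have "I x = 0" by (auto simp: I_def intro!: prod_zero bexI[of _ i])
      then show ?thesis by simp
    qed
    have Fm[measurable]: "case_prod F \<in> borel_measurable (lborel \<Otimes>\<^sub>M lborel)"
      unfolding F_def by measurable
    have Fp: "(\<integral>\<^sup>+x. ?Q p x \<partial>P) = ?J ^ n" if "p \<in> S" for p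
    proof -
      have "p permutes {..<2*n}" using that by (simp add: S_def)
      then show ?thesis using nn_integral_pairs[OF Fm, of p n] permutes_inj_on[of p "{..<2*n}" "{..<2*n}"] permutes_image[of p "{..<2*n}"]
        by (simp add: P_def)
    qed
    have Fpm: "?Q p \<in> borel_measurable P" if "p \<in> S" for p
    proof (rule borel_measurable_prod_ennreal)
      fix k assume "k \<in> {..<n}"
      then have "p (Suc (2*k)) < 2*n" "p (2*k) < 2*n"
        using permutes_in_image[of p "{..<2*n}"] that by (auto simp: S_def)
      then show "(\<lambda>x. F (x (p (Suc (2*k)))) (x (p (2*k)))) \<in> borel_measurable P"
        using measurable_compose[OF measurable_Pair[OF Pc Pc] Fm] by simp
    qed
    have J: "?J \<le> ennreal (E0 * A * (t - s) powr (2 - \<theta>) * (1 + norm \<xi>) powr - (\<theta> / H))"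
    proof -
      have "\<kappa> powr - \<beta> = (c0 / 2) powr - \<beta> * (1 + norm \<xi>) powr - (\<theta> / H)"
      proof -
        have n: "0 < 1 + norm \<xi>" by (simp add: add_pos_nonneg)
        have "((1 + norm \<xi>)\<^sup>2) powr - \<beta> = (1 + norm \<xi>) powr (2 * - \<beta>)"
          using n powr_powr[of "1 + norm \<xi>" 2 "- \<beta>"] by (simp only: powr_numeral)
        also have "2 * - \<beta> = - (\<theta> / H)" by (simp add: \<beta>_def)
        finally show ?thesis unfolding \<kappa>_def using c0 by (subst powr_mult) auto
      qed
      then have "(\<integral>\<^sup>+a. \<integral>\<^sup>+b. ennreal (indicator {s..t} a * indicator {s..t} b * exp (- (\<kappa> * \<bar>a - b\<bar> powr (2 * H)))) \<partial>lborel \<partial>lborel)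
         \<le> ennreal (A * (t - s) powr (2 - \<theta>) * (1 + norm \<xi>) powr - (\<theta> / H))"
        using exp_pair_integral_le[OF \<theta> H(1) st(2) \<kappa>] unfolding \<beta>_def[symmetric] by (simp add: A_def mult_ac)
      then have "ennreal E0 * (\<integral>\<^sup>+a. \<integral>\<^sup>+b. ennreal (indicator {s..t} a * indicator {s..t} b * exp (- (\<kappa> * \<bar>a - b\<bar> powr (2 * H)))) \<partial>lborel \<partial>lborel)
         \<le> ennreal E0 * ennreal (A * (t - s) powr (2 - \<theta>) * (1 + norm \<xi>) powr - (\<theta> / H))"
        by (intro mult_left_mono) auto
      also have "\<dots> = ennreal (E0 * A * (t - s) powr (2 - \<theta>) * (1 + norm \<xi>) powr - (\<theta> / H))"
        using A0 by (subst ennreal_mult[symmetric]) (auto simp: E0_def mult_ac)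
      finally show ?thesis unfolding F_def by (simp add: nn_integral_cmult)
    qed
    have Di: "integrable (?N) (\<lambda>w. complex_of_real (cmod (D w) ^ (2*n)))"
      using PN.integrable_snd[OF int] by (subst Bochner_Integration.integrable_cong[OF refl stepA])
    have Dr: "integrable (?N) (\<lambda>w. cmod (D w) ^ (2*n))"
      using Di by (simp only: complex_of_real_integrable_eq)
    have "(\<integral>\<^sup>+w. ennreal (cmod (D w) ^ (2*n)) \<partial>?N) = ennreal (\<integral>w. cmod (D w) ^ (2*n) \<partial>?N)"
      by (rule nn_integral_eq_integral[OF Dr]) simp
    also have "(\<integral>w. cmod (D w) ^ (2*n) \<partial>?N) = norm (\<integral>w. complex_of_real (cmod (D w) ^ (2*n)) \<partial>?N)"
      by (simp add: integral_nonneg_AE del: of_real_power)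
    also have "(\<integral>w. complex_of_real (cmod (D w) ^ (2*n)) \<partial>?N) = (\<integral>w. \<integral>x. G x w \<partial>P \<partial>?N)"
      by (rule Bochner_Integration.integral_cong[OF refl stepA])
    also have "\<dots> = (\<integral>x. \<integral>w. G x w \<partial>?N \<partial>P)"
      by (rule PN.Fubini_integral[OF int])
    also have "ennreal (norm (\<integral>x. \<integral>w. G x w \<partial>?N \<partial>P)) \<le> (\<integral>\<^sup>+x. ennreal (norm (\<integral>w. G x w \<partial>?N)) \<partial>P)"
      by (rule integral_norm_bound_ennreal[OF PN.integrable_fst[OF int]])
    also have "\<dots> \<le> (\<integral>\<^sup>+x. (\<Sum>p\<in>S. ?Q p x) \<partial>P)"
      by (intro nn_integral_mono order_trans[OF ennreal_leI[OF stepC] stepD])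
    also have "\<dots> = (\<Sum>p\<in>S. \<integral>\<^sup>+x. ?Q p x \<partial>P)"
      by (rule nn_integral_sum) (rule Fpm)
    also have "\<dots> = (\<Sum>p\<in>S. ?J ^ n)"
      by (intro sum.cong refl Fp)
    also have "\<dots> \<le> (\<Sum>p\<in>S. ennreal (E0 * A * (t - s) powr (2 - \<theta>) * (1 + norm \<xi>) powr - (\<theta> / H)) ^ n)"
      by (intro sum_mono power_mono J) simp
    also have "\<dots> = ennreal (real (card S)) * ennreal ((E0 * A * (t - s) powr (2 - \<theta>) * (1 + norm \<xi>) powr - (\<theta> / H)) ^ n)"
      using A0 by (simp add: ennreal_power ennreal_of_nat_eq_real_of_nat E0_def)
    also have "\<dots> = ennreal ((real (card S) * (E0 * A) ^ n) * ((t - s) powr (2 - \<theta>)) ^ n * ((1 + norm \<xi>) powr - (\<theta> / H)) ^ n)"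
      using A0 by (subst ennreal_mult[symmetric]) (auto simp: E0_def power_mult_distrib mult_ac)
    finally show ?thesis unfolding D_def .
  qed
  moreover have "0 \<le> real (card S) * (E0 * A) ^ n" using A0 by (simp add: E0_def)
  ultimately show ?thesis by blast
qed

section \<open>Chaining and the union bound\<close>

text \<open>\<open>x\<close> and \<open>y\<close> are replaced by their lower dyadic neighbours at
  level \<open>m\<close>. These are equal or adjacent, which accounts for the 1 in the constant;
  refining level by level towards \<open>x\<close> and towards \<open>y\<close> gives two geometric
  tails, each at most A q^m / (1 - q).\<close>

lemma dyadic_chaining_unit:
  fixes f :: "real \<Rightarrow> complex"
  assumes f: "continuous_on {0..1} f" and q: "0 < q" "q < 1" and A: "0 \<le> A"
    and inc: "\<And>m i. i < 2 ^ m \<Longrightarrow> cmod (f ((real i + 1) / 2 ^ m) - f (real i / 2 ^ m)) \<le> A * q ^ m"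
    and xy: "0 \<le> x" "x \<le> y" "y \<le> 1" "y - x \<le> 1 / 2 ^ m"
  shows "cmod (f y - f x) \<le> (1 + 2 / (1 - q)) * A * q ^ m"
proof -
  define k where "k m x = nat \<lfloor>2 ^ m * x\<rfloor>" for m and x :: real
  define d where "d m x = real (k m x) / 2 ^ m" for m and x :: real
  have k: "real (k m x) \<le> 2 ^ m * x" "2 ^ m * x < real (k m x) + 1" if "0 \<le> x" for m x
    using that by (auto simp: k_def)
  have step: "cmod (f (d (Suc m) x) - f (d m x)) \<le> A * q ^ m" if x: "0 \<le> x" "x \<le> 1" for m x
  proof -
    have "2 * real (k m x) \<le> 2 ^ Suc m * x" "2 ^ Suc m * x < 2 * real (k m x) + 2"
      using k[OF x(1), of m] by auto
    then have "real (2 * k m x) < real (k (Suc m) x) + 1" "real (k (Suc m) x) < real (2 * k m x + 2)"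
      using k[OF x(1), of "Suc m"] by auto
    \<comment> \<open>Refining moves the lower neighbour by zero or one cell of the finer
      level.\<close>
    then consider "k (Suc m) x = 2 * k m x" | "k (Suc m) x = 2 * k m x + 1" by linarith
    then show ?thesis
    proof cases
      case 1
      then have "d (Suc m) x = d m x" by (simp add: d_def)
      then show ?thesis using A q by simp
    next
      case 2
      \<comment> \<open>\<open>inc\<close> is available only below the number of cells; x \<le> 1
        keeps the index in range.\<close>
      have "2 ^ Suc m * x \<le> 2 ^ Suc m" using x by (intro mult_left_le) auto
      then have "real (k (Suc m) x) \<le> 2 ^ Suc m" using k(1)[OF x(1), of "Suc m"] by linarith
      then have "k (Suc m) x \<le> 2 ^ Suc m" by (metis of_nat_le_iff of_nat_numeral of_nat_power)
      then have "2 * k m x < 2 ^ Suc m" using 2 by linarith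
      from inc[OF this] have "cmod (f (d (Suc m) x) - f (d m x)) \<le> A * q ^ Suc m"
        by (simp add: d_def 2 add.commute)
      also have "\<dots> \<le> A * q ^ m" using A q by (intro mult_left_mono power_decreasing) auto
      finally show ?thesis .
    qed
  qed
  have sum: "cmod (f (d (m + j) x) - f (d m x)) \<le> A * (q ^ m - q ^ (m + j)) / (1 - q)" if x: "0 \<le> x" "x \<le> 1" for m x j
  proof (induction j)
    case (Suc j)
    have "cmod (f (d (m + Suc j) x) - f (d m x)) \<le> cmod (f (d (Suc (m + j)) x) - f (d (m + j) x)) + cmod (f (d (m + j) x) - f (d m x))"
      using norm_triangle_ineq[of "f (d (Suc (m + j)) x) - f (d (m + j) x)" "f (d (m + j) x) - f (d m x)"] by simp
    also have "\<dots> \<le> A * q ^ (m + j) + A * (q ^ m - q ^ (m + j)) / (1 - q)"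
      by (intro add_mono step Suc x)
    also have "\<dots> = A * (q ^ m - q ^ (m + Suc j)) / (1 - q)" using q by (simp add: field_simps)
    finally show ?case .
  qed simp
  have lim: "cmod (f x - f (d m x)) \<le> A * q ^ m / (1 - q)" if x: "0 \<le> x" "x \<le> 1" for m x
  proof -
    have dx: "d m x \<le> x" "0 \<le> d m x" for m
      using k[OF x(1), of m] by (auto simp: d_def field_simps)
    have dx': "x - 1 / 2 ^ m \<le> d m x" for m
    proof -
      have "x - 1 / 2 ^ m = (2 ^ m * x - 1) / 2 ^ m" by (simp add: diff_divide_distrib)
      also have "\<dots> \<le> d m x" unfolding d_def using k(2)[OF x(1), of m] by (intro divide_right_mono) auto
      finally show ?thesis .
    qed
    have "(\<lambda>j. d (m + j) x) \<longlonglongrightarrow> x"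
    proof (rule tendsto_sandwich)
      show "\<forall>\<^sub>F j in sequentially. x - 1 / 2 ^ (m + j) \<le> d (m + j) x" using dx' by (intro always_eventually) blast
      show "\<forall>\<^sub>F j in sequentially. d (m + j) x \<le> x" using dx(1) by (intro always_eventually) blast
      have "(\<lambda>j. (1/2::real) ^ (m + j)) \<longlonglongrightarrow> 0"
        using LIMSEQ_ignore_initial_segment[OF LIMSEQ_realpow_zero[of "1/2"], of m] by (simp add: add.commute)
      then have "(\<lambda>j. x - (1/2) ^ (m + j)) \<longlonglongrightarrow> x - 0" by (intro tendsto_diff tendsto_const)
      then show "(\<lambda>j. x - 1 / 2 ^ (m + j)) \<longlonglongrightarrow> x" by (simp add: power_one_over)
    qed simp
    then have "(\<lambda>j. f (d (m + j) x)) \<longlonglongrightarrow> f x"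
      by (rule continuous_on_tendsto_compose[OF f]) (use dx x in \<open>auto intro: order_trans always_eventually\<close>)
    then have "(\<lambda>j. cmod (f (d (m + j) x) - f (d m x))) \<longlonglongrightarrow> cmod (f x - f (d m x))"
      by (intro tendsto_intros)
    moreover have "cmod (f (d (m + j) x) - f (d m x)) \<le> A * q ^ m / (1 - q)" for j
    proof -
      have "A * (q ^ m - q ^ (m + j)) / (1 - q) \<le> A * q ^ m / (1 - q)"
        using A q by (intro divide_right_mono mult_left_mono) auto
      then show ?thesis using sum[OF x, of m j] by linarith
    qed
    ultimately show ?thesis by (intro LIMSEQ_le_const2) auto
  qed
  have x: "0 \<le> x" "x \<le> 1" and y: "0 \<le> y" "y \<le> 1" using xy by auto
  have mid: "cmod (f (d m y) - f (d m x)) \<le> A * q ^ m"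
  proof -
    have "2 ^ m * y \<le> 2 ^ m * x + 1" using xy(4) by (simp add: field_simps)
    moreover have "2 ^ m * x \<le> 2 ^ m * y" using xy by simp
    ultimately have "real (k m x) < real (k m y) + 1" "real (k m y) < real (k m x) + 2"
      using k[OF x(1), of m] k[OF y(1), of m] by linarith+
    then consider "k m y = k m x" | "k m y = k m x + 1" by linarith
    then show ?thesis
    proof cases
      case 1 then show ?thesis using A q by (simp add: d_def)
    next
      case 2
      have "2 ^ m * y \<le> 2 ^ m" using y by (intro mult_left_le) auto
      then have "real (k m y) \<le> 2 ^ m" using k(1)[OF y(1), of m] by linarith
      then have "k m y \<le> 2 ^ m" by (metis of_nat_le_iff of_nat_numeral of_nat_power)
      then have "k m x < 2 ^ m" using 2 by linarith
      from inc[OF this] show ?thesis by (simp add: d_def 2 add.commute)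
    qed
  qed
  have "f y - f x = (f y - f (d m y)) + (f (d m y) - f (d m x)) - (f x - f (d m x))" by simp
  then have "cmod (f y - f x) \<le> cmod (f y - f (d m y)) + cmod (f (d m y) - f (d m x)) + cmod (f x - f (d m x))"
    by (metis norm_triangle_ineq norm_triangle_ineq4 add_right_mono order_trans)
  also have "\<dots> \<le> A * q ^ m / (1 - q) + A * q ^ m + A * q ^ m / (1 - q)"
    by (intro add_mono lim mid x y)
  also have "\<dots> = (1 + 2 / (1 - q)) * A * q ^ m" by (simp add: algebra_simps add_divide_distrib)
  finally show ?thesis .
qed

lemma exists_dyadic_scale:
  fixes h :: real assumes "0 < h" "h \<le> 1"
  shows "\<exists>m. 1 / 2 ^ Suc m < h \<and> h \<le> 1 / 2 ^ m"
proof -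
  have ex: "\<exists>m. 1 / 2 ^ Suc m < h"
  proof -
    obtain m where "(1/2) ^ m < h" using real_arch_pow_inv[OF assms(1), of "1/2"] by auto
    moreover have "(1/2::real) ^ Suc m \<le> (1/2) ^ m" by simp
    ultimately have "(1/2) ^ Suc m < h" by linarith
    then show ?thesis by (auto simp: power_one_over)
  qed
  define m where "m = (LEAST m. 1 / 2 ^ Suc m < h)"
  have m: "1 / 2 ^ Suc m < h" unfolding m_def by (rule LeastI_ex[OF ex])
  have "h \<le> 1 / 2 ^ m"
  proof (cases m)
    case (Suc l)
    then have "\<not> 1 / 2 ^ Suc l < h" using not_less_Least[of l "\<lambda>m. 1 / 2 ^ Suc m < h"] unfolding m_def[symmetric] by simp
    then show ?thesis using Suc by simp
  qed (use assms in simp)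
  then show ?thesis using m by blast
qed

lemma dyadic_chaining:
  fixes F :: "real \<Rightarrow> complex" and T \<gamma> A :: real
  assumes T: "0 < T" and F: "continuous_on {0..T} F" and \<gamma>: "0 < \<gamma>" and A: "0 \<le> A"
    and inc: "\<And>m i. i < 2 ^ m \<Longrightarrow> cmod (F (T * (real i + 1) / 2 ^ m) - F (T * real i / 2 ^ m)) \<le> A * (2 powr - \<gamma>) ^ m"
    and st: "0 \<le> s" "s \<le> t" "t \<le> T"
  shows "cmod (F t - F s) \<le> (1 + 2 / (1 - 2 powr - \<gamma>)) * 2 powr \<gamma> * A * ((t - s) / T) powr \<gamma>"
proof (cases "s = t")
  case False
  define q where "q = 2 powr - \<gamma>"
  have q: "0 < q" "q < 1" using \<gamma> powr_less_mono[of "- \<gamma>" 0 2] by (auto simp: q_def)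
  define h where "h = (t - s) / T"
  have h: "0 < h" "h \<le> 1" using st False T by (auto simp: h_def)
  obtain m where m: "1 / 2 ^ Suc m < h" "h \<le> 1 / 2 ^ m" using exists_dyadic_scale[OF h] by blast
  have "cmod ((\<lambda>x. F (T * x)) (t / T) - (\<lambda>x. F (T * x)) (s / T)) \<le> (1 + 2 / (1 - q)) * A * q ^ m"
  proof (rule dyadic_chaining_unit[where f = "\<lambda>x. F (T * x)" and x = "s / T" and y = "t / T"])
    show "continuous_on {0..1} (\<lambda>x. F (T * x))"
      by (rule continuous_on_compose2[OF F]) (use T in \<open>auto intro!: continuous_intros simp: mult_le_cancel_left1\<close>)
    show "cmod (F (T * ((real i + 1) / 2 ^ m)) - F (T * (real i / 2 ^ m))) \<le> A * q ^ m" if "i < 2 ^ m" for i m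
      using inc[OF that] by (simp add: q_def)
    show "t / T - s / T \<le> 1 / 2 ^ m" using m by (simp add: h_def diff_divide_distrib)
  qed (use q A st T in \<open>auto simp: divide_right_mono\<close>)
  then have "cmod (F t - F s) \<le> (1 + 2 / (1 - q)) * A * q ^ m" using T by simp
  also have "\<dots> \<le> (1 + 2 / (1 - q)) * A * (2 powr \<gamma> * h powr \<gamma>)"
  proof (rule mult_left_mono)
    have "q ^ m = (1 / 2 ^ m) powr \<gamma>"
      by (simp add: q_def powr_realpow[symmetric] powr_powr powr_divide powr_minus_divide mult.commute)
    \<comment> \<open>The scale was chosen with 1 / 2^(m + 1) < h, so 1 / 2^m < 2 h; this is the
      origin of the factor \<open>2 powr \<gamma>\<close>.\<close>
    also have "\<dots> \<le> (2 * h) powr \<gamma>" using m(1) \<gamma> by (intro powr_mono2) (auto simp: field_simps)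
    also have "\<dots> = 2 powr \<gamma> * h powr \<gamma>" using h by (simp add: powr_mult)
    finally show "q ^ m \<le> 2 powr \<gamma> * h powr \<gamma>" .
    show "0 \<le> (1 + 2 / (1 - q)) * A" using q A by simp
  qed
  finally show ?thesis by (simp add: q_def h_def mult_ac)
qed simp

section \<open>Discretisation of the frequencies\<close>

lemma norm_iexp_diff_le: "cmod (exp (\<i> * complex_of_real a) - exp (\<i> * complex_of_real b)) \<le> \<bar>a - b\<bar>"
proof -
  have "exp (\<i> * complex_of_real a) - exp (\<i> * complex_of_real b) = exp (\<i> * complex_of_real b) * (iexp (a - b) - 1)"
    by (simp add: right_diff_distrib exp_add[symmetric] algebra_simps)
  then show ?thesis using iexp_approx1[of "a - b" 0] by (simp add: norm_mult)
qed

text \<open>The phase is 1-Lipschitz and the path bounded, so neighbouring frequencies have nearby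
  increments. The bound is linear in t - s as well, so rounding the frequency does not spoil the
  time regularity.\<close>

lemma osc_lipschitz_frequency:
  fixes w :: "real \<Rightarrow> real^'d"
  assumes w: "continuous_on {0..T} w" and W: "\<And>r. r \<in> {0..T} \<Longrightarrow> norm (w r) \<le> W"
    and st: "0 \<le> s" "s \<le> t" "t \<le> T"
  shows "cmod ((osc w t \<xi> - osc w s \<xi>) - (osc w t \<eta> - osc w s \<eta>)) \<le> norm (\<xi> - \<eta>) * W * (t - s)"
proof -
  let ?f = "\<lambda>\<xi> r. indicator {s<..t} r *\<^sub>R iexp (\<xi> \<bullet> w r)"
  note o = osc_diff[OF w st]
  have i: "integrable lborel (\<lambda>r. ?f \<xi> r - ?f \<eta> r)" using o(2) by auto
  have ib: "has_bochner_integral lborel (indicator {s<..t} :: real \<Rightarrow> real) (measure lborel {s<..t})"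
    by (rule has_bochner_integral_real_indicator) (use st in auto)
  have b: "norm (?f \<xi> r - ?f \<eta> r) \<le> indicator {s<..t} r * (norm (\<xi> - \<eta>) * W)" for r
  proof (cases "r \<in> {s<..t}")
    case True
    have "cmod (iexp (\<xi> \<bullet> w r) - iexp (\<eta> \<bullet> w r)) \<le> \<bar>\<xi> \<bullet> w r - \<eta> \<bullet> w r\<bar>"
      by (rule norm_iexp_diff_le)
    also have "\<dots> = \<bar>(\<xi> - \<eta>) \<bullet> w r\<bar>" by (simp add: inner_diff_left)
    also have "\<dots> \<le> norm (\<xi> - \<eta>) * norm (w r)" by (rule Cauchy_Schwarz_ineq2)
    also have "\<dots> \<le> norm (\<xi> - \<eta>) * W" using True st by (intro mult_left_mono W) auto
    finally show ?thesis using True by simp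
  qed simp
  have "cmod ((osc w t \<xi> - osc w s \<xi>) - (osc w t \<eta> - osc w s \<eta>)) = cmod (\<integral>r. ?f \<xi> r - ?f \<eta> r \<partial>lborel)"
    unfolding o(1) by (subst Bochner_Integration.integral_diff[OF o(2) o(2)]) simp
  also have "\<dots> \<le> (\<integral>r. indicator {s<..t} r * (norm (\<xi> - \<eta>) * W) \<partial>lborel)"
    using ib by (intro order_trans[OF integral_norm_bound] integral_mono integrable_norm i b integrable_mult_left)
      (simp add: has_bochner_integral_iff)
  also have "\<dots> = norm (\<xi> - \<eta>) * W * (t - s)" using st by simp
  finally show ?thesis .
qed

lemma osc_continuous:
  fixes w :: "real \<Rightarrow> real^'d"
  assumes w: "continuous_on {0..T} w"
  shows "continuous_on {0..T} (\<lambda>t. osc w t \<xi>)"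
proof -
  have le: "cmod (osc w t \<xi> - osc w s \<xi>) \<le> t - s" if st: "0 \<le> s" "s \<le> t" "t \<le> T" for s t
  proof -
    have "cmod (osc w t \<xi> - osc w s \<xi>) \<le> (\<integral>r. norm (indicator {s<..t} r *\<^sub>R iexp (\<xi> \<bullet> w r)) \<partial>lborel)"
      unfolding osc_diff(1)[OF w st] by (rule integral_norm_bound)
    also have "\<dots> = (\<integral>r. indicator {s<..t} r \<partial>lborel)" by simp
    also have "\<dots> = t - s" using st by simp
    finally show ?thesis .
  qed
  have "1-lipschitz_on {0..T} (\<lambda>t. osc w t \<xi>)"
  proof (rule lipschitz_onI)
    fix x y assume "x \<in> {0..T}" "y \<in> {0..T}"
    then show "dist (osc w x \<xi>) (osc w y \<xi>) \<le> 1 * dist x y"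
      using le[of x y] le[of y x] by (cases "x \<le> y") (auto simp: dist_norm norm_minus_commute)
  qed simp
  then show ?thesis by (rule lipschitz_on_continuous_on)
qed

definition round_to_grid :: "nat \<Rightarrow> nat \<Rightarrow> real^'d \<Rightarrow> real^'d" where
  "round_to_grid K N \<xi> = (\<chi> j. of_int \<lfloor>real N ^ K * \<xi> $ j\<rfloor> / real N ^ K)"

text \<open>The rounded frequencies of the shell N - 1 \<le> |\<xi>| \<le> N. Mesh N^(-K) with K
  \<ge> \<rho> makes the rounding error at most of order N^(-\<rho>), while the number of points
  stays polynomial in N.\<close>

definition frequency_grid :: "nat \<Rightarrow> nat \<Rightarrow> (real^'d) set" where
  "frequency_grid K N = round_to_grid K N ` {\<xi>. real N \<le> 1 + norm \<xi> \<and> norm \<xi> \<le> real N}"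

lemma norm_round_to_grid:
  fixes \<xi> :: "real^'d"
  assumes "1 \<le> N" shows "norm (\<xi> - round_to_grid K N \<xi>) \<le> real CARD('d) / real N ^ K"
proof -
  have pos: "0 < real N ^ K" using assms by simp
  have "norm (\<xi> - round_to_grid K N \<xi>) \<le> (\<Sum>j\<in>UNIV. \<bar>(\<xi> - round_to_grid K N \<xi>) $ j\<bar>)"
    by (rule norm_le_l1_cart)
  also have "\<dots> \<le> (\<Sum>j\<in>(UNIV::'d set). 1 / real N ^ K)"
  proof (rule sum_mono)
    fix j
    have "(\<xi> - round_to_grid K N \<xi>) $ j = (real N ^ K * \<xi> $ j - of_int \<lfloor>real N ^ K * \<xi> $ j\<rfloor>) / real N ^ K"
      using pos by (simp add: round_to_grid_def diff_divide_distrib)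
    also have "\<bar>\<dots>\<bar> \<le> 1 / real N ^ K"
    proof -
      have "\<bar>real N ^ K * \<xi> $ j - of_int \<lfloor>real N ^ K * \<xi> $ j\<rfloor>\<bar> \<le> 1" by linarith
      then show ?thesis using pos by (simp add: divide_right_mono)
    qed
    finally show "\<bar>(\<xi> - round_to_grid K N \<xi>) $ j\<bar> \<le> 1 / real N ^ K" .
  qed
  also have "\<dots> = real CARD('d) / real N ^ K" by simp
  finally show ?thesis .
qed

text \<open>A grid point is given by integer numerators of modulus at most N^(K + 1) in each
  coordinate; there are 2 N^(K + 1) + 1 \<le> 3 N^(K + 1) choices for each.\<close>

lemma frequency_grid_card:
  assumes N: "1 \<le> N"
  shows "finite (frequency_grid K N :: (real^'d) set)"
    and "real (card (frequency_grid K N :: (real^'d) set)) \<le> (3 * real N ^ (K + 1)) ^ CARD('d)"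
proof -
  let ?I = "{- (int N ^ (K + 1)) .. int N ^ (K + 1)}"
  let ?Z = "PiE (UNIV :: 'd set) (\<lambda>_. ?I)"
  let ?h = "\<lambda>z :: 'd \<Rightarrow> int. (\<chi> j. of_int (z j) / real N ^ K) :: real^'d"
  have sub: "frequency_grid K N \<subseteq> ?h ` ?Z"
  proof
    fix q :: "real^'d" assume "q \<in> frequency_grid K N"
    then obtain \<xi> :: "real^'d" where \<xi>: "norm \<xi> \<le> real N" "q = round_to_grid K N \<xi>" by (auto simp: frequency_grid_def)
    have "\<lfloor>real N ^ K * \<xi> $ j\<rfloor> \<in> ?I" for j
    proof -
      have "\<bar>\<xi> $ j\<bar> \<le> real N" using component_le_norm_cart[of \<xi> j] \<xi>(1) by linarith
      then have "\<bar>real N ^ K * \<xi> $ j\<bar> \<le> real N ^ K * real N" unfolding abs_mult by (intro mult_mono) auto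
      then have "- (real N ^ (K + 1)) \<le> real N ^ K * \<xi> $ j" "real N ^ K * \<xi> $ j \<le> real N ^ (K + 1)" by (auto simp: mult.commute)
      then have "real_of_int (- (int N ^ (K + 1))) \<le> real N ^ K * \<xi> $ j" "real N ^ K * \<xi> $ j \<le> real_of_int (int N ^ (K + 1))" by auto
      then show ?thesis by (simp add: le_floor_iff floor_le_iff del: of_int_minus of_int_power power_Suc power_add)
    qed
    then have z: "(\<lambda>j. \<lfloor>real N ^ K * \<xi> $ j\<rfloor>) \<in> ?Z" by (auto simp: PiE_UNIV_domain)
    show "q \<in> ?h ` ?Z" by (rule image_eqI[OF _ z]) (simp add: \<xi>(2) round_to_grid_def)
  qed
  have fZ: "finite ?Z" by (intro finite_PiE) auto
  then show "finite (frequency_grid K N :: (real^'d) set)" using sub finite_surj by blast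
  have "card (frequency_grid K N :: (real^'d) set) \<le> card (?h ` ?Z)" using fZ sub by (intro card_mono) auto
  also have "\<dots> \<le> card ?Z" using fZ by (rule card_image_le)
  also have "\<dots> = card ?I ^ CARD('d)" by (simp add: card_PiE)
  finally have "real (card (frequency_grid K N :: (real^'d) set)) \<le> real (card ?I ^ CARD('d))" by (rule of_nat_mono)
  also have "\<dots> = (real (card ?I)) ^ CARD('d)" by simp
  also have "\<dots> \<le> (3 * real N ^ (K + 1)) ^ CARD('d)"
  proof (rule power_mono)
    have "1 \<le> real N ^ (K + 1)" using N by (intro one_le_power) simp
    moreover have "real (card ?I) = 2 * real N ^ (K + 1) + 1" by (simp add: nat_add_distrib nat_power_eq)
    ultimately show "real (card ?I) \<le> 3 * real N ^ (K + 1)" by linarith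
  qed simp
  finally show "real (card (frequency_grid K N :: (real^'d) set)) \<le> (3 * real N ^ (K + 1)) ^ CARD('d)" .
qed

text \<open>Rounding may bring a frequency closer to the origin, but by at most
  \<open>CARD('d)\<close> since the mesh is at most 1. The moment bound at a grid point can
  therefore be expressed in \<open>N\<close>.\<close>

lemma frequency_grid_norm:
  fixes q :: "real^'d"
  assumes N: "1 \<le> N" and q: "q \<in> frequency_grid K N"
  shows "real N \<le> (1 + real CARD('d)) * (1 + norm q)"
proof -
  obtain \<xi> :: "real^'d" where \<xi>: "real N \<le> 1 + norm \<xi>" "q = round_to_grid K N \<xi>" using q by (auto simp: frequency_grid_def)
  have "1 \<le> real N ^ K" using N by (intro one_le_power) simp
  then have "real CARD('d) / real N ^ K \<le> real CARD('d)" by (simp add: divide_le_eq mult_le_cancel_left1)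
  then have "norm (\<xi> - q) \<le> real CARD('d)"
    unfolding \<xi>(2) by (rule order_trans[OF norm_round_to_grid[OF N]])
  then have "real N \<le> 1 + norm q + real CARD('d)" using \<xi>(1) norm_triangle_sub[of \<xi> q] by linarith
  also have "\<dots> \<le> (1 + real CARD('d)) * (1 + norm q)" by (simp add: distrib_left distrib_right)
  finally show ?thesis .
qed

lemma osc_diff_measurable:
  assumes "0 \<le> s" "s \<le> t" "t \<le> T"
  shows "(\<lambda>w. osc w t \<xi> - osc w s \<xi>) \<in> borel_measurable (path_law M T B)"
proof (subst measurable_cong)
  show "osc w t \<xi> - osc w s \<xi> = (\<integral>r. indicator {s<..t} r *\<^sub>R iexp (\<xi> \<bullet> w r) \<partial>lborel)"
    if "w \<in> space (path_law M T B)" for w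
    by (rule osc_diff(1)[OF path_law_continuous[OF that] assms])
  have "(\<lambda>(r, w). indicator {s<..t} r *\<^sub>R iexp (\<xi> \<bullet> w r)) \<in> borel_measurable (lborel \<Otimes>\<^sub>M path_law M T B)"
    using phase_measurable[OF assms(1,3), of 1 \<xi>]
    by (subst measurable_cong_sets[OF sets_pair_measure_cong[OF refl sets_path_law] refl]) simp
  from measurable_pair_swap[OF this]
  show "(\<lambda>w. \<integral>r. indicator {s<..t} r *\<^sub>R iexp (\<xi> \<bullet> w r) \<partial>lborel) \<in> borel_measurable (path_law M T B)"
    by (intro lborel.borel_measurable_lebesgue_integral) simp
qed

text \<open>The factors are the number of dyadic intervals at level m, the 2n-th power of the Holder
  weight, and the time factor of the moment. Their exponents add up to m (1 - n (2 - \<theta> - 2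
  \<gamma>)); the positive gap, multiplied by a large n, absorbs the count.\<close>

lemma dyadic_weight_le:
  fixes \<theta> \<gamma> :: real
  assumes "2 \<le> real n * (2 - \<theta> - 2 * \<gamma>)"
  shows "2 ^ m * ((2 powr \<gamma>) ^ m) ^ (2*n) * ((1 / 2 ^ m) powr (2 - \<theta>)) ^ n \<le> (1/2) ^ m"
proof -
  have half: "(1 / 2 ^ m :: real) = 2 powr (- real m)"
    unfolding powr_minus_divide by (simp only: powr_realpow[of 2, simplified])
  then have "2 ^ m * ((2 powr \<gamma>) ^ m) ^ (2*n) * ((1 / 2 ^ m) powr (2 - \<theta>)) ^ n =
      2 powr (real m) * 2 powr (\<gamma> * real m * real (2*n)) * 2 powr (- real m * (2 - \<theta>) * real n)"
    by (simp add: powr_powr powr_realpow[symmetric] mult_ac)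
  also have "\<dots> = 2 powr (real m * (1 - real n * (2 - \<theta> - 2 * \<gamma>)))"
    by (simp add: powr_add[symmetric] algebra_simps)
  also have "\<dots> \<le> 2 powr (real m * (- 1))"
    using assms by (intro powr_mono mult_left_mono) auto
  also have "\<dots> = (1/2) ^ m" using half by (simp add: power_one_over)
  finally show ?thesis .
qed

text \<open>The same balance in frequency: size of the grid, 2n-th power of the weight N^\<rho>,
  frequency factor of the moment. What remains is the summable power N^(-2).\<close>

lemma frequency_weight_le:
  fixes N :: real
  assumes "1 \<le> N" "real ((K + 1) * d) + 2 \<le> real n * (\<sigma> - 2 * \<rho>)"
  shows "(N ^ (K + 1)) ^ d * (N powr \<rho>) ^ (2*n) * (N powr - \<sigma>) ^ n \<le> 1 / N\<^sup>2"
proof -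
  have N: "0 < N" using assms by simp
  have "(N ^ (K + 1)) ^ d * (N powr \<rho>) ^ (2*n) * (N powr - \<sigma>) ^ n =
      N powr (real ((K + 1) * d)) * N powr (\<rho> * real (2*n)) * N powr (- \<sigma> * real n)"
    unfolding power_mult[symmetric] using N
    by (simp add: powr_powr powr_realpow[symmetric] del: of_nat_mult of_nat_add)
  also have "\<dots> = N powr (real ((K + 1) * d) - real n * (\<sigma> - 2 * \<rho>))"
    by (simp add: powr_add[symmetric] algebra_simps)
  also have "\<dots> \<le> N powr (- 2)" using assms by (intro powr_mono) auto
  also have "\<dots> = 1 / N\<^sup>2" using N by (simp add: powr_minus powr_numeral divide_inverse)
  finally show ?thesis .
qed

lemma suminf_double_finite:
  fixes R :: real assumes "0 \<le> R"
  shows "(\<Sum>N. \<Sum>m. ennreal (R * (1/2) ^ m * (1 / (real (Suc N))\<^sup>2))) < \<infinity>"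
proof -
  have inner: "(\<Sum>m. ennreal (R * (1/2) ^ m * (1 / (real (Suc N))\<^sup>2))) = ennreal (2 * R * inverse ((real (Suc N))\<^sup>2))" for N
  proof -
    define c where "c = inverse ((real (Suc N))\<^sup>2)"
    have c: "0 \<le> c" "1 / (real (Suc N))\<^sup>2 = c" by (simp_all add: c_def divide_inverse)
    have "(\<lambda>m. (R * c) * (1/2) ^ m) sums ((R * c) * (1 / (1 - 1/2)))"
      by (intro sums_mult geometric_sums) simp
    then have "(\<lambda>m. R * (1/2) ^ m * c) sums (2 * R * c)" by (simp add: mult_ac)
    then show ?thesis unfolding c(2) c_def[symmetric] using assms c(1) by (subst suminf_ennreal2) (auto simp: sums_iff)
  qed
  have "summable (\<lambda>N. inverse ((real (Suc N))\<^sup>2))"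
    using inverse_power_summable[of 2, where 'a = real] summable_Suc_iff[of "\<lambda>n. inverse ((real n)\<^sup>2)"] by simp
  then have "summable (\<lambda>N. 2 * R * inverse ((real (Suc N))\<^sup>2))" by (rule summable_mult)
  then show ?thesis unfolding inner using assms by (subst suminf_ennreal2) auto
qed

lemma term_le_suminf_ennreal: "f i \<le> (\<Sum>i. f i)" for f :: "nat \<Rightarrow> ennreal"
  using sum_le_suminf[of f "{i}"] by (simp add: summableI)

text \<open>A crude root extraction: any bound on \<open>x\<close> will do, so 1 + s stands in for
  the k-th root of s.\<close>

lemma le_of_power_le:
  fixes x s :: real
  assumes "x ^ k \<le> s" "1 \<le> k" "0 \<le> s" shows "x \<le> 1 + s"
proof (cases "1 \<le> x")
  case True
  then have "x \<le> x ^ k" using assms by (intro self_le_power) auto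
  then show ?thesis using assms by linarith
qed (use assms in linarith)

lemma powr_minus_quotient:
  fixes x y a :: real
  assumes "0 \<le> x" "0 \<le> y"
  shows "(x / y) powr - a = y powr a * x powr - a"
proof -
  have "(x / y) powr - a = x powr - a / y powr - a" using assms by (simp add: powr_divide)
  also have "\<dots> = y powr a * x powr - a" unfolding powr_minus[of y] by (simp only: divide_inverse inverse_inverse_eq mult.commute)
  finally show ?thesis .
qed

text \<open>Deterministic passage from the grid to all times and frequencies: chaining in time at
  the rounded frequency, then the Lipschitz bound in frequency. The bound \<open>W\<close> on the
  path enters the constant here.\<close>

lemma irregularity_from_grid:
  fixes w :: "real \<Rightarrow> real^'d"
  assumes T: "0 < T" and w: "continuous_on {0..T} w" and \<gamma>: "0 < \<gamma>" "\<gamma> \<le> 1" and \<rho>: "0 < \<rho>" "\<rho> \<le> real K"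
    and A: "0 \<le> A"
    and grid: "\<And>N m q i. q \<in> frequency_grid K (Suc N) \<Longrightarrow> i < 2 ^ m \<Longrightarrow>
      (2 powr \<gamma>) ^ m * real (Suc N) powr \<rho> * cmod (osc w (T * (real i + 1) / 2 ^ m) q - osc w (T * real i / 2 ^ m) q) \<le> A"
  shows "\<exists>C. \<forall>s t \<xi>. 0 \<le> s \<longrightarrow> s \<le> t \<longrightarrow> t \<le> T \<longrightarrow>
     cmod (osc w t \<xi> - osc w s \<xi>) \<le> C * \<bar>t - s\<bar> powr \<gamma> * (1 + norm \<xi>) powr - \<rho>"
proof -
  obtain W where W: "\<And>r. r \<in> {0..T} \<Longrightarrow> norm (w r) \<le> W" using path_bounded[OF w] by blast
  have W0: "0 \<le> W" using W[of 0] T norm_ge_zero[of "w 0"] by (meson atLeastAtMost_iff less_imp_le order_refl order_trans)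
  define R where "R = (1 + 2 / (1 - 2 powr - \<gamma>)) * 2 powr \<gamma>"
  have "2 powr - \<gamma> < 2 powr (0::real)" using \<gamma> by (intro powr_less_mono) auto
  then have R0: "0 \<le> R" by (simp add: R_def)
  have "cmod (osc w t \<xi> - osc w s \<xi>) \<le> ((R * A + real CARD('d) * W * T) * 2 powr \<rho> / T powr \<gamma>) * \<bar>t - s\<bar> powr \<gamma> * (1 + norm \<xi>) powr - \<rho>"
    if st: "0 \<le> s" "s \<le> t" "t \<le> T" for s t and \<xi> :: "real^'d"
  proof -
    \<comment> \<open>N' = N + 1 lies between |\<xi>| and 1 + |\<xi>|, so \<open>\<xi>\<close>
      belongs to shell \<open>Suc N\<close>, and shell 0 never occurs.\<close>
    define N where "N = nat \<lfloor>norm \<xi>\<rfloor>"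
    define N' where "N' = real (Suc N)"
    have "N' = of_int \<lfloor>norm \<xi>\<rfloor> + 1" by (simp add: N'_def N_def)
    then have N: "N' \<le> 1 + norm \<xi>" "norm \<xi> \<le> N'" by linarith+
    have N1: "1 \<le> N'" by (simp add: N'_def)
    define q where "q = round_to_grid K (Suc N) \<xi>"
    have qG: "q \<in> frequency_grid K (Suc N)" using N by (auto simp: q_def frequency_grid_def N'_def)
    define h where "h = (t - s) / T"
    have h: "0 \<le> h" "h \<le> 1" using st T by (auto simp: h_def)
    have "cmod (osc w t q - osc w s q) \<le> (1 + 2 / (1 - 2 powr - \<gamma>)) * 2 powr \<gamma> * (A * N' powr - \<rho>) * ((t - s) / T) powr \<gamma>"
    proof (rule dyadic_chaining[OF T osc_continuous[OF w] \<gamma>(1) _ _ st])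
      show "0 \<le> A * N' powr - \<rho>" using A by simp
      show "cmod (osc w (T * (real i + 1) / 2 ^ m) q - osc w (T * real i / 2 ^ m) q) \<le> A * N' powr - \<rho> * (2 powr - \<gamma>) ^ m"
        if "i < 2 ^ m" for m i
      proof -
        have "0 < (2 powr \<gamma>) ^ m * N' powr \<rho>" using N1 by simp
        then have "cmod (osc w (T * (real i + 1) / 2 ^ m) q - osc w (T * real i / 2 ^ m) q) \<le> A / ((2 powr \<gamma>) ^ m * N' powr \<rho>)"
          using grid[OF qG that] by (simp add: pos_le_divide_eq N'_def mult_ac)
        also have "\<dots> = A * N' powr - \<rho> * (2 powr - \<gamma>) ^ m"
          by (simp add: powr_minus divide_inverse power_inverse)
        finally show ?thesis .
      qed
    qed
    then have 1: "cmod (osc w t q - osc w s q) \<le> R * A * N' powr - \<rho> * h powr \<gamma>"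
      by (simp add: R_def h_def mult_ac)
    have "cmod ((osc w t \<xi> - osc w s \<xi>) - (osc w t q - osc w s q)) \<le> norm (\<xi> - q) * W * (t - s)"
      by (rule osc_lipschitz_frequency[OF w W st])
    also have "\<dots> \<le> (real CARD('d) * N' powr - \<rho>) * W * (T * h powr \<gamma>)"
    proof (intro mult_mono mult_nonneg_nonneg W0 order_refl)
      have "norm (\<xi> - q) \<le> real CARD('d) * (1 / N' ^ K)"
        using norm_round_to_grid[of "Suc N" \<xi> K] by (simp add: q_def N'_def)
      also have "\<dots> \<le> real CARD('d) * N' powr - \<rho>"
      proof (rule mult_left_mono)
        have "N' powr \<rho> \<le> N' powr real K" using \<rho> N1 by (intro powr_mono) auto
        also have "\<dots> = N' ^ K" using N1 by (simp add: powr_realpow)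
        finally show "1 / N' ^ K \<le> N' powr - \<rho>" using N1 by (simp add: powr_minus divide_inverse le_imp_inverse_le)
      qed simp
      finally show "norm (\<xi> - q) \<le> real CARD('d) * N' powr - \<rho>" .
      \<comment> \<open>The Lipschitz bound is linear in time; for h \<le> 1 and \<gamma> \<le> 1 it
        is dominated by h^\<gamma>.\<close>
      have "h powr 1 \<le> h powr \<gamma>" using h \<gamma> by (intro powr_mono')
      then show "t - s \<le> T * h powr \<gamma>" using h T by (simp add: h_def field_simps)
    qed (use st T in auto)
    also have "\<dots> = real CARD('d) * W * T * N' powr - \<rho> * h powr \<gamma>" by (simp add: mult_ac)
    finally have 2: "cmod ((osc w t \<xi> - osc w s \<xi>) - (osc w t q - osc w s q)) \<le> real CARD('d) * W * T * N' powr - \<rho> * h powr \<gamma>" .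
    have "cmod (osc w t \<xi> - osc w s \<xi>) \<le> cmod (osc w t q - osc w s q) + cmod ((osc w t \<xi> - osc w s \<xi>) - (osc w t q - osc w s q))"
      by (rule norm_triangle_sub)
    also have "\<dots> \<le> (R * A + real CARD('d) * W * T) * (N' powr - \<rho>) * h powr \<gamma>"
      using 1 2 by (simp add: distrib_right)
    also have "\<dots> \<le> (R * A + real CARD('d) * W * T) * (2 powr \<rho> * (1 + norm \<xi>) powr - \<rho>) * h powr \<gamma>"
    proof (intro mult_right_mono mult_left_mono)
      \<comment> \<open>N' \<ge> 1 and N' \<ge> |\<xi>| give N' \<ge> (1 + |\<xi>|) / 2.\<close>
      have "N' powr - \<rho> \<le> ((1 + norm \<xi>) / 2) powr - \<rho>" using N N1 \<rho> by (intro powr_mono2') auto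
      also have "\<dots> = 2 powr \<rho> * (1 + norm \<xi>) powr - \<rho>" by (rule powr_minus_quotient) auto
      finally show "N' powr - \<rho> \<le> 2 powr \<rho> * (1 + norm \<xi>) powr - \<rho>" .
    qed (use R0 A W0 T in auto)
    also have "h powr \<gamma> = \<bar>t - s\<bar> powr \<gamma> / T powr \<gamma>" using st T by (simp add: h_def powr_divide)
    finally show ?thesis by (simp add: mult_ac)
  qed
  then show ?thesis by blast
qed

text \<open>The union bound is carried out by a single random series \<open>S\<close> of all
  weighted 2n-th powers. Its expectation is finite, so it is almost surely finite, and its value
  bounds every term at once.\<close>

lemma irregularity_AE:
  fixes B :: "real \<Rightarrow> 'w \<Rightarrow> real^'d"
  assumes H: "0 < H" "H < 1" and T: "0 < T" and B: "fractional_brownian_motion M H T B"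
    and \<theta>: "0 < \<theta>" "\<theta> < 1" and \<rho>: "0 < \<rho>" "\<rho> < \<theta> / (2 * H)" and \<gamma>: "0 < \<gamma>" "\<gamma> < 1 - \<theta> / 2"
  shows "AE w in path_law M T B. \<exists>C. \<forall>s t \<xi>. 0 \<le> s \<longrightarrow> s \<le> t \<longrightarrow> t \<le> T \<longrightarrow>
     cmod (osc w t \<xi> - osc w s \<xi>) \<le> C * \<bar>t - s\<bar> powr \<gamma> * (1 + norm \<xi>) powr - \<rho>"
proof -
  let ?N = "path_law M T B"
  let ?d = "CARD('d)"
  define K where "K = nat \<lceil>\<rho>\<rceil>"
  have K: "\<rho> \<le> real K" using \<rho> by (simp add: K_def)
  define \<sigma> where "\<sigma> = \<theta> / H"
  define a b where "a = 2 - \<theta> - 2 * \<gamma>" and "b = \<sigma> - 2 * \<rho>"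
  have ab: "0 < a" "0 < b" using \<gamma> \<rho> H by (auto simp: a_def b_def \<sigma>_def field_simps)
  \<comment> \<open>\<open>a\<close> and \<open>b\<close> are the exponent gaps in time and in
    frequency; n is taken so large that they outweigh the number of dyadic intervals and of grid
    points.\<close>
  obtain n where n: "max (2 / a) ((real ((K + 1) * ?d) + 2) / b) < real n" using reals_Archimedean2 by blast
  have na: "2 \<le> real n * a" and nb: "real ((K + 1) * ?d) + 2 \<le> real n * b"
    using n ab by (auto simp: pos_divide_less_eq)
  have n1: "1 \<le> n" using na by (cases n) auto
  obtain C where C: "0 \<le> C" and mom: "\<And>\<xi> s t. 0 \<le> s \<Longrightarrow> s \<le> t \<Longrightarrow> t \<le> T \<Longrightarrow>
    (\<integral>\<^sup>+w. ennreal (cmod (osc w t \<xi> - osc w s \<xi>) ^ (2*n)) \<partial>?N)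
      \<le> ennreal (C * ((t - s) powr (2 - \<theta>)) ^ n * ((1 + norm \<xi>) powr - (\<theta> / H)) ^ n)"
    using osc_moment[OF H B \<theta>, of n] by blast
  define Y where "Y m i q w = cmod (osc w (T * (real i + 1) / 2 ^ m) q - osc w (T * real i / 2 ^ m) q)" for m i q and w :: "real \<Rightarrow> real^'d"
  define v where "v N m = (2 powr \<gamma>) ^ m * real (Suc N) powr \<rho>" for N m :: nat
  let ?blk = "\<lambda>N m w. \<Sum>q\<in>frequency_grid K (Suc N). \<Sum>i<2 ^ m. ennreal ((v N m * Y m i q w) ^ (2*n))"
  define S where "S w = (\<Sum>N. \<Sum>m. ?blk N m w)" for w
  define R where "R = 3 ^ ?d * C * (T powr (2 - \<theta>)) ^ n * ((1 + real ?d) powr \<sigma>) ^ n"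
  have R0: "0 \<le> R" using C by (simp add: R_def)
  have v0: "0 \<le> v N m" for N m by (simp add: v_def)
  have times: "0 \<le> T * real i / 2 ^ m" "T * real i / 2 ^ m \<le> T * (real i + 1) / 2 ^ m" "T * (real i + 1) / 2 ^ m \<le> T"
    if "i < 2 ^ m" for i m
  proof -
    have "real i + 1 \<le> 2 ^ m" using that by (metis Suc_leI of_nat_Suc of_nat_le_iff of_nat_numeral of_nat_power add.commute)
    then show "T * (real i + 1) / 2 ^ m \<le> T" using T by (simp add: pos_divide_le_eq)
  qed (use T in \<open>auto intro!: divide_right_mono\<close>)
  have Ym: "(\<lambda>w. Y m i q w) \<in> borel_measurable ?N" if "i < 2 ^ m" for m i q
    unfolding Y_def by (rule measurable_compose[OF osc_diff_measurable[OF times[OF that]] borel_measurable_norm])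
  have Zm: "(\<lambda>w. ennreal ((v N m * Y m i q w) ^ (2*n))) \<in> borel_measurable ?N" if "i < 2 ^ m" for N m i q
    using Ym[OF that] by measurable
  let ?p = "\<lambda>N. ((1 + real ?d) powr \<sigma> * real (Suc N) powr - \<sigma>) ^ n"
  have Z: "(\<integral>\<^sup>+w. ennreal ((v N m * Y m i q w) ^ (2*n)) \<partial>?N)
      \<le> ennreal (v N m ^ (2*n) * (C * ((T / 2 ^ m) powr (2 - \<theta>)) ^ n * ?p N))"
    if i: "i < 2 ^ m" and q: "q \<in> frequency_grid K (Suc N)" for N m i and q :: "real^'d"
  proof -
    have "(\<integral>\<^sup>+w. ennreal ((v N m * Y m i q w) ^ (2*n)) \<partial>?N) =
        (\<integral>\<^sup>+w. ennreal (v N m ^ (2*n)) * ennreal (Y m i q w ^ (2*n)) \<partial>?N)"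
      by (simp add: power_mult_distrib ennreal_mult v0 Y_def)
    also have "\<dots> = ennreal (v N m ^ (2*n)) * (\<integral>\<^sup>+w. ennreal (Y m i q w ^ (2*n)) \<partial>?N)"
      using Ym[OF i] by (intro nn_integral_cmult) measurable
    also have "\<dots> \<le> ennreal (v N m ^ (2*n)) * ennreal (C * ((T / 2 ^ m) powr (2 - \<theta>)) ^ n * ?p N)"
    proof (intro mult_left_mono)
      have diff: "T * (real i + 1) / 2 ^ m - T * real i / 2 ^ m = T / 2 ^ m" by (simp add: diff_divide_distrib[symmetric] algebra_simps)
      have "(1 + norm q) powr - \<sigma> \<le> (real (Suc N) / (1 + real ?d)) powr - \<sigma>"
      proof (rule powr_mono2')
        show "real (Suc N) / (1 + real ?d) \<le> 1 + norm q"
          using frequency_grid_norm[OF _ q] by (simp add: divide_le_eq mult.commute add_pos_nonneg)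
      qed (use \<theta> H in \<open>auto simp: \<sigma>_def add_pos_nonneg\<close>)
      also have "\<dots> = (1 + real ?d) powr \<sigma> * real (Suc N) powr - \<sigma>"
        by (rule powr_minus_quotient) auto
      finally have "((1 + norm q) powr - \<sigma>) ^ n \<le> ?p N"
        by (intro power_mono) auto
      then have "C * ((T / 2 ^ m) powr (2 - \<theta>)) ^ n * ((1 + norm q) powr - \<sigma>) ^ n \<le> C * ((T / 2 ^ m) powr (2 - \<theta>)) ^ n * ?p N"
        using C by (intro mult_left_mono) auto
      then show "(\<integral>\<^sup>+w. ennreal (Y m i q w ^ (2*n)) \<partial>?N) \<le> ennreal (C * ((T / 2 ^ m) powr (2 - \<theta>)) ^ n * ?p N)"
        using mom[OF times[OF i], of q] unfolding Y_def diff \<sigma>_def[symmetric] by (meson ennreal_leI order_trans)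
    qed simp
    finally show ?thesis using C v0 by (simp add: ennreal_mult[symmetric])
  qed
  have block: "(\<integral>\<^sup>+w. ?blk N m w \<partial>?N)
      \<le> ennreal (R * (1/2) ^ m * (1 / (real (Suc N))\<^sup>2))" for N m
  proof -
    let ?G = "frequency_grid K (Suc N) :: (real^'d) set"
    define E where "E = v N m ^ (2*n) * (C * ((T / 2 ^ m) powr (2 - \<theta>)) ^ n * ?p N)"
    have E0: "0 \<le> E" using C v0 by (simp add: E_def)
    have "(\<integral>\<^sup>+w. (\<Sum>q\<in>?G. \<Sum>i<2 ^ m. ennreal ((v N m * Y m i q w) ^ (2*n))) \<partial>?N) =
        (\<Sum>q\<in>?G. \<integral>\<^sup>+w. (\<Sum>i<2 ^ m. ennreal ((v N m * Y m i q w) ^ (2*n))) \<partial>?N)"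
      by (intro nn_integral_sum borel_measurable_sum Zm) simp
    also have "\<dots> = (\<Sum>q\<in>?G. \<Sum>i<2 ^ m. \<integral>\<^sup>+w. ennreal ((v N m * Y m i q w) ^ (2*n)) \<partial>?N)"
      by (intro sum.cong refl nn_integral_sum Zm) simp
    also have "\<dots> \<le> (\<Sum>q\<in>?G. \<Sum>i<2 ^ m::nat. ennreal E)"
      unfolding E_def by (intro sum_mono Z) auto
    also have "\<dots> = ennreal (real (card ?G) * 2 ^ m * E)"
      using E0 by (simp add: ennreal_mult ennreal_of_nat_eq_real_of_nat mult.assoc)
    also have "\<dots> \<le> ennreal ((3 * real (Suc N) ^ (K + 1)) ^ ?d * 2 ^ m * E)"
      using frequency_grid_card(2)[of "Suc N" K, where 'd = 'd] E0 by (intro ennreal_leI mult_right_mono) auto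
    also have "(3 * real (Suc N) ^ (K + 1)) ^ ?d * 2 ^ m * E =
       R * (2 ^ m * ((2 powr \<gamma>) ^ m) ^ (2*n) * ((1 / 2 ^ m) powr (2 - \<theta>)) ^ n)
         * ((real (Suc N) ^ (K + 1)) ^ ?d * (real (Suc N) powr \<rho>) ^ (2*n) * (real (Suc N) powr - \<sigma>) ^ n)"
    proof -
      have "(T / 2 ^ m) powr (2 - \<theta>) = T powr (2 - \<theta>) * (1 / 2 ^ m) powr (2 - \<theta>)"
        using T by (subst powr_mult[symmetric]) auto
      then show ?thesis by (simp only: E_def R_def v_def power_mult_distrib mult_ac)
    qed
    also have "ennreal \<dots> \<le> ennreal (R * (1/2) ^ m * (1 / (real (Suc N))\<^sup>2))"
      using R0 na nb unfolding a_def b_def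
      by (intro ennreal_leI mult_mono dyadic_weight_le frequency_weight_le mult_left_mono) auto
    finally show ?thesis .
  qed
  have bm: "?blk N m \<in> borel_measurable ?N" for N m
    by (intro borel_measurable_sum Zm) simp
  have bm': "(\<lambda>w. \<Sum>m. ?blk N m w) \<in> borel_measurable ?N" for N
    using bm by measurable
  have "(\<integral>\<^sup>+w. S w \<partial>?N) =
      (\<Sum>N. \<Sum>m. \<integral>\<^sup>+w. ?blk N m w \<partial>?N)"
    unfolding S_def by (simp only: nn_integral_suminf[OF bm'] nn_integral_suminf[OF bm])
  also have "\<dots> \<le> (\<Sum>N. \<Sum>m. ennreal (R * (1/2) ^ m * (1 / (real (Suc N))\<^sup>2)))"
    by (intro suminf_le block summableI)
  also have "\<dots> < \<infinity>" by (rule suminf_double_finite[OF R0])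
  finally have "(\<integral>\<^sup>+w. S w \<partial>?N) \<noteq> \<infinity>" by simp
  moreover have "S \<in> borel_measurable ?N"
    unfolding S_def[abs_def] using bm' by measurable
  ultimately have "AE w in ?N. S w \<noteq> \<infinity>" by (intro nn_integral_PInf_AE)
  then show ?thesis
  proof (rule AE_mp, intro AE_I2 impI)
    fix w assume w: "w \<in> space ?N" and fin: "S w \<noteq> \<infinity>"
    define s0 where "s0 = enn2real (S w)"
    have s0: "S w = ennreal s0" "0 \<le> s0" using fin by (auto simp: s0_def top.not_eq_extremum)
    show "\<exists>C. \<forall>s t \<xi>. 0 \<le> s \<longrightarrow> s \<le> t \<longrightarrow> t \<le> T \<longrightarrow> cmod (osc w t \<xi> - osc w s \<xi>) \<le> C * \<bar>t - s\<bar> powr \<gamma> * (1 + norm \<xi>) powr - \<rho>"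
    proof (rule irregularity_from_grid[OF T path_law_continuous[OF w] \<gamma>(1) _ \<rho>(1) K])
      show "\<gamma> \<le> 1" using \<gamma> \<theta> by simp
      show "0 \<le> 1 + s0" using s0 by simp
      fix N m i :: nat and q :: "real^'d" assume q: "q \<in> frequency_grid K (Suc N)" and i: "i < 2 ^ m"
      have "ennreal ((v N m * Y m i q w) ^ (2*n)) \<le> (\<Sum>i<2 ^ m. ennreal ((v N m * Y m i q w) ^ (2*n)))"
        using i by (intro member_le_sum) auto
      also have "\<dots> \<le> ?blk N m w"
        using q frequency_grid_card(1)[of "Suc N" K, where 'd = 'd] by (intro member_le_sum) auto
      also have "\<dots> \<le> (\<Sum>m. ?blk N m w)"
        by (rule term_le_suminf_ennreal)
      also have "\<dots> \<le> S w" unfolding S_def by (rule term_le_suminf_ennreal)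
      finally have "(v N m * Y m i q w) ^ (2*n) \<le> s0" using s0 by (simp add: ennreal_le_iff)
      then have "v N m * Y m i q w \<le> 1 + s0" using n1 s0 by (intro le_of_power_le[of _ "2*n"]) auto
      then show "(2 powr \<gamma>) ^ m * real (Suc N) powr \<rho> * cmod (osc w (T * (real i + 1) / 2 ^ m) q - osc w (T * real i / 2 ^ m) q) \<le> 1 + s0"
        by (simp add: v_def Y_def)
    qed
  qed
qed

theorem corollary1p5:
  fixes H \<rho> T :: real
  assumes "0 < H" and "H < 1" and "\<rho> < 1 / (2 * H)" and "0 < T"
  shows "\<exists>\<gamma>>1/2. \<forall>(M :: 'w measure) (B :: real \<Rightarrow> 'w \<Rightarrow> real^'d).
    fractional_brownian_motion M H T B \<longrightarrow>
    (AE w in path_law M T B. \<exists>C::real. \<forall>\<alpha>::real.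
       (\<forall>t\<in>{0..T}. FL_bounded_operator \<alpha> (\<alpha> + \<rho>) (averaging w t)) \<and>
       (\<forall>s t. 0 \<le> s \<longrightarrow> s \<le> t \<longrightarrow> t \<le> T \<longrightarrow>
          FL_onorm \<alpha> (\<alpha> + \<rho>) (\<lambda>f \<phi>. averaging w t f \<phi> - averaging w s f \<phi>)
            \<le> C * \<bar>t - s\<bar> powr \<gamma>))"
proof -
  \<comment> \<open>Irregularity is proved for the positive exponent r. Since 1 + |\<xi>| \<ge> 1,
    it implies the bound for every smaller exponent, so nonpositive \<open>\<rho>\<close> are
    covered; 1 / (4H) is just some point between 0 and 1 / (2H).\<close>
  define r where "r = max \<rho> (1 / (4 * H))"
  have "0 < 1 / (4 * H)" "1 / (4 * H) < 1 / (2 * H)" using assms by (simp_all add: field_simps)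
  then have r: "0 < r" "r < 1 / (2 * H)" "\<rho> \<le> r" using assms by (auto simp: r_def less_max_iff_disj)
  have "2 * H * r < 1" using r assms by (simp add: field_simps)
  \<comment> \<open>2 H r < \<theta> makes \<open>r\<close> admissible in
    \<open>irregularity_AE\<close>, and \<theta> < 1 leaves room for \<gamma> strictly between 1/2
    and 1 - \<theta>/2. Both are chosen before the process, from H and \<rho>.\<close>
  then obtain \<theta> where \<theta>: "2 * H * r < \<theta>" "\<theta> < 1" using dense by blast
  have \<theta>': "0 < \<theta>" "r < \<theta> / (2 * H)"
    using \<theta> r assms less_trans[OF mult_pos_pos[of "2 * H" r] \<theta>(1)] by (auto simp: field_simps)
  have "1/2 < 1 - \<theta> / 2" using \<theta> by simp
  then obtain \<gamma> where \<gamma>: "1/2 < \<gamma>" "\<gamma> < 1 - \<theta> / 2" using dense by blast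
  have \<gamma>0: "0 < \<gamma>" using \<gamma> by simp
  show ?thesis
  proof (intro exI[of _ \<gamma>] conjI allI impI)
    show "1/2 < \<gamma>" by (rule \<gamma>)
    fix M :: "'w measure" and B :: "real \<Rightarrow> 'w \<Rightarrow> real^'d"
    assume B: "fractional_brownian_motion M H T B"
    show "AE w in path_law M T B. \<exists>C::real. \<forall>\<alpha>::real.
       (\<forall>t\<in>{0..T}. FL_bounded_operator \<alpha> (\<alpha> + \<rho>) (averaging w t)) \<and>
       (\<forall>s t. 0 \<le> s \<longrightarrow> s \<le> t \<longrightarrow> t \<le> T \<longrightarrow>
          FL_onorm \<alpha> (\<alpha> + \<rho>) (\<lambda>f \<phi>. averaging w t f \<phi> - averaging w s f \<phi>)
            \<le> C * \<bar>t - s\<bar> powr \<gamma>)"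
      using irregularity_AE[OF assms(1,2,4) B \<theta>'(1) \<theta>(2) r(1) \<theta>'(2) \<gamma>0 \<gamma>(2)]
    proof (rule AE_mp, intro AE_I2 impI)
      fix w assume "w \<in> space (path_law M T B)"
      then have w: "continuous_on {0..T} w" by (rule path_law_continuous)
      assume "\<exists>C. \<forall>s t \<xi>. 0 \<le> s \<longrightarrow> s \<le> t \<longrightarrow> t \<le> T \<longrightarrow>
        cmod (osc w t \<xi> - osc w s \<xi>) \<le> C * \<bar>t - s\<bar> powr \<gamma> * (1 + norm \<xi>) powr - r"
      then obtain C where C: "\<And>s t \<xi>. 0 \<le> s \<Longrightarrow> s \<le> t \<Longrightarrow> t \<le> T \<Longrightarrow>
        cmod (osc w t \<xi> - osc w s \<xi>) \<le> C * \<bar>t - s\<bar> powr \<gamma> * (1 + norm \<xi>) powr - r" by blast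
      have C': "cmod (osc w t \<xi> - osc w s \<xi>) \<le> \<bar>C\<bar> * \<bar>t - s\<bar> powr \<gamma> * (1 + norm \<xi>) powr - \<rho>"
        if "0 \<le> s" "s \<le> t" "t \<le> T" for s t \<xi>
      proof -
        have "C * \<bar>t - s\<bar> powr \<gamma> * (1 + norm \<xi>) powr - r \<le> \<bar>C\<bar> * \<bar>t - s\<bar> powr \<gamma> * (1 + norm \<xi>) powr - \<rho>"
          using r(3) by (intro mult_mono[OF mult_mono[OF abs_ge_self order_refl]] powr_mono) auto
        then show ?thesis using C[OF that, of \<xi>] by linarith
      qed
      \<comment> \<open>The witness is fixed before \<alpha>, as the bound on \<open>osc\<close>
        does not involve \<alpha>.\<close>
      show "\<exists>C::real. \<forall>\<alpha>::real.
       (\<forall>t\<in>{0..T}. FL_bounded_operator \<alpha> (\<alpha> + \<rho>) (averaging w t)) \<and>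
       (\<forall>s t. 0 \<le> s \<longrightarrow> s \<le> t \<longrightarrow> t \<le> T \<longrightarrow>
          FL_onorm \<alpha> (\<alpha> + \<rho>) (\<lambda>f \<phi>. averaging w t f \<phi> - averaging w s f \<phi>)
            \<le> C * \<bar>t - s\<bar> powr \<gamma>)"
        using averaging_FL_bounds[OF w C'] by (intro exI[of _ "\<bar>C\<bar>"]) blast
    qed
  qed
qed

end
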